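(* (1) For any $\phi\in\mathcal B$ and any $z=a+ib$ with $a>0$, $$|W_\phi(z)|=\frac{\sqrt{\phi(1)}}{\sqrt{\phi(a)\phi(1+a)|\phi(z)|}}\,e^{G_\phi(a)-A_\phi(z)}\,e^{-E_\phi(z)-R_\phi(a)}.$$ For any $a>0$, $$\sup_{\phi\in\mathcal B}\ \sup_{z\in\mathbb C_{(a,\infty)}}\big|e^{-E_\phi(z)-R_\phi(\Re(z))}\big|\asymp1,$$ that is, this supremum lies between two positive finite constants. (2) Let $\phi\in\mathcal B$. For any fixed $b\in\mathbb R$, as $a\to\infty$, $$|W_\phi(a+ib)|=\frac{e^{-T_\phi}}{\sqrt{|\phi(a+ib)|\,\phi(1)}}\,e^{a\ln\phi(a)-H_\phi(a)+H_\phi^*(a)-A_\phi(a+ib)}\Big(1+O\Big(\frac1a\Big)\Big),$$ where $\lim_{a\to\infty}A_\phi(a+ib)=0$. (3) Let $\phi\in\mathcal B$. (a) If $\mathtt d>0$ then $\phi\in\mathcal B_{\mathcal E}(\frac\pi2)$. (b) If $\phi\in\mathcal B_\alpha$ for some $\alpha\in(0,1)$, then $\phi\in\mathcal B_{\mathcal E}(\frac\pi2\alpha)$. (c) Let $\mathtt d=0$ and $\mu(dy)=\upsilon(y)dy$. If $\upsilon(0^+)<\infty$ exists and $\sup_{y\ge0}\upsilon(y)<\infty$, then $\phi\in\mathcal B_{\mathcal P}(\mathtt N_\phi)$ with $\mathtt N_\phi=\frac{\upsilon(0^+)}{\phi(\infty)}$. If $\upsilon(0^+)=\infty$ and $\upsilon=\upsilon_1+\upsilon_2$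 with $\upsilon_1,\upsilon_2\in L^1(\mathbb R^+)$, $\upsilon_1\ge0$ non-increasing on $\mathbb R^+$, $\int_0^\infty\upsilon_2(y)dy\ge0$ and $|\upsilon_2(y)|\le\big(\int_y^\infty\upsilon_1(r)dr\big)\vee C$ for some $C>0$, then $\phi\in\mathcal B_{\mathcal P}(\infty)$.
   Context: $\mathbb C_{(a,\infty)}=\{\Re z>a\}$, $\mathbb R^+=(0,\infty)$; $\arg$ takes values in $(-\pi,\pi]$. $\mathcal B$: Bernstein functions $\phi\not\equiv0$, $\phi(z)=\phi(0)+\mathtt dz+\int_0^\infty(1-e^{-zy})\mu(dy)$, $\Re z\ge0$, with $\phi(0),\mathtt d\ge0$, $\int_0^\infty(1\wedge y)\mu(dy)<\infty$; $\bar\mu(y)=\int_y^\infty\mu(dr)$; $\phi(\infty)=\lim_{u\to\infty}\phi(u)$. $\mathfrak a_\phi=\inf\{u<0:\phi\text{ holomorphic on }\Re z>u\}$, $\mathfrak u_\phi=\sup\{u\in[\mathfrak a_\phi,0]:\phi(u)=0\}$, $\overline{\mathfrak a}_\phi=\max\{\mathfrak a_\phi,\mathfrak u_\phi\}$ ($\inf\emptyset=0$, $\sup\emptyset=-\infty$). $W_\phi(z)=\frac{e^{-\gamma_\phi z}}{\phi(z)}\prod_{k=1}^\infty\frac{\phi(k)}{\phi(k+z)}e^{\frac{\phi'(k)}{\phi(k)}z}$, $\Re z>0$, $\gamma_\phi=\lim_n\big(\sum_{k=1}^n\frac{\phi'(k)}{\phi(k)}-\ln\phi(n)\big)$; it satisfies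 $W_\phi(1)=1$, $W_\phi(z+1)=\phi(z)W_\phi(z)$ and is extended by this recurrence (holomorphically on $\Re z>\overline{\mathfrak a}_\phi$). For $z=a+ib$, $a>0$, with $\mathrm P(u)=(u-\lfloor u\rfloor)(1-(u-\lfloor u\rfloor))$ and derivatives under the integrals taken in $u$: $A_\phi(z)=\int_0^b\arg\phi(a+iu)\,du$; $G_\phi(a)=\int_1^{1+a}\ln\phi(u)\,du$; $H_\phi(a)=\int_1^{1+a}\frac{u\phi'(u)}{\phi(u)}du$; $H_\phi^*(a)=a\frac{\phi(a+1)-\phi(a)}{\phi(a)}$; $E_\phi(z)=\frac12\int_0^\infty\mathrm P(u)\Big(\ln\frac{|\phi(u+z)|}{\phi(u+a)}\Big)''du$; $R_\phi(a)=\frac12\int_1^\infty\mathrm P(u)\Big(\ln\frac{\phi(u+a)}{\phi(u)}\Big)''du$; $T_\phi=-\frac12\int_1^\infty\mathrm P(u)(\ln\phi(u))''du$. Decay classes: for $\beta\in[0,\infty)$, $\mathcal B_{\mathcal P}(\beta)$ is the set of $\phi\in\mathcal B$ with $\lim_{|b|\to\infty}\frac{|W_\phi(a+ib)|}{|b|^{-\beta+\varepsilon}}=\lim_{|b|\to\infty}\frac{|b|^{-\beta-\varepsilon}}{|W_\phi(a+ib)|}=0$ for all $a>\overline{\mathfrak a}_\phi$, $\varepsilon>0$; $\mathcal B_{\mathcal P}(\infty)$ is the set with $\lim_{|b|\to\infty}|b|^\beta|W_\phi(a+ib)|=0$ for all $a>\overline{\mathfrak a}_\phi$, $\beta\ge0$;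 for $\theta\in(0,\frac\pi2]$, $\mathcal B_{\mathcal E}(\theta)$ is the set with $\limsup_{|b|\to\infty}\frac{\ln|W_\phi(a+ib)|}{|b|}\le-\theta$ for all $a>\overline{\mathfrak a}_\phi$. $\mathcal B_\alpha$, $\alpha\in(0,1)$: those $\phi\in\mathcal B$ with $\mathtt d=0$ and $\bar\mu(y)=y^{-\alpha}\ell(y)$, $\ell$ slowly varying at $0$ and quasi-monotone, i.e. of bounded variation in a neighbourhood of $0$ with $\int_0^xy^\gamma|d\ell(y)|=O(x^\gamma\ell(x))$ as $x\to0$ for every $\gamma>0$. *)

theory Defs
  imports "HOL-Analysis.Analysis" "HOL-Library.Landau_Symbols"
begin

subsection \<open>Bernstein functions\<close>

text \<open>A measure on the open half-line is encoded as a Borel measure on the reals which does not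
  charge the complement. The values of \<open>\<phi>\<close> on \<open>Re z < 0\<close> are unconstrained, and no notion below
  depends on them: to the left of the imaginary axis \<open>bernstein_ext \<phi>\<close> is used instead.\<close>

definition levy_khintchine ::
    "(complex \<Rightarrow> complex) \<Rightarrow> real \<Rightarrow> real \<Rightarrow> real measure \<Rightarrow> bool" where
  "levy_khintchine \<phi> q d \<mu> \<longleftrightarrow>
     0 \<le> q \<and> 0 \<le> d \<and> sets \<mu> = sets borel \<and> emeasure \<mu> {..0} = 0 \<and>
     (\<integral>\<^sup>+ y. ennreal (min 1 y) \<partial>\<mu>) < \<infinity> \<and>
     (\<forall>z. 0 \<le> Re z \<longrightarrow>
        \<phi> z = of_real q + of_real d * z + (LINT y|\<mu>. 1 - exp (- z * of_real y)))"

definition bernstein_functions :: "(complex \<Rightarrow> complex) set" where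
  "bernstein_functions =
     {\<phi>. (\<exists>q d \<mu>. levy_khintchine \<phi> q d \<mu>) \<and> (\<exists>z. 0 \<le> Re z \<and> \<phi> z \<noteq> 0)}"

definition on_reals :: "(complex \<Rightarrow> complex) \<Rightarrow> real \<Rightarrow> real" where
  "on_reals \<phi> u = Re (\<phi> (of_real u))"

definition bernstein_limit :: "(complex \<Rightarrow> complex) \<Rightarrow> ereal" where
  "bernstein_limit \<phi> = Lim at_top (\<lambda>u. ereal (on_reals \<phi> u))"

definition holomorphic_extension ::
    "(complex \<Rightarrow> complex) \<Rightarrow> real \<Rightarrow> (complex \<Rightarrow> complex) \<Rightarrow> bool" where
  "holomorphic_extension \<phi> u f \<longleftrightarrow>
     f holomorphic_on {z. u < Re z} \<and> (\<forall>z. 0 \<le> Re z \<longrightarrow> f z = \<phi> z)"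

text \<open>The description is unique by the identity theorem.\<close>

definition bernstein_ext :: "(complex \<Rightarrow> complex) \<Rightarrow> complex \<Rightarrow> complex" where
  "bernstein_ext \<phi> z =
     (if 0 \<le> Re z then \<phi> z
      else (THE w. \<exists>u f. u < Re z \<and> holomorphic_extension \<phi> u f \<and> w = f z))"

definition a_index :: "(complex \<Rightarrow> complex) \<Rightarrow> ereal" where
  "a_index \<phi> =
     (let S = {u. u < 0 \<and> (\<exists>f. holomorphic_extension \<phi> u f)}
      in if S = {} then 0 else Inf (ereal ` S))"

text \<open>For \<open>u > \<aa>\<^sub>\<phi>\<close>, and for \<open>u = 0\<close>, the limit condition says \<open>\<phi>(u) = 0\<close>, because \<open>\<phi>\<close> is
  right-continuous there; at a finite endpoint \<open>u = \<aa>\<^sub>\<phi> < 0\<close> it gives \<open>\<phi>(u)\<close> its meaning as a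
  boundary value. \<open>Sup\<close> in \<^typ>\<open>ereal\<close> satisfies \<open>Sup {} = - \<infinity>\<close>.\<close>

definition u_index :: "(complex \<Rightarrow> complex) \<Rightarrow> ereal" where
  "u_index \<phi> =
     Sup (ereal ` {u. a_index \<phi> \<le> ereal u \<and> u \<le> 0 \<and>
                      ((\<lambda>v. bernstein_ext \<phi> (of_real v)) \<longlongrightarrow> 0) (at_right u)})"

definition abar_index :: "(complex \<Rightarrow> complex) \<Rightarrow> ereal" where
  "abar_index \<phi> = max (a_index \<phi>) (u_index \<phi>)"


subsection \<open>Bernstein-gamma functions\<close>

definition gamma_const :: "(complex \<Rightarrow> complex) \<Rightarrow> real" where
  "gamma_const \<phi> =
     lim (\<lambda>n. (\<Sum>k=1..n. deriv (on_reals \<phi>) (real k) / on_reals \<phi> (real k))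
              - ln (on_reals \<phi> (real n)))"

definition W_right :: "(complex \<Rightarrow> complex) \<Rightarrow> complex \<Rightarrow> complex" where
  "W_right \<phi> z =
     exp (- of_real (gamma_const \<phi>) * z) / \<phi> z *
     (\<Prod>k. \<phi> (of_nat (Suc k)) / \<phi> (of_nat (Suc k) + z) *
           exp (deriv \<phi> (of_nat (Suc k)) / \<phi> (of_nat (Suc k)) * z))"

text \<open>The extension by \<open>W(z) = W(z + n) / (\<phi>(z) \<dots> \<phi>(z + n - 1))\<close>, with \<open>n\<close> minimal such that
  \<open>z + n\<close> lies in the right half-plane; \<open>n = 0\<close> for \<open>Re z > 0\<close>.\<close>

definition W :: "(complex \<Rightarrow> complex) \<Rightarrow> complex \<Rightarrow> complex" where
  "W \<phi> z =
     (let n = (LEAST n::nat. 0 < Re z + real n)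
      in W_right \<phi> (z + of_nat n) / (\<Prod>j<n. bernstein_ext \<phi> (z + of_nat j)))"


subsection \<open>The functionals in the Stirling-type representation\<close>

definition P :: "real \<Rightarrow> real" where
  "P u = frac u * (1 - frac u)"

definition A :: "(complex \<Rightarrow> complex) \<Rightarrow> complex \<Rightarrow> real" where
  "A \<phi> z = (LBINT u=0..ereal (Im z). Arg (\<phi> (Complex (Re z) u)))"

definition G :: "(complex \<Rightarrow> complex) \<Rightarrow> real \<Rightarrow> real" where
  "G \<phi> a = (LBINT u=1..ereal (1 + a). ln (on_reals \<phi> u))"

definition H :: "(complex \<Rightarrow> complex) \<Rightarrow> real \<Rightarrow> real" where
  "H \<phi> a = (LBINT u=1..ereal (1 + a). u * deriv (on_reals \<phi>) u / on_reals \<phi> u)"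

definition Hstar :: "(complex \<Rightarrow> complex) \<Rightarrow> real \<Rightarrow> real" where
  "Hstar \<phi> a = a * ((on_reals \<phi> (a + 1) - on_reals \<phi> a) / on_reals \<phi> a)"

definition E :: "(complex \<Rightarrow> complex) \<Rightarrow> complex \<Rightarrow> real" where
  "E \<phi> z = 1 / 2 * (LBINT u=0..\<infinity>. P u *
     (deriv ^^ 2) (\<lambda>v. ln (cmod (\<phi> (of_real v + z)) / on_reals \<phi> (v + Re z))) u)"

definition R :: "(complex \<Rightarrow> complex) \<Rightarrow> real \<Rightarrow> real" where
  "R \<phi> a = 1 / 2 * (LBINT u=1..\<infinity>. P u *
     (deriv ^^ 2) (\<lambda>v. ln (on_reals \<phi> (v + a) / on_reals \<phi> v)) u)"

definition T :: "(complex \<Rightarrow> complex) \<Rightarrow> real" where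
  "T \<phi> = - 1 / 2 * (LBINT u=1..\<infinity>. P u * (deriv ^^ 2) (\<lambda>v. ln (on_reals \<phi> v)) u)"


subsection \<open>Decay classes\<close>

text \<open>On the reals, \<^const>\<open>at_infinity\<close> is the filter of \<open>\<bar>b\<bar> \<rightarrow> \<infinity>\<close>.\<close>

definition poly_class :: "real \<Rightarrow> (complex \<Rightarrow> complex) set" where
  "poly_class \<beta> = {\<phi> \<in> bernstein_functions.
     \<forall>a \<epsilon>. abar_index \<phi> < ereal a \<and> 0 < \<epsilon> \<longrightarrow>
       ((\<lambda>b. cmod (W \<phi> (Complex a b)) / \<bar>b\<bar> powr (- \<beta> + \<epsilon>)) \<longlongrightarrow> 0) at_infinity \<and>
       ((\<lambda>b. \<bar>b\<bar> powr (- \<beta> - \<epsilon>) / cmod (W \<phi> (Complex a b))) \<longlongrightarrow> 0) at_infinity}"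

definition poly_class_infinity :: "(complex \<Rightarrow> complex) set" where
  "poly_class_infinity = {\<phi> \<in> bernstein_functions.
     \<forall>a \<beta>. abar_index \<phi> < ereal a \<and> 0 \<le> \<beta> \<longrightarrow>
       ((\<lambda>b. \<bar>b\<bar> powr \<beta> * cmod (W \<phi> (Complex a b))) \<longlongrightarrow> 0) at_infinity}"

definition exp_class :: "real \<Rightarrow> (complex \<Rightarrow> complex) set" where
  "exp_class \<theta> = {\<phi> \<in> bernstein_functions.
     \<forall>a. abar_index \<phi> < ereal a \<longrightarrow>
       Limsup at_infinity (\<lambda>b. ereal (ln (cmod (W \<phi> (Complex a b))) / \<bar>b\<bar>)) \<le> ereal (- \<theta>)}"


subsection \<open>Regularly varying tails\<close>

definition slowly_varying_at_0 :: "(real \<Rightarrow> real) \<Rightarrow> bool" where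
  "slowly_varying_at_0 l \<longleftrightarrow>
     set_borel_measurable borel {0<..} l \<and> (\<forall>\<^sub>F y in at_right 0. 0 < l y) \<and>
     (\<forall>c>0. ((\<lambda>y. l (c * y) / l y) \<longlongrightarrow> 1) (at_right 0))"

definition total_variation :: "(real \<Rightarrow> real) \<Rightarrow> real \<Rightarrow> real \<Rightarrow> ennreal" where
  "total_variation f s t =
     (SUP xs\<in>{xs. sorted xs \<and> set xs \<subseteq> {s..t}}.
        \<Sum>i<length xs - 1. ennreal \<bar>f (xs ! Suc i) - f (xs ! i)\<bar>)"

text \<open>The measure \<open>\<nu>\<close> is \<open>|dl|\<close>, characterised by its values on half-open intervals; this presupposes
  right-continuous \<open>l\<close>, which holds for \<open>l(y) = y\<^sup>\<alpha> \<mu>(y, \<infinity>)\<close>. Bounded variation near \<open>0\<close> is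
  understood locally on \<open>(0, \<delta>]\<close>, as is usual for quasi-monotone functions: the variation on
  \<open>(0, \<delta>]\<close> itself is infinite for, e.g., \<open>l(y) = ln (1 / y)\<close>. Functions of finite variation on all
  of \<open>(0, \<delta>]\<close> are included.\<close>

definition quasi_monotone_at_0 :: "(real \<Rightarrow> real) \<Rightarrow> bool" where
  "quasi_monotone_at_0 l \<longleftrightarrow>
     (\<exists>\<delta> \<nu>. 0 < \<delta> \<and> sets \<nu> = sets borel \<and>
        (\<forall>s t. 0 < s \<and> s \<le> t \<and> t \<le> \<delta> \<longrightarrow>
           total_variation l s t < \<infinity> \<and> emeasure \<nu> {s<..t} = total_variation l s t) \<and>
        (\<forall>g>0. \<exists>C. \<forall>\<^sub>F x in at_right 0.
           (\<integral>\<^sup>+ y\<in>{0<..x}. ennreal (y powr g) \<partial>\<nu>) \<le> ennreal (C * (x powr g * l x))))"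

definition regular_class :: "real \<Rightarrow> (complex \<Rightarrow> complex) set" where
  "regular_class \<alpha> = {\<phi> \<in> bernstein_functions.
     \<exists>q \<mu> l. levy_khintchine \<phi> q 0 \<mu> \<and>
       (\<forall>y>0. measure \<mu> {y<..} = y powr (- \<alpha>) * l y) \<and>
       slowly_varying_at_0 l \<and> quasi_monotone_at_0 l}"

text \<open>\<open>\<mu>(dy) = v(y) dy\<close> on the open half-line\<close>

definition has_density :: "real measure \<Rightarrow> (real \<Rightarrow> real) \<Rightarrow> bool" where
  "has_density \<mu> v \<longleftrightarrow>
     set_borel_measurable borel {0<..} v \<and> (\<forall>y>0. 0 \<le> v y) \<and>
     \<mu> = density lborel (\<lambda>y. ennreal (indicator {0<..} y * v y))"

end

theory Submission
  imports Defs "HOL-Complex_Analysis.Complex_Analysis" "HOL-Real_Asymp.Real_Asymp"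
begin

text \<open>
  The proof rests on two facts about a Bernstein function \<open>\<phi>\<close> on the right half-plane, both immediate from the
  Levy-Khintchine integral: \<open>Re \<phi>(z) \<ge> \<phi>(Re z) > 0\<close> and \<open>\<bar>\<phi>'(z)\<bar> Re z \<le> \<phi>(Re z)\<close>. Hence \<open>ln \<phi>\<close> is holomorphic there, its
  derivative is bounded by \<open>1 / Re z\<close>, and by Cauchy's inequality its second derivative is bounded by \<open>4 / (Re z)\<^sup>2\<close>, with
  constants independent of \<open>\<phi>\<close>.

  For the representation of \<open>\<bar>W(z)\<bar>\<close>, the Weierstrass product becomes a Gauss-type limit of sums of \<open>ln \<bar>\<phi>(k + z)\<bar>\<close> and
  \<open>ln \<phi>(k)\<close> (\<open>W_limit\<close>). The trapezoidal rule with its remainder written through \<open>P\<close> (\<open>trapezoid_limit\<close>)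
  turns the sums into integrals, and these are differences of a primitive of \<open>ln \<phi>\<close>, which yields \<open>A\<close> and \<open>G\<close> with
  the remainders \<open>E\<close> and \<open>R\<close> (\<open>ln_norm_W\<close>). The bounds on the second derivative make \<open>E\<close> and \<open>R\<close> bounded
  uniformly in \<open>\<phi>\<close>, and make all errors in the asymptotics along the real direction of order \<open>1 / a\<close>.

  On a vertical line only \<open>A(a + i b)\<close> can be large, apart from the explicit factor \<open>\<bar>\<phi>(z)\<bar>\<close>. Moving the path of integration to the
  right gives \<open>A(a + i b) = \<integral> ln (\<bar>\<phi>(x + i b)\<bar> / \<phi>(x)) dx\<close> over \<open>x > a\<close>, with a nonnegative integrand
  (\<open>A_eq_modulus_integral\<close>). The three decay statements are read off from this integral.
  If \<open>\<phi>(t w) / \<phi>(t s)\<close> behaves like \<open>(w / s) powr \<alpha>\<close> for large \<open>t\<close>, then scaling \<open>x = b s\<close> and Fatou's lemma give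
  \<open>A(a + i b) / b\<close> a lower limit of at least \<open>\<pi> \<alpha> / 2\<close>; a positive drift gives \<open>\<alpha> = 1\<close>, and a regularly varying tail gives its
  index by dominated convergence. If the Levy measure is finite with density \<open>v\<close>, the integral is, up to bounded errors or
  constant factors, \<open>\<integral> exp (- a y) (1 - cos (b y)) / y v(y) dy\<close>, which grows like \<open>v(0+) ln b\<close>
  when \<open>v\<close> has a finite limit at 0, and faster than any multiple of \<open>ln b\<close> when \<open>v\<close> tends to infinity there.

  To the left of the imaginary axis, the Landau-Pringsheim principle (\<open>exp_moment_extend\<close>) identifies every
  holomorphic extension of \<open>\<phi>\<close> with the Levy-Khintchine integral. Therefore the factors in the recurrence for \<open>W\<close> are bounded
  away from zero on vertical lines, and the decay passes to all admissible abscissae.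
\<close>

section \<open>Laplace-type integrals of Levy measures\<close>

text \<open>The factor min 1 y is the weight in the definition of a Levy measure, so \<open>c = 0\<close> gives exactly the
  integrability of Levy measures. The values \<open>c < 0\<close> describe by how much the Levy-Khintchine integral
  extends to the left of the imaginary axis.\<close>

definition exp_moment :: "real measure \<Rightarrow> real \<Rightarrow> bool" where
  "exp_moment \<mu> c \<longleftrightarrow> sets \<mu> = sets borel \<and> emeasure \<mu> {..0} = 0 \<and>
     integrable \<mu> (\<lambda>y. min 1 y * exp (- c * y))"

text \<open>Up to sign the \<open>n\<close>-th derivative of the Laplace transform of \<open>\<mu>\<close>. As \<open>\<mu>\<close> may have infinite mass,
  the case \<open>n = 0\<close> is renormalised by subtracting 1 under the integral, which is invisible to all
  derivatives; the Levy-Khintchine integral is then linear in \<open>lap \<mu> 0\<close>.\<close>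

definition lap :: "real measure \<Rightarrow> nat \<Rightarrow> complex \<Rightarrow> complex" where
  "lap \<mu> n z = (LINT y|\<mu>. of_real (y ^ n) * exp (- z * of_real y) - (if n = 0 then 1 else 0))"

lemma AE_pos:
  assumes "sets \<mu> = sets borel" "emeasure \<mu> {..0} = 0"
  shows "AE y in \<mu>. 0 < (y::real)"
proof (rule AE_I)
  show "{y \<in> space \<mu>. \<not> 0 < y} \<subseteq> {..0}" by auto
qed (use assms in auto)

lemma power_div_fact_le_exp:
  assumes "0 \<le> (t::real)"
  shows "t ^ m / fact m \<le> exp t"
proof -
  have "(\<lambda>n. t ^ n / fact n) sums exp t"
    using exp_converges[of t] by (simp add: field_simps)
  hence sm: "summable (\<lambda>n. t ^ n / fact n)" and eq: "(\<Sum>n. t ^ n / fact n) = exp t"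
    by (auto simp: sums_iff)
  have "(\<Sum>n\<in>{m}. t ^ n / fact n) \<le> (\<Sum>n. t ^ n / fact n)"
    using assms by (intro sum_le_suminf[OF sm]) auto
  thus ?thesis using eq by simp
qed

lemma power_exp_le_min:
  assumes "0 < \<eta>" "0 < m" "0 \<le> (y::real)"
  shows "y ^ m * exp (- \<eta> * y) \<le> (1 + fact m / \<eta> ^ m) * min 1 y"
proof (cases "y \<le> 1")
  case True
  have "y ^ m \<le> y ^ 1" using assms True by (intro power_decreasing) auto
  moreover have "exp (- \<eta> * y) \<le> 1" using assms by simp
  ultimately have "y ^ m * exp (- \<eta> * y) \<le> y * 1"
    using assms by (intro mult_mono) auto
  also have "\<dots> \<le> (1 + fact m / \<eta> ^ m) * y"
    using assms by (simp add: algebra_simps)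
  finally show ?thesis using True by (simp add: min_def)
next
  case False
  have "(\<eta> * y) ^ m / fact m \<le> exp (\<eta> * y)"
    using assms by (intro power_div_fact_le_exp) auto
  hence "(\<eta> * y) ^ m * exp (- \<eta> * y) \<le> fact m"
    by (simp add: exp_minus field_simps)
  hence "y ^ m * exp (- \<eta> * y) \<le> fact m / \<eta> ^ m"
    using assms by (simp add: field_simps power_mult_distrib)
  thus ?thesis using False by simp
qed

text \<open>The mean value inequality on the segment from 0 to \<open>w\<close>, on which the derivative of exp has modulus
  at most \<open>max 1 (exp (Re w))\<close>.\<close>

lemma norm_exp_diff_1_le: "norm (exp w - 1) \<le> norm w * max 1 (exp (Re w))" for w :: complex
proof -
  have "norm (exp w - exp 0) \<le> max 1 (exp (Re w)) * norm (w - 0)"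
  proof (rule field_differentiable_bound)
    show "convex (closed_segment 0 w)" by simp
    show "(exp has_field_derivative exp x) (at x within closed_segment 0 w)" for x :: complex
      by (rule DERIV_subset[OF DERIV_exp]) auto
    show "norm (exp x) \<le> max 1 (exp (Re w))" if x: "x \<in> closed_segment 0 w" for x
    proof -
      obtain t where t: "0 \<le> t" "t \<le> 1" "x = of_real t * w"
        using x unfolding in_segment scaleR_conv_of_real by auto
      have "Re x \<le> max 0 (Re w)"
        using t mult_left_le_one_le[of "Re w" t] mult_nonneg_nonpos[of t "Re w"] by (cases "0 \<le> Re w") auto
      hence "exp (Re x) \<le> exp (max 0 (Re w))" by simp
      also have "\<dots> = max 1 (exp (Re w))" by (auto simp: max_def)
      finally show ?thesis by simp
    qed
  qed auto
  thus ?thesis by (simp add: mult.commute)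
qed

text \<open>For \<open>y \<le> 1\<close> the increment is linear in \<open>y\<close>, for \<open>y > 1\<close> both terms are bounded by the exponential
  weight; this is why integrability of the weight \<open>min 1 y * exp (- c * y)\<close> is the right condition.\<close>

lemma norm_1_minus_exp_le:
  assumes "c \<le> 0" "c \<le> Re z" "0 \<le> y"
  shows "norm (1 - exp (- z * of_real y)) \<le> (2 + norm z) * (min 1 y * exp (- c * y))"
proof -
  have e: "exp (- Re z * y) \<le> exp (- c * y)" "1 \<le> exp (- c * y)"
    using assms by (auto intro: mult_right_mono simp: mult_nonpos_nonneg)
  show ?thesis
  proof (cases "y \<le> 1")
    case True
    have "norm (1 - exp (- z * of_real y)) = norm (exp (- z * of_real y) - 1)"
      by (rule norm_minus_commute)
    also have "\<dots> \<le> norm (- z * of_real y) * max 1 (exp (Re (- z * of_real y)))"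
      by (rule norm_exp_diff_1_le)
    also have "\<dots> \<le> norm (- z * of_real y) * exp (- c * y)"
      using e by (intro mult_left_mono) auto
    also have "\<dots> = norm z * (min 1 y * exp (- c * y))"
      using True assms by (simp add: norm_mult min_def)
    also have "\<dots> \<le> (2 + norm z) * (min 1 y * exp (- c * y))"
      using assms by (intro mult_right_mono) auto
    finally show ?thesis .
  next
    case False
    have "norm (1 - exp (- z * of_real y)) \<le> 1 + exp (- Re z * y)"
      by (rule order.trans[OF norm_triangle_ineq4]) simp
    also have "\<dots> \<le> 2 * exp (- c * y)" using e by linarith
    also have "\<dots> \<le> (2 + norm z) * exp (- c * y)" by (intro mult_right_mono) auto
    finally show ?thesis using False by simp
  qed
qed

lemma exp_moment_integrable_lap:
  assumes "exp_moment \<mu> c" "c \<le> 0" "c < Re z"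
  shows "integrable \<mu> (\<lambda>y. of_real (y ^ n) * exp (- z * of_real y) - (if n = 0 then 1 else 0))"
proof -
  note [measurable_cong] = assms(1)[unfolded exp_moment_def, THEN conjunct1]
  have int: "integrable \<mu> (\<lambda>y. min 1 y * exp (- c * y))" and sets: "sets \<mu> = sets borel"
    and null: "emeasure \<mu> {..0} = 0"
    using assms by (auto simp: exp_moment_def)
  define \<eta> where "\<eta> = Re z - c"
  have \<eta>: "0 < \<eta>" using assms by (simp add: \<eta>_def)
  define C where "C = 2 + norm z + (1 + fact n / \<eta> ^ n)"
  have C: "2 + norm z \<le> C" "1 + fact n / \<eta> ^ n \<le> C" using \<eta> by (auto simp: C_def)
  show ?thesis
  proof (rule Bochner_Integration.integrable_bound)
    show "integrable \<mu> (\<lambda>y. C * (min 1 y * exp (- c * y)))" using int by simp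
    show "AE y in \<mu>. norm (of_real (y ^ n) * exp (- z * of_real y) - (if n = 0 then 1 else 0))
             \<le> norm (C * (min 1 y * exp (- c * y)))"
      using AE_pos[OF sets null]
    proof eventually_elim
      case (elim y)
      have nn: "0 \<le> min 1 y * exp (- c * y)" using elim by simp
      show ?case
      proof (cases "n = 0")
        case True
        have "norm (exp (- z * of_real y) - 1) \<le> (2 + norm z) * (min 1 y * exp (- c * y))"
          using norm_1_minus_exp_le[of c z y] assms elim by (simp add: norm_minus_commute)
        also have "\<dots> \<le> C * (min 1 y * exp (- c * y))" using C nn by (intro mult_right_mono) auto
        finally show ?thesis using True nn by simp
      next
        case False
        have "y ^ n * exp (- Re z * y) = y ^ n * exp (- \<eta> * y) * exp (- c * y)"
          by (simp add: \<eta>_def algebra_simps flip: exp_add)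
        also have "\<dots> \<le> (1 + fact n / \<eta> ^ n) * min 1 y * exp (- c * y)"
          using power_exp_le_min[of \<eta> n y] \<eta> False elim by (intro mult_right_mono) auto
        also have "\<dots> \<le> C * (min 1 y * exp (- c * y))"
          using mult_right_mono[OF C(2) nn] by (simp add: mult.assoc)
        finally have "y ^ n * exp (- Re z * y) \<le> C * (min 1 y * exp (- c * y))" .
        moreover have "norm (of_real (y ^ n) * exp (- z * of_real y)) = y ^ n * exp (- Re z * y)"
          using elim by (simp add: norm_mult norm_power)
        ultimately show ?thesis using False by (simp add: order.trans[OF _ abs_ge_self])
      qed
    qed
  qed measurable
qed

text \<open>A first-order expansion with an explicit quadratic error. It replaces differentiation under the integral
  sign by one integral estimate.\<close>

lemma DERIV_quadratic_error:
  fixes f :: "complex \<Rightarrow> complex"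
  assumes "0 < \<delta>" "\<And>h. norm h < \<delta> \<Longrightarrow> norm (f (z + h) - f z - D * h) \<le> C * (norm h)\<^sup>2"
  shows "(f has_field_derivative D) (at z)"
proof -
  have "((\<lambda>h. (f (z + h) - f z) / h - D) \<longlongrightarrow> 0) (at 0)"
  proof (rule Lim_null_comparison)
    show "((\<lambda>h::complex. C * norm h) \<longlongrightarrow> 0) (at 0)"
      by (auto intro!: tendsto_eq_intros)
    show "\<forall>\<^sub>F h in at 0. norm ((f (z + h) - f z) / h - D) \<le> C * norm h"
      unfolding eventually_at
    proof (intro exI[of _ \<delta>] conjI ballI impI assms(1))
      fix h :: complex
      assume "h \<noteq> 0 \<and> dist h 0 < \<delta>"
      hence h: "h \<noteq> 0" "norm h < \<delta>" by auto
      have "norm ((f (z + h) - f z) / h - D) = norm (f (z + h) - f z - D * h) / norm h"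
        using h by (simp add: norm_divide[symmetric] field_simps)
      also have "\<dots> \<le> C * (norm h)\<^sup>2 / norm h"
        using assms(2)[OF h(2)] h by (intro divide_right_mono) auto
      finally show "norm ((f (z + h) - f z) / h - D) \<le> C * norm h"
        using h by (simp add: power2_eq_square)
    qed
  qed
  thus ?thesis unfolding DERIV_def by (simp add: Lim_null[symmetric])
qed

lemma integral_norm_bound_AE:
  fixes f :: "'a \<Rightarrow> 'b::{banach, second_countable_topology}"
  assumes "integrable M f" "integrable M g" "AE x in M. norm (f x) \<le> g x"
  shows "norm (integral\<^sup>L M f) \<le> integral\<^sup>L M g"
  by (rule order.trans[OF integral_norm_bound integral_mono_AE]) (use assms in auto)

text \<open>The second-order Taylor remainder of \<open>exp (- h * y)\<close> costs a factor \<open>y\<^sup>2 exp (\<bar>h\<bar> y)\<close>. As \<open>Re z\<close> is strictly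
  larger than \<open>c\<close>, half of the gap \<open>Re z - c\<close> pays for \<open>exp (\<bar>h\<bar> y)\<close> and the other half for the power of \<open>y\<close>.\<close>

lemma lap_has_derivative:
  assumes "exp_moment \<mu> c" "c \<le> 0" "c < Re z"
  shows "(lap \<mu> n has_field_derivative - lap \<mu> (Suc n) z) (at z)"
proof -
  note [measurable_cong] = assms(1)[unfolded exp_moment_def, THEN conjunct1]
  have int: "integrable \<mu> (\<lambda>y. min 1 y * exp (- c * y))" and sets: "sets \<mu> = sets borel"
    and null: "emeasure \<mu> {..0} = 0"
    using assms by (auto simp: exp_moment_def)
  \<comment> \<open>the radius of admissible increments, and the exponential rate left over for powers of \<open>y\<close>\<close>
  define \<eta> where "\<eta> = (Re z - c) / 2"
  have \<eta>: "0 < \<eta>" using assms by (simp add: \<eta>_def)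
  define C where "C = (1 + fact (n + 2) / \<eta> ^ (n + 2))"
  define I where "I = (LINT y|\<mu>. min 1 y * exp (- c * y))"
  show ?thesis
  proof (rule DERIV_quadratic_error[OF \<eta>, where C = "C * I"])
    fix h :: complex assume h: "norm h < \<eta>"
    have "Re h \<ge> - norm h" using abs_Re_le_cmod[of h] by linarith
    hence Re: "c < Re (z + h)" using h \<eta> by (simp add: \<eta>_def)
    let ?f = "\<lambda>n z y. of_real (y ^ n) * exp (- z * of_real y) - (if n = 0 then 1 else 0 :: complex)"
    note i = exp_moment_integrable_lap[OF assms(1,2)]
    note ii = Bochner_Integration.integrable_diff[OF i[OF Re] i[OF assms(3)], of n n]
       integrable_mult_left[where c = h, OF i[OF assms(3), of "Suc n"]]
    have eq: "lap \<mu> n (z + h) - lap \<mu> n z - (- lap \<mu> (Suc n) z) * h =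
          (LINT y|\<mu>. ?f n (z + h) y - ?f n z y + ?f (Suc n) z y * h)"
    proof -
      have e1: "(LINT y|\<mu>. ?f n (z + h) y - ?f n z y + ?f (Suc n) z y * h) =
            (LINT y|\<mu>. ?f n (z + h) y - ?f n z y) + (LINT y|\<mu>. ?f (Suc n) z y * h)"
        by (rule Bochner_Integration.integral_add[OF ii])
      have e2: "(LINT y|\<mu>. ?f n (z + h) y - ?f n z y) = lap \<mu> n (z + h) - lap \<mu> n z"
        unfolding lap_def by (rule Bochner_Integration.integral_diff[OF i[OF Re] i[OF assms(3)]])
      have e3: "(LINT y|\<mu>. ?f (Suc n) z y * h) = lap \<mu> (Suc n) z * h"
        unfolding lap_def by (rule integral_mult_left_zero)
      show ?thesis unfolding e1 e2 e3 by (simp add: mult.commute)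
    qed
    have bd: "norm (LINT y|\<mu>. ?f n (z + h) y - ?f n z y + ?f (Suc n) z y * h)
            \<le> (LINT y|\<mu>. (norm h)\<^sup>2 * C * (min 1 y * exp (- c * y)))"
    proof (rule integral_norm_bound_AE)
      show "integrable \<mu> (\<lambda>y. ?f n (z + h) y - ?f n z y + ?f (Suc n) z y * h)"
        by (rule Bochner_Integration.integrable_add[OF ii])
      show "integrable \<mu> (\<lambda>y. (norm h)\<^sup>2 * C * (min 1 y * exp (- c * y)))"
        by (rule integrable_mult_right[OF int])
      show "AE y in \<mu>. norm (?f n (z + h) y - ?f n z y + ?f (Suc n) z y * h)
                \<le> (norm h)\<^sup>2 * C * (min 1 y * exp (- c * y))"
        using AE_pos[OF sets null]
      proof eventually_elim
        case (elim y)
        define p where "p = complex_of_real (y ^ n) * exp (- z * of_real y)"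
        define e where "e = exp (- h * of_real y)"
        have "exp (- (z + h) * of_real y) = exp (- z * of_real y) * e"
          by (simp add: e_def exp_add[symmetric] algebra_simps)
        hence "?f n (z + h) y - ?f n z y + ?f (Suc n) z y * h = p * e - p + p * (h * of_real y)"
          by (simp add: p_def)
        also have "\<dots> = p * (e - (1 + - h * of_real y))"
          by (simp add: algebra_simps)
        also have "norm \<dots> = norm p * norm (e - (1 + - h * of_real y))"
          by (rule norm_mult)
        also have "norm p = y ^ n * exp (- Re z * y)"
          using elim by (simp add: p_def norm_mult norm_power)
        also have "y ^ n * exp (- Re z * y) * norm (e - (1 + - h * of_real y)) \<le>
            y ^ n * exp (- Re z * y) * (exp (\<bar>Re h\<bar> * y) * (norm h * y)\<^sup>2)"
        proof (rule mult_left_mono)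
          show "norm (e - (1 + - h * of_real y)) \<le> exp (\<bar>Re h\<bar> * y) * (norm h * y)\<^sup>2"
          proof -
          have "norm (e - (\<Sum>k\<le>1. (- h * of_real y) ^ k / fact k))
                 \<le> exp \<bar>Re (- h * of_real y)\<bar> * norm (- h * of_real y) ^ Suc 1 / fact 1"
            unfolding e_def by (rule Taylor_exp)
          moreover have "(\<Sum>k\<le>1. (- h * of_real y) ^ k / fact k) = 1 + - h * of_real y" by simp
          moreover have "\<bar>Re (- h * of_real y)\<bar> = \<bar>Re h\<bar> * y" "norm (- h * of_real y) = norm h * y"
            using elim by (simp_all add: norm_mult abs_mult)
          ultimately show ?thesis by (metis div_by_1 fact_1 Suc_1)
          qed
        qed (use elim in simp)
        also have "y ^ n * exp (- Re z * y) * (exp (\<bar>Re h\<bar> * y) * (norm h * y)\<^sup>2) =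
           (norm h)\<^sup>2 * (y ^ (n + 2) * (exp (- Re z * y) * exp (\<bar>Re h\<bar> * y)))"
          by (simp add: power2_eq_square)
        also have "\<dots> \<le> (norm h)\<^sup>2 * (y ^ (n + 2) * (exp (- \<eta> * y) * exp (- c * y)))"
        proof -
          have "\<bar>Re h\<bar> \<le> \<eta>" using abs_Re_le_cmod[of h] h by linarith
          hence "\<bar>Re h\<bar> * y \<le> \<eta> * y" using elim by (intro mult_right_mono) auto
          hence "- Re z * y + \<bar>Re h\<bar> * y \<le> - \<eta> * y - c * y"
            by (simp add: \<eta>_def field_simps)
          hence "exp (- Re z * y) * exp (\<bar>Re h\<bar> * y) \<le> exp (- \<eta> * y) * exp (- c * y)"
            by (simp flip: exp_add)
          thus ?thesis using elim by (intro mult_left_mono) auto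
        qed
        also have "\<dots> = (norm h)\<^sup>2 * ((y ^ (n + 2) * exp (- \<eta> * y)) * exp (- c * y))"
          by (simp add: mult.assoc)
        also have "\<dots> \<le> (norm h)\<^sup>2 * (C * min 1 y * exp (- c * y))"
          using power_exp_le_min[of \<eta> "n + 2" y] \<eta> elim unfolding C_def
          by (intro mult_left_mono mult_right_mono) auto
        finally show ?case by (simp add: mult.assoc)
      qed
    qed
    have I: "(LINT y|\<mu>. (norm h)\<^sup>2 * C * (min 1 y * exp (- c * y))) = C * I * (norm h)\<^sup>2"
      unfolding I_def by (subst integral_mult_right_zero) (simp only: mult_ac)
    show "norm (lap \<mu> n (z + h) - lap \<mu> n z - (- lap \<mu> (Suc n) z) * h) \<le> C * I * (norm h)\<^sup>2"
      using bd unfolding eq I .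
  qed
qed

definition lk_integral :: "real \<Rightarrow> real \<Rightarrow> real measure \<Rightarrow> complex \<Rightarrow> complex" where
  "lk_integral q d \<mu> z = of_real q + of_real d * z + (LINT y|\<mu>. 1 - exp (- z * of_real y))"

lemma lk_integral_eq_lap: "lk_integral q d \<mu> z = of_real q + of_real d * z - lap \<mu> 0 z"
proof -
  have "(LINT y|\<mu>. 1 - exp (- z * of_real y)) = (LINT y|\<mu>. - (exp (- z * of_real y) - 1))"
    by simp
  also have "\<dots> = - lap \<mu> 0 z" by (subst integral_minus) (simp add: lap_def)
  finally show ?thesis by (simp add: lk_integral_def)
qed

lemma lk_integral_has_derivative:
  assumes "exp_moment \<mu> c" "c \<le> 0" "c < Re z"
  shows "(lk_integral q d \<mu> has_field_derivative (of_real d + lap \<mu> 1 z)) (at z)"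
proof -
  have "((\<lambda>z. of_real q + of_real d * z - lap \<mu> 0 z) has_field_derivative (of_real d + lap \<mu> 1 z)) (at z)"
    using lap_has_derivative[OF assms, of 0] by (auto intro!: derivative_eq_intros)
  thus ?thesis by (simp add: lk_integral_eq_lap[abs_def])
qed

lemma exp_moment_integrable:
  assumes "exp_moment \<mu> c" "c \<le> 0" "c \<le> Re z"
  shows "integrable \<mu> (\<lambda>y. 1 - exp (- z * of_real y))"
proof -
  note [measurable_cong] = assms(1)[unfolded exp_moment_def, THEN conjunct1]
  have int: "integrable \<mu> (\<lambda>y. min 1 y * exp (- c * y))" and sets: "sets \<mu> = sets borel"
    and null: "emeasure \<mu> {..0} = 0"
    using assms by (auto simp: exp_moment_def)
  show ?thesis
  proof (rule Bochner_Integration.integrable_bound)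
    show "integrable \<mu> (\<lambda>y. (2 + norm z) * (min 1 y * exp (- c * y)))" using int by simp
    show "AE y in \<mu>. norm (1 - exp (- z * of_real y)) \<le> norm ((2 + norm z) * (min 1 y * exp (- c * y)))"
      using AE_pos[OF sets null]
    proof eventually_elim
      case (elim y)
      thus ?case using norm_1_minus_exp_le[of c z y] assms by (simp add: order.trans[OF _ abs_ge_self])
    qed
  qed measurable
qed

lemma exp_moment_integrable_real:
  assumes "exp_moment \<mu> c" "c \<le> 0" "c \<le> x"
  shows "integrable \<mu> (\<lambda>y. 1 - exp (- x * y))"
proof -
  have "(\<lambda>y. 1 - exp (- of_real x * of_real y)) = (\<lambda>y. complex_of_real (1 - exp (- x * y)))"
    by (simp flip: exp_of_real)
  thus ?thesis
    using exp_moment_integrable[of \<mu> c "of_real x"] assms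
    by (simp only: Re_complex_of_real complex_of_real_integrable_eq)
qed

lemma exp_moment_integrable_exp:
  assumes "exp_moment \<mu> c" "c \<le> 0" "c < x"
  shows "integrable \<mu> (\<lambda>y. y * exp (- x * y))"
proof -
  have "(\<lambda>y. of_real (y ^ 1) * exp (- of_real x * of_real y) - (if (1::nat) = 0 then 1 else 0)) =
        (\<lambda>y. complex_of_real (y * exp (- x * y)))"
    by (simp flip: exp_of_real)
  thus ?thesis
    using exp_moment_integrable_lap[of \<mu> c "of_real x" 1] assms
    by (simp only: Re_complex_of_real complex_of_real_integrable_eq)
qed

lemma levy_khintchine_exp_moment:
  assumes "levy_khintchine \<phi> q d \<mu>"
  shows "exp_moment \<mu> 0"
proof -
  note lk = assms[unfolded levy_khintchine_def]
  note [measurable_cong] = lk[THEN conjunct2, THEN conjunct2, THEN conjunct1]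
  have "integrable \<mu> (\<lambda>y. min 1 y)"
  proof (rule integrableI_nonneg)
    show "AE y in \<mu>. 0 \<le> min 1 y" using AE_pos[of \<mu>] lk by (auto elim!: eventually_mono)
  qed (use lk in auto)
  thus ?thesis using lk by (simp add: exp_moment_def)
qed

lemma levy_khintchine_eq:
  assumes "levy_khintchine \<phi> q d \<mu>" "0 \<le> Re z"
  shows "\<phi> z = lk_integral q d \<mu> z"
  using assms by (simp add: levy_khintchine_def lk_integral_def)

subsection \<open>Analytic continuation\<close>

text \<open>The Landau-Pringsheim principle. Around the point 1 the \<open>n\<close>-th Taylor coefficient of
  \<open>g(w) = q + d (1 - w) - f(1 - w)\<close> is \<open>\<integral> y\<^sup>n exp (- y) \<mu>(dy) / n!\<close> for \<open>n \<ge> 1\<close>, a nonnegative number. A holomorphic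
  extension makes the Taylor series converge at the real point \<open>1 - x\<close>, and then monotone summation
  under the integral forces the exponential moment at \<open>x\<close> to be finite.\<close>

lemma exp_moment_extend:
  assumes mom: "exp_moment \<mu> 0" and u: "u < x" "x < 0"
    and f: "f holomorphic_on {z. u < Re z}" "\<And>z. 0 < Re z \<Longrightarrow> f z = lk_integral q d \<mu> z"
  shows "exp_moment \<mu> x"
proof -
  note [measurable_cong] = mom[unfolded exp_moment_def, THEN conjunct1]
  have sets: "sets \<mu> = sets borel" and null: "emeasure \<mu> {..0} = 0"
    using mom by (auto simp: exp_moment_def)
  define g where "g w = of_real q + of_real d * (1 - w) - f (1 - w)" for w
  have g_hol: "g holomorphic_on ball 0 (1 - u)"
  proof -
    have sub: "(\<lambda>w. 1 - w) ` ball 0 (1 - u) \<subseteq> {z. u < Re z}"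
    proof (rule image_subsetI)
      fix w :: complex assume "w \<in> ball 0 (1 - u)"
      thus "1 - w \<in> {z. u < Re z}" using abs_Re_le_cmod[of w] by simp
    qed
    have "(f \<circ> (\<lambda>w. 1 - w)) holomorphic_on ball 0 (1 - u)"
      by (rule holomorphic_on_compose_gen[OF _ f(1) sub]) (intro holomorphic_intros)
    thus ?thesis unfolding g_def by (auto intro!: holomorphic_intros simp: o_def)
  qed
  have op: "open {w::complex. Re w < 1}" by (rule open_halfspace_Re_lt)
  have deriv_g: "(deriv ^^ n) g w = lap \<mu> n (1 - w)" if "Re w < 1" for n w
    using that
  proof (induction n arbitrary: w)
    case 0
    thus ?case using f(2)[of "1 - w"] by (simp add: g_def lk_integral_eq_lap)
  next
    case (Suc n)
    have "((\<lambda>w. lap \<mu> n (1 - w)) has_field_derivative (- lap \<mu> (Suc n) (1 - w)) * (-1)) (at w)"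
      by (rule DERIV_chain2[OF lap_has_derivative[OF mom]])
         (use Suc.prems in \<open>auto intro!: derivative_eq_intros\<close>)
    hence "((\<lambda>w. lap \<mu> n (1 - w)) has_field_derivative lap \<mu> (Suc n) (1 - w)) (at w)" by simp
    hence "((deriv ^^ n) g has_field_derivative lap \<mu> (Suc n) (1 - w)) (at w)"
      by (rule has_field_derivative_transform_within_open[OF _ op]) (use Suc in auto)
    thus ?case by (simp add: DERIV_imp_deriv)
  qed
  define r where "r = 1 - x"
  have r: "0 < r" "1 < r" "r < 1 - u" using u by (auto simp: r_def)
  define m where "m n = (LINT y|\<mu>. y ^ n * exp (- y))" for n
  have int_m: "integrable \<mu> (\<lambda>y. y ^ Suc n * exp (- y))" for n
  proof -
    have "(\<lambda>y. of_real (y ^ Suc n) * exp (- 1 * of_real y) - (if Suc n = 0 then 1 else 0)) =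
          (\<lambda>y. complex_of_real (y ^ Suc n * exp (- y)))"
      by (simp flip: exp_of_real)
    moreover have "integrable \<mu> (\<lambda>y. of_real (y ^ Suc n) * exp (- 1 * complex_of_real y) - (if Suc n = 0 then 1 else 0))"
      by (rule exp_moment_integrable_lap[OF mom]) auto
    ultimately show ?thesis by (simp only: complex_of_real_integrable_eq)
  qed
  have lap_m: "lap \<mu> (Suc n) 1 = of_real (m (Suc n))" for n
  proof -
    have "(\<lambda>y. of_real (y ^ Suc n) * exp (- 1 * of_real y) - (if Suc n = 0 then 1 else 0)) =
          (\<lambda>y. complex_of_real (y ^ Suc n * exp (- y)))"
      by (simp flip: exp_of_real)
    thus ?thesis unfolding lap_def m_def by (simp only: integral_complex_of_real)
  qed
  have "(\<lambda>n. (deriv ^^ n) g 0 / fact n * (of_real r - 0) ^ n) sums g (of_real r)"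
    by (rule holomorphic_power_series[OF g_hol]) (use r in auto)
  hence "summable (\<lambda>n. lap \<mu> n 1 / fact n * of_real r ^ n)"
    by (simp add: deriv_g sums_iff)
  hence "summable (\<lambda>n. lap \<mu> (Suc n) 1 / fact (Suc n) * of_real r ^ Suc n)"
    by (subst summable_Suc_iff)
  hence "summable (\<lambda>n. complex_of_real (m (Suc n) / fact (Suc n) * r ^ Suc n))"
    by (simp only: lap_m of_real_mult of_real_divide of_real_fact of_real_power)
  hence summ: "summable (\<lambda>n. m (Suc n) / fact (Suc n) * r ^ Suc n)"
    by (simp only: summable_complex_of_real)
  \<comment> \<open>the Taylor terms at \<open>1 - x\<close> before integration; the term of order 0 carries the renormalisation and is dropped\<close>
  define F where "F n y = y ^ Suc n * exp (- y) / fact (Suc n) * r ^ Suc n" for n and y :: real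
  have F_sum: "(\<lambda>n. F n y) sums (exp (- y) * (exp (r * y) - 1))" for y
  proof -
    have "(\<lambda>n. (r * y) ^ n / fact n) sums exp (r * y)"
      using exp_converges[of "r * y"] by (simp add: field_simps)
    hence "(\<lambda>n. (r * y) ^ Suc n / fact (Suc n)) sums (exp (r * y) - 1)"
      by (subst sums_Suc_iff) simp
    hence "(\<lambda>n. exp (- y) * ((r * y) ^ Suc n / fact (Suc n))) sums (exp (- y) * (exp (r * y) - 1))"
      by (rule sums_mult)
    thus ?thesis by (simp add: F_def power_mult_distrib mult_ac del: power_Suc fact_Suc)
  qed
  have F_int: "integrable \<mu> (F n)" for n
    unfolding F_def using int_m[of n] by (simp del: power_Suc fact_Suc)
  have F_nonneg: "0 \<le> F n y" if "0 < y" for n y using that r by (simp add: F_def)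
  have F_norm: "(LINT y|\<mu>. norm (F n y)) = m (Suc n) / fact (Suc n) * r ^ Suc n" for n
  proof -
    have "(LINT y|\<mu>. norm (F n y)) = (LINT y|\<mu>. F n y)"
    proof (rule integral_cong_AE)
      show "AE y in \<mu>. norm (F n y) = F n y"
        using AE_pos[OF sets null] by eventually_elim (simp add: F_nonneg)
    qed (use borel_measurable_integrable[OF F_int] in auto)
    also have "\<dots> = m (Suc n) / fact (Suc n) * r ^ Suc n"
      unfolding F_def m_def by (simp del: power_Suc fact_Suc)
    finally show ?thesis .
  qed
  have "integrable \<mu> (\<lambda>y. \<Sum>n. F n y)"
  proof (rule integrable_suminf[OF F_int])
    show "AE y in \<mu>. summable (\<lambda>n. norm (F n y))"
      using AE_pos[OF sets null]
    proof eventually_elim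
      case (elim y)
      have "summable (\<lambda>n. F n y)" using F_sum[of y] by (simp add: sums_iff)
      thus ?case using F_nonneg[OF elim] by simp
    qed
    show "summable (\<lambda>n. LINT y|\<mu>. norm (F n y))"
      using summ by (simp only: F_norm)
  qed
  hence int: "integrable \<mu> (\<lambda>y. exp (- y) * (exp (r * y) - 1))"
    using F_sum by (simp add: sums_iff)
  have "integrable \<mu> (\<lambda>y. min 1 y * exp (- x * y))"
  proof (rule Bochner_Integration.integrable_bound[OF integrable_mult_right[OF int, of 2]])
    show "AE y in \<mu>. norm (min 1 y * exp (- x * y)) \<le> norm (2 * (exp (- y) * (exp (r * y) - 1)))"
      using AE_pos[OF sets null]
    proof eventually_elim
      case (elim y)
      have "1 / (1 + y) \<ge> exp (- y)"
        using exp_ge_add_one_self[of y] elim by (simp add: exp_minus field_simps)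
      hence "1 - exp (- y) \<ge> y / (1 + y)" using elim by (simp add: field_simps)
      moreover have "min 1 y \<le> 2 * (y / (1 + y))"
        using elim by (auto simp: min_def field_simps mult_left_le)
      ultimately have a: "min 1 y \<le> 2 * (1 - exp (- y))"
        by (meson mult_left_mono order_trans zero_le_numeral)
      have "y \<le> r * y" using elim r by simp
      hence "exp (- (r * y)) \<le> exp (- y)" by simp
      hence "2 * (1 - exp (- y)) \<le> 2 * (1 - exp (- (r * y)))" by simp
      hence "min 1 y \<le> 2 * (1 - exp (- (r * y)))" by (rule order.trans[OF a])
      hence "min 1 y * exp (- x * y) \<le> 2 * (1 - exp (- (r * y))) * exp (- x * y)"
        by (intro mult_right_mono) auto
      also have "\<dots> = 2 * (exp (- y) * (exp (r * y) - 1))"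
        by (simp add: r_def algebra_simps flip: exp_add)
      finally show ?case using elim by simp
    qed
  qed measurable
  thus ?thesis using sets null by (simp add: exp_moment_def)
qed

section \<open>Bernstein functions on the right half-plane\<close>

definition lk_real :: "real \<Rightarrow> real \<Rightarrow> real measure \<Rightarrow> real \<Rightarrow> real" where
  "lk_real q d \<mu> x = q + d * x + (LINT y|\<mu>. 1 - exp (- x * y))"

lemma lk_integral_of_real: "lk_integral q d \<mu> (of_real x) = of_real (lk_real q d \<mu> x)"
proof -
  have "(LINT y|\<mu>. 1 - exp (- of_real x * of_real y)) = (LINT y|\<mu>. complex_of_real (1 - exp (- x * y)))"
    by (simp flip: exp_of_real)
  thus ?thesis unfolding lk_integral_def lk_real_def integral_complex_of_real by simp
qed

lemma exp_moment_integrable_cos: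
  assumes "exp_moment \<mu> c" "c \<le> 0" "c \<le> x"
  shows "integrable \<mu> (\<lambda>y. exp (- x * y) * (1 - cos (b * y)))"
proof -
  have "integrable \<mu> (\<lambda>y. Re (1 - exp (- Complex x b * of_real y)) - (1 - exp (- x * y)))"
    by (rule Bochner_Integration.integrable_diff[OF integrable_Re[OF exp_moment_integrable[OF assms(1,2)]]
            exp_moment_integrable_real[OF assms]]) (use assms in simp)
  moreover have "Re (1 - exp (- Complex x b * of_real y)) - (1 - exp (- x * y)) =
       exp (- x * y) * (1 - cos (b * y))" for y
    by (simp add: Re_exp algebra_simps)
  ultimately show ?thesis by simp
qed

lemma Re_lk_integral:
  assumes "exp_moment \<mu> c" "c \<le> 0" "c \<le> x"
  shows "Re (lk_integral q d \<mu> (Complex x b)) =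
           lk_real q d \<mu> x + (LINT y|\<mu>. exp (- x * y) * (1 - cos (b * y)))"
proof -
  have eq: "Re (1 - exp (- Complex x b * of_real y)) =
       (1 - exp (- x * y)) + exp (- x * y) * (1 - cos (b * y))" for y
    by (simp add: Re_exp algebra_simps)
  have "Re (LINT y|\<mu>. 1 - exp (- Complex x b * of_real y)) =
        (LINT y|\<mu>. Re (1 - exp (- Complex x b * of_real y)))"
    using exp_moment_integrable[of \<mu> c "Complex x b"] assms by (subst integral_Re) auto
  also have "\<dots> = (LINT y|\<mu>. (1 - exp (- x * y))) + (LINT y|\<mu>. exp (- x * y) * (1 - cos (b * y)))"
    unfolding eq
    using exp_moment_integrable_cos[OF assms] exp_moment_integrable_real[OF assms]
    by (rule Bochner_Integration.integral_add[rotated])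
  finally show ?thesis by (simp add: lk_integral_def lk_real_def)
qed

text \<open>Along a vertical line the real part is smallest on the real axis, since \<open>1 - cos\<close> is nonnegative. All lower bounds
  on moduli below come from here.\<close>

lemma Re_lk_integral_ge:
  assumes "exp_moment \<mu> c" "c \<le> 0" "c \<le> Re z"
  shows "lk_real q d \<mu> (Re z) \<le> Re (lk_integral q d \<mu> z)"
proof -
  have "0 \<le> (LINT y|\<mu>. exp (- Re z * y) * (1 - cos (Im z * y)))"
    by (rule integral_nonneg_AE) simp
  thus ?thesis using Re_lk_integral[OF assms, of q d "Im z"] by simp
qed

lemma lk_real_mono:
  assumes "exp_moment \<mu> c" "c \<le> 0" "c \<le> x" "x \<le> x'" "0 \<le> d"
  shows "lk_real q d \<mu> x \<le> lk_real q d \<mu> x'"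
proof -
  have "(LINT y|\<mu>. 1 - exp (- x * y)) \<le> (LINT y|\<mu>. 1 - exp (- x' * y))"
  proof (rule integral_mono_AE)
    show "AE y in \<mu>. 1 - exp (- x * y) \<le> 1 - exp (- x' * y)"
      using AE_pos[of \<mu>] assms(1) unfolding exp_moment_def
      by (auto elim!: eventually_mono simp: assms(4))
  qed (rule exp_moment_integrable_real[OF assms(1,2)]; use assms in simp)+
  thus ?thesis using assms by (auto simp: lk_real_def intro!: add_mono mult_left_mono)
qed

lemma lk_integral_cnj: "lk_integral q d \<mu> (cnj z) = cnj (lk_integral q d \<mu> z)"
proof -
  have "(LINT y|\<mu>. 1 - exp (- cnj z * of_real y)) = (LINT y|\<mu>. cnj (1 - exp (- z * of_real y)))"
    by (simp add: exp_cnj)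
  also have "\<dots> = cnj (LINT y|\<mu>. 1 - exp (- z * of_real y))"
    by (rule Bochner_Integration.integral_cnj)
  finally show ?thesis by (simp add: lk_integral_def)
qed

text \<open>From \<open>x y exp (- x y) \<le> 1 - exp (- x y)\<close>, integrated against \<open>\<mu>\<close>. It gives \<open>\<bar>\<phi>'(z)\<bar> Re z \<le> \<phi>(Re z)\<close>, the estimate
  behind all uniformity in \<open>\<phi>\<close>.\<close>

lemma lap_1_bound:
  assumes "exp_moment \<mu> 0" "0 < Re z" "0 \<le> d" "0 \<le> q"
  shows "norm (of_real d + lap \<mu> 1 z) * Re z \<le> lk_real q d \<mu> (Re z)"
proof -
  let ?x = "Re z"
  have i: "integrable \<mu> (\<lambda>y. y * exp (- ?x * y))"
    using exp_moment_integrable_exp[of \<mu> 0 ?x] assms by simp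
  have AE: "AE y in \<mu>. 0 < y" using AE_pos[of \<mu>] assms(1) by (simp add: exp_moment_def)
  have "norm (lap \<mu> 1 z) \<le> (LINT y|\<mu>. y * exp (- ?x * y))"
    unfolding lap_def
  proof (rule integral_norm_bound_AE[OF exp_moment_integrable_lap[OF assms(1) _ assms(2)] i])
    show "AE y in \<mu>. norm (of_real (y ^ 1) * exp (- z * of_real y) - (if (1::nat) = 0 then 1 else 0))
        \<le> y * exp (- Re z * y)"
      using AE by eventually_elim (simp add: norm_mult)
  qed simp
  hence "norm (lap \<mu> 1 z) * ?x \<le> (LINT y|\<mu>. y * exp (- ?x * y)) * ?x"
    using assms by (intro mult_right_mono) auto
  also have "\<dots> = (LINT y|\<mu>. y * exp (- ?x * y) * ?x)" by simp
  also have "\<dots> \<le> (LINT y|\<mu>. 1 - exp (- ?x * y))"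
  proof (rule integral_mono_AE)
    show "integrable \<mu> (\<lambda>y. 1 - exp (- ?x * y))"
      using exp_moment_integrable_real[of \<mu> 0 ?x] assms by simp
    show "AE y in \<mu>. y * exp (- ?x * y) * ?x \<le> 1 - exp (- ?x * y)"
      using AE
    proof eventually_elim
      case (elim y)
      have "(1 + ?x * y) * exp (- ?x * y) \<le> exp (?x * y) * exp (- ?x * y)"
        by (intro mult_right_mono exp_ge_add_one_self) auto
      also have "\<dots> = 1" by (simp flip: exp_add)
      finally show ?case by (simp add: algebra_simps)
    qed
  qed (use i in simp)
  finally have "norm (lap \<mu> 1 z) * ?x \<le> (LINT y|\<mu>. 1 - exp (- ?x * y))" .
  moreover have "norm (of_real d + lap \<mu> 1 z) \<le> d + norm (lap \<mu> 1 z)"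
    using norm_triangle_ineq[of "of_real d" "lap \<mu> 1 z"] assms by simp
  hence "norm (of_real d + lap \<mu> 1 z) * ?x \<le> (d + norm (lap \<mu> 1 z)) * ?x"
    using assms by (intro mult_right_mono) auto
  ultimately show ?thesis using assms by (simp add: lk_real_def algebra_simps)
qed

text \<open>If the value at one point \<open>x > 0\<close> vanishes, then so do \<open>q\<close> and \<open>d\<close>, and \<open>\<mu>\<close> is the null measure, so that the function is
  identically zero.\<close>

lemma lk_real_pos:
  assumes "exp_moment \<mu> 0" "0 \<le> d" "0 \<le> q" "0 \<le> Re w" "lk_integral q d \<mu> w \<noteq> 0" "0 < x"
  shows "0 < lk_real q d \<mu> x"
proof (rule ccontr)
  assume *: "\<not> 0 < lk_real q d \<mu> x"
  have AE: "AE y in \<mu>. 0 < y" using AE_pos[of \<mu>] assms(1) by (simp add: exp_moment_def)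
  have i: "integrable \<mu> (\<lambda>y. 1 - exp (- x * y))"
    using exp_moment_integrable_real[of \<mu> 0 x] assms by simp
  have nn: "AE y in \<mu>. 0 \<le> 1 - exp (- x * y)"
    using AE by eventually_elim (use assms in auto)
  have "0 \<le> (LINT y|\<mu>. 1 - exp (- x * y))" by (rule integral_nonneg_AE[OF nn])
  moreover have "0 \<le> d * x" using assms by simp
  ultimately have z: "q = 0" "d * x = 0" "(LINT y|\<mu>. 1 - exp (- x * y)) = 0"
    using * assms unfolding lk_real_def by linarith+
  hence "AE y in \<mu>. 1 - exp (- x * y) = 0"
    using integral_nonneg_eq_0_iff_AE[OF i nn] by simp
  hence "AE y in \<mu>. False" using AE by eventually_elim (use assms in auto)
  hence "(LINT y|\<mu>. 1 - exp (- w * of_real y)) = (LINT y|\<mu>. 0)"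
    using assms(1) exp_moment_integrable[of \<mu> 0 w] assms(4)
    by (intro integral_cong_AE) (auto elim!: eventually_mono)
  hence "lk_integral q d \<mu> w = 0" using z assms by (simp add: lk_integral_def)
  thus False using assms by simp
qed

lemma bernstein_lk:
  assumes "\<phi> \<in> bernstein_functions"
  obtains q d \<mu> where "levy_khintchine \<phi> q d \<mu>"
  using assms by (auto simp: bernstein_functions_def)

lemma levy_khintchine_on_reals:
  assumes "levy_khintchine \<phi> q d \<mu>" "0 \<le> x"
  shows "on_reals \<phi> x = lk_real q d \<mu> x" "\<phi> (of_real x) = of_real (lk_real q d \<mu> x)"
  using levy_khintchine_eq[OF assms(1), of "of_real x"] assms(2)
  by (auto simp: on_reals_def lk_integral_of_real)

lemma bernstein_of_real:
  assumes "\<phi> \<in> bernstein_functions" "0 \<le> x"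
  shows "\<phi> (of_real x) = of_real (on_reals \<phi> x)"
  using bernstein_lk[OF assms(1)] levy_khintchine_on_reals assms(2) by metis

lemma bernstein_pos:
  assumes "\<phi> \<in> bernstein_functions" "0 < x"
  shows "0 < on_reals \<phi> x"
proof -
  obtain q d \<mu> where lk: "levy_khintchine \<phi> q d \<mu>" by (rule bernstein_lk[OF assms(1)])
  obtain w where "0 \<le> Re w" "\<phi> w \<noteq> 0" using assms(1) by (auto simp: bernstein_functions_def)
  hence "0 < lk_real q d \<mu> x"
    using lk_real_pos[OF levy_khintchine_exp_moment[OF lk]] levy_khintchine_eq[OF lk] lk assms(2)
    by (auto simp: levy_khintchine_def)
  thus ?thesis using levy_khintchine_on_reals[OF lk] assms(2) by simp
qed

lemma bernstein_Re_ge: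
  assumes "\<phi> \<in> bernstein_functions" "0 \<le> Re z"
  shows "on_reals \<phi> (Re z) \<le> Re (\<phi> z)"
proof -
  obtain q d \<mu> where lk: "levy_khintchine \<phi> q d \<mu>" by (rule bernstein_lk[OF assms(1)])
  show ?thesis
    using Re_lk_integral_ge[OF levy_khintchine_exp_moment[OF lk], of z q d]
      levy_khintchine_on_reals[OF lk assms(2)] levy_khintchine_eq[OF lk assms(2)] assms by simp
qed

lemma bernstein_mono:
  assumes "\<phi> \<in> bernstein_functions" "0 \<le> x" "x \<le> x'"
  shows "on_reals \<phi> x \<le> on_reals \<phi> x'"
proof -
  obtain q d \<mu> where lk: "levy_khintchine \<phi> q d \<mu>" by (rule bernstein_lk[OF assms(1)])
  show ?thesis
    using lk_real_mono[OF levy_khintchine_exp_moment[OF lk], of x x' d q]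
      levy_khintchine_on_reals[OF lk] assms lk by (simp add: levy_khintchine_def)
qed

lemma bernstein_cnj:
  assumes "\<phi> \<in> bernstein_functions" "0 \<le> Re z"
  shows "\<phi> (cnj z) = cnj (\<phi> z)"
proof -
  obtain q d \<mu> where lk: "levy_khintchine \<phi> q d \<mu>" by (rule bernstein_lk[OF assms(1)])
  show ?thesis using levy_khintchine_eq[OF lk, of z] levy_khintchine_eq[OF lk, of "cnj z"] assms
    by (simp add: lk_integral_cnj)
qed

lemma bernstein_deriv:
  assumes "\<phi> \<in> bernstein_functions" "0 < Re z"
  shows "(\<phi> has_field_derivative deriv \<phi> z) (at z)"
    and "norm (deriv \<phi> z) * Re z \<le> on_reals \<phi> (Re z)"
proof -
  obtain q d \<mu> where lk: "levy_khintchine \<phi> q d \<mu>" by (rule bernstein_lk[OF assms(1)])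
  note mom = levy_khintchine_exp_moment[OF lk]
  have "(\<phi> has_field_derivative (of_real d + lap \<mu> 1 z)) (at z)"
    by (rule has_field_derivative_transform_within_open[OF lk_integral_has_derivative[OF mom]
          open_halfspace_Re_gt[of 0]])
       (use assms levy_khintchine_eq[OF lk] in auto)
  moreover from this have "deriv \<phi> z = of_real d + lap \<mu> 1 z" by (rule DERIV_imp_deriv)
  moreover have "norm (of_real d + lap \<mu> 1 z) * Re z \<le> on_reals \<phi> (Re z)"
    using lap_1_bound[OF mom assms(2)] lk levy_khintchine_on_reals[OF lk, of "Re z"] assms
    by (auto simp: levy_khintchine_def)
  ultimately show "(\<phi> has_field_derivative deriv \<phi> z) (at z)"
    "norm (deriv \<phi> z) * Re z \<le> on_reals \<phi> (Re z)" by simp_all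
qed

lemma bernstein_norm_ge:
  assumes "\<phi> \<in> bernstein_functions" "0 \<le> Re z"
  shows "on_reals \<phi> (Re z) \<le> norm (\<phi> z)"
  using bernstein_Re_ge[OF assms] complex_Re_le_cmod[of "\<phi> z"] by linarith

subsection \<open>The logarithm of a Bernstein function\<close>

definition bernstein_log :: "(complex \<Rightarrow> complex) \<Rightarrow> complex \<Rightarrow> complex" where
  "bernstein_log \<phi> z = Ln (\<phi> z)"

abbreviation right_half_plane :: "complex set" where
  "right_half_plane \<equiv> {z. 0 < Re z}"

lemma convex_right_half_plane: "convex right_half_plane"
  by (rule convex_halfspace_Re_gt)

lemma open_right_half_plane: "open right_half_plane"
  by (rule open_halfspace_Re_gt)

context
  fixes \<phi> assumes bern: "\<phi> \<in> bernstein_functions"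
begin

lemma bernstein_Re_pos: "0 < Re z \<Longrightarrow> 0 < Re (\<phi> z)"
  using bernstein_Re_ge[OF bern, of z] bernstein_pos[OF bern, of "Re z"] by simp

lemma bernstein_nonzero: "0 < Re z \<Longrightarrow> \<phi> z \<noteq> 0"
  using bernstein_Re_pos[of z] by auto

lemma exp_bernstein_log: "0 < Re z \<Longrightarrow> exp (bernstein_log \<phi> z) = \<phi> z"
  using bernstein_nonzero by (simp add: bernstein_log_def)

lemma Re_bernstein_log: "0 < Re z \<Longrightarrow> Re (bernstein_log \<phi> z) = ln (norm (\<phi> z))"
  using bernstein_nonzero by (simp add: bernstein_log_def Re_Ln)

lemma Im_bernstein_log: "0 < Re z \<Longrightarrow> Im (bernstein_log \<phi> z) = Arg (\<phi> z)"
  using bernstein_nonzero by (simp add: bernstein_log_def Arg_eq_Im_Ln)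

lemma bernstein_log_of_real:
  "0 < x \<Longrightarrow> bernstein_log \<phi> (of_real x) = of_real (ln (on_reals \<phi> x))"
  using bernstein_of_real[OF bern, of x] bernstein_pos[OF bern, of x]
  by (simp add: bernstein_log_def Ln_of_real)

lemma bernstein_log_deriv:
  assumes "0 < Re z"
  shows "(bernstein_log \<phi> has_field_derivative deriv (bernstein_log \<phi>) z) (at z)"
    and "deriv (bernstein_log \<phi>) z = deriv \<phi> z / \<phi> z"
    and "norm (deriv (bernstein_log \<phi>) z) \<le> 1 / Re z"
proof -
  have "(bernstein_log \<phi> has_field_derivative deriv \<phi> z / \<phi> z) (at z)"
  proof -
    have "\<phi> z \<notin> \<real>\<^sub>\<le>\<^sub>0"
      using bernstein_Re_pos[OF assms] by (auto simp: complex_nonpos_Reals_iff)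
    from DERIV_chain2[OF has_field_derivative_Ln[OF this] bernstein_deriv(1)[OF bern assms]]
    show ?thesis by (simp add: bernstein_log_def[abs_def] divide_inverse mult.commute)
  qed
  moreover from this show eq: "deriv (bernstein_log \<phi>) z = deriv \<phi> z / \<phi> z" by (rule DERIV_imp_deriv)
  ultimately show "(bernstein_log \<phi> has_field_derivative deriv (bernstein_log \<phi>) z) (at z)" by simp
  have "norm (deriv \<phi> z) * Re z \<le> norm (\<phi> z)"
    using bernstein_deriv(2)[OF bern assms] bernstein_norm_ge[OF bern, of z] assms by simp
  thus "norm (deriv (bernstein_log \<phi>) z) \<le> 1 / Re z"
    using assms bernstein_nonzero[OF assms] by (simp add: eq norm_divide field_simps)
qed

lemma bernstein_log_holomorphic: "bernstein_log \<phi> holomorphic_on right_half_plane"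
  using bernstein_log_deriv(1) open_right_half_plane
  by (auto simp: holomorphic_on_def field_differentiable_def intro: DERIV_subset)

text \<open>Cauchy's inequality on the disc of radius \<open>Re z / 2\<close> about \<open>z\<close>, on which the first derivative is at most
  \<open>2 / Re z\<close>. The constant does not depend on \<open>\<phi>\<close>.\<close>

lemma bernstein_log_deriv2:
  assumes "0 < Re z"
  shows "(deriv (bernstein_log \<phi>) has_field_derivative deriv (deriv (bernstein_log \<phi>)) z) (at z)"
    and "norm (deriv (deriv (bernstein_log \<phi>)) z) \<le> 4 / (Re z)\<^sup>2"
proof -
  have hol: "deriv (bernstein_log \<phi>) holomorphic_on right_half_plane"
    by (rule holomorphic_deriv[OF bernstein_log_holomorphic open_right_half_plane])
  show "(deriv (bernstein_log \<phi>) has_field_derivative deriv (deriv (bernstein_log \<phi>)) z) (at z)"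
    by (rule holomorphic_derivI[OF hol open_right_half_plane]) (use assms in auto)
  have Re: "Re z / 2 \<le> Re w" if "norm (z - w) \<le> Re z / 2" for w
    using abs_Re_le_cmod[of "z - w"] that by simp
  have sub: "cball z (Re z / 2) \<subseteq> right_half_plane"
    using Re assms by (force simp: dist_norm)
  have "norm ((deriv ^^ 1) (deriv (bernstein_log \<phi>)) z) \<le> fact 1 * (2 / Re z) / (Re z / 2) ^ 1"
  proof (rule Cauchy_inequality)
    show "continuous_on (cball z (Re z / 2)) (deriv (bernstein_log \<phi>))"
      using holomorphic_on_subset[OF hol sub] by (rule holomorphic_on_imp_continuous_on)
    show "deriv (bernstein_log \<phi>) holomorphic_on ball z (Re z / 2)"
      by (rule holomorphic_on_subset[OF hol]) (use sub ball_subset_cball in blast)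
    show "norm (deriv (bernstein_log \<phi>) x) \<le> 2 / Re z" if "norm (z - x) = Re z / 2" for x
    proof -
      have h: "Re z / 2 \<le> Re x" using Re[of x] that by simp
      hence "1 / Re x \<le> 1 / (Re z / 2)" using assms by (intro divide_left_mono) auto
      thus ?thesis using bernstein_log_deriv(3)[of x] h assms by simp
    qed
  qed (use assms in auto)
  thus "norm (deriv (deriv (bernstein_log \<phi>)) z) \<le> 4 / (Re z)\<^sup>2"
    using assms by (simp add: power2_eq_square)
qed

end

section \<open>The trapezoidal rule\<close>

lemma P_bounds: "0 \<le> P u" "P u \<le> 1 / 4"
proof -
  have f: "0 \<le> frac u" "frac u < 1" by (auto simp: frac_lt_1)
  thus "0 \<le> P u" by (simp add: P_def)
  have "0 \<le> (frac u - 1 / 2)\<^sup>2" by simp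
  thus "P u \<le> 1 / 4" by (simp add: P_def power2_eq_square algebra_simps)
qed

lemma P_measurable [measurable]: "P \<in> borel_measurable borel"
  unfolding P_def[abs_def] frac_def by measurable

lemma P_eq:
  assumes "real k \<le> u" "u \<le> real k + 1"
  shows "P u = (u - real k) * (real k + 1 - u)"
proof (cases "u = real k + 1")
  case True
  hence "u = of_int (int k + 1)" by simp
  hence "frac u = 0" by (metis frac_of_int)
  thus ?thesis using True by (simp add: P_def)
next
  case False
  hence "frac u = u - real k"
    using assms by (intro frac_unique_iff[THEN iffD2]) auto
  thus ?thesis by (simp add: P_def)
qed

lemma tendsto_divide_add_at_top: "((\<lambda>u::real. K / (u + s)) \<longlongrightarrow> 0) at_top"
  by (intro tendsto_divide_0[OF tendsto_const] filterlim_at_top_imp_at_infinity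
      filterlim_tendsto_add_at_top[OF tendsto_const filterlim_ident, of s, simplified add.commute])

lemma integrable_inverse_square:
  assumes "0 < m + s"
  shows "set_integrable lborel {m<..} (\<lambda>u::real. K / (u + s)\<^sup>2)"
    and "(LBINT u:{m<..}. K / (u + s)\<^sup>2) = K / (m + s)"
proof -
  have F: "((\<lambda>u. - 1 / (u + s)) has_real_derivative 1 / (u + s)\<^sup>2) (at u)" if "m < u" for u
    using that assms by (auto intro!: derivative_eq_intros simp: power2_eq_square)
  have A: "(((\<lambda>u. - 1 / (u + s)) \<circ> real_of_ereal) \<longlongrightarrow> - 1 / (m + s)) (at_right (ereal m))"
    unfolding ereal_tendsto_simps using assms by (auto intro!: tendsto_eq_intros)
  have B: "(((\<lambda>u. - 1 / (u + s)) \<circ> real_of_ereal) \<longlongrightarrow> 0) (at_left \<infinity>)"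
    unfolding ereal_tendsto_simps
    by (rule tendsto_divide_add_at_top)
  have i: "set_integrable lborel (einterval (ereal m) \<infinity>) (\<lambda>u. 1 / (u + s)\<^sup>2)"
    "(LBINT u=ereal m..\<infinity>. 1 / (u + s)\<^sup>2) = 0 - (- 1 / (m + s))"
    by (rule interval_integral_FTC_nonneg[OF _ F _ _ A B];
        use assms in \<open>auto intro!: continuous_intros\<close>)+
  show "set_integrable lborel {m<..} (\<lambda>u. K / (u + s)\<^sup>2)"
    using set_integrable_mult_right[of K, OF i(1)] by simp
  have "(LBINT u:{m<..}. K * (1 / (u + s)\<^sup>2)) = K * (LBINT u:{m<..}. 1 / (u + s)\<^sup>2)"
    by (rule set_integral_mult_right)
  thus "(LBINT u:{m<..}. K / (u + s)\<^sup>2) = K / (m + s)"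
    using i(2) by (simp add: interval_integral_to_infinity_eq)
qed

text \<open>The form in which the remainder terms are estimated: an integrand of size \<open>K / (u + s)\<^sup>2\<close> gives a remainder of
  size \<open>K / (m + s)\<close>.\<close>

lemma P_integral_bound:
  fixes f :: "real \<Rightarrow> real"
  assumes "0 < m + s" "0 \<le> K" "continuous_on {m<..} f" "\<And>u. m < u \<Longrightarrow> \<bar>f u\<bar> \<le> K / (u + s)\<^sup>2"
  shows "set_integrable lborel {m<..} (\<lambda>u. P u * f u)"
    and "\<bar>LBINT u=ereal m..\<infinity>. P u * f u\<bar> \<le> K / (m + s)"
proof -
  have b: "norm (P u * f u) \<le> K / (u + s)\<^sup>2" if "m < u" for u
  proof -
    have "\<bar>P u\<bar> \<le> 1" using P_bounds[of u] by simp
    hence "\<bar>P u\<bar> * \<bar>f u\<bar> \<le> 1 * (K / (u + s)\<^sup>2)"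
      using assms(4)[OF that] by (intro mult_mono) auto
    thus ?thesis by (simp add: abs_mult)
  qed
  have meas: "set_borel_measurable borel {m<..} (\<lambda>u. P u * f u)"
  proof -
    have [measurable]: "(\<lambda>u. indicator {m<..} u *\<^sub>R f u) \<in> borel_measurable borel"
      by (rule borel_measurable_continuous_on_indicator[OF _ assms(3)]) simp
    have "(\<lambda>u. P u * (indicator {m<..} u *\<^sub>R f u)) \<in> borel_measurable borel" by measurable
    thus ?thesis by (simp add: set_borel_measurable_def mult_ac)
  qed
  show i: "set_integrable lborel {m<..} (\<lambda>u. P u * f u)"
    by (rule set_integrable_bound[OF integrable_inverse_square(1)[OF assms(1), of K]])
       (use meas b assms(2) in \<open>auto simp: set_borel_measurable_def intro!: AE_I2 order.trans[OF _ abs_ge_self]\<close>)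
  have "\<bar>LBINT u:{m<..}. P u * f u\<bar> \<le> (LBINT u:{m<..}. K / (u + s)\<^sup>2)"
    unfolding set_lebesgue_integral_def real_norm_def[symmetric]
  proof (rule integral_norm_bound_AE)
    show "AE u in lborel. norm (indicator {m<..} u *\<^sub>R (P u * f u)) \<le> indicator {m<..} u *\<^sub>R (K / (u + s)\<^sup>2)"
      using b by (auto simp: indicator_def)
  qed (use i integrable_inverse_square(1)[OF assms(1), of K] in \<open>auto simp: set_integrable_def\<close>)
  thus "\<bar>LBINT u=ereal m..\<infinity>. P u * f u\<bar> \<le> K / (m + s)"
    using integrable_inverse_square(2)[OF assms(1), of K] by (simp add: interval_integral_to_infinity_eq)
qed

text \<open>On \<open>[k, k + 1]\<close> the function \<open>P\<close> is the polynomial \<open>p(u) = (u - k)(k + 1 - u)\<close> with \<open>p'' = -2\<close>, so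
  \<open>p f2 + 2 f\<close> is the derivative of \<open>p f1 - p' f\<close>. The primitive \<open>f0\<close> of \<open>f\<close> is carried along because it is
  known in closed form in the application.\<close>

lemma trapezoid_unit:
  fixes f0 f f1 f2 :: "real \<Rightarrow> real"
  assumes "\<And>u. real k \<le> u \<Longrightarrow> (f0 has_real_derivative f u) (at u)"
    "\<And>u. real k \<le> u \<Longrightarrow> (f has_real_derivative f1 u) (at u)"
    "\<And>u. real k \<le> u \<Longrightarrow> (f1 has_real_derivative f2 u) (at u)"
    "continuous_on {real k..} f2"
  shows "(LBINT u=real k..real (Suc k). P u * f2 u) =
           f (real k) + f (real (Suc k)) - 2 * (f0 (real (Suc k)) - f0 (real k))"
proof -
  let ?p = "\<lambda>u. (u - real k) * (real k + 1 - u)"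
  let ?F = "\<lambda>u. ?p u * f1 u - (2 * real k + 1 - 2 * u) * f u - 2 * f0 u"
  have "(LBINT u=real k..real (Suc k). P u * f2 u) = (LBINT u=real k..real (Suc k). ?p u * f2 u)"
    by (rule interval_integral_cong) (auto simp: einterval_iff P_eq)
  also have "\<dots> = ?F (real (Suc k)) - ?F (real k)"
  proof (rule interval_integral_FTC_finite)
    show "continuous_on {min (real k) (real (Suc k))..max (real k) (real (Suc k))} (\<lambda>u. ?p u * f2 u)"
      by (intro continuous_intros continuous_on_subset[OF assms(4)]) auto
    fix u assume "min (real k) (real (Suc k)) \<le> u"
    hence u: "real k \<le> u" by simp
    have "(?F has_real_derivative ?p u * f2 u) (at u)"
      by (rule derivative_eq_intros assms u refl)+ (simp add: algebra_simps)
    thus "(?F has_vector_derivative ?p u * f2 u) (at u within {min (real k) (real (Suc k))..max (real k) (real (Suc k))})"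
      by (auto simp: has_real_derivative_iff_has_vector_derivative intro: has_vector_derivative_at_within)
  qed
  also have "\<dots> = f (real k) + f (real (Suc k)) - 2 * (f0 (real (Suc k)) - f0 (real k))"
    by (simp add: algebra_simps)
  finally show ?thesis .
qed

text \<open>The Euler-Maclaurin formula of order two on a half-line. The tail of the remainder integral from \<open>n\<close> on is
  bounded by \<open>K / (n + s)\<close>.\<close>

lemma trapezoid_limit:
  fixes f0 f f1 f2 :: "real \<Rightarrow> real" and m :: nat
  assumes ms: "0 < real m + s" and K: "0 \<le> K"
  assumes d: "\<And>u. real m \<le> u \<Longrightarrow> (f0 has_real_derivative f u) (at u)"
    "\<And>u. real m \<le> u \<Longrightarrow> (f has_real_derivative f1 u) (at u)"
    "\<And>u. real m \<le> u \<Longrightarrow> (f1 has_real_derivative f2 u) (at u)"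
    and cont: "continuous_on {real m..} f2" and bound: "\<And>u. real m \<le> u \<Longrightarrow> \<bar>f2 u\<bar> \<le> K / (u + s)\<^sup>2"
  shows "(\<lambda>n. (\<Sum>k=m..n. f (real k)) - (f (real m) + f (real n)) / 2 - (f0 (real n) - f0 (real m)))
           \<longlonglongrightarrow> 1 / 2 * (LBINT u=ereal (real m)..\<infinity>. P u * f2 u)"
proof -
  let ?I = "\<lambda>a b. LBINT u=a..b. P u * f2 u"
  have c: "continuous_on {x<..} f2" if "real m \<le> x" for x
    using that by (intro continuous_on_subset[OF cont]) auto
  have int: "set_integrable lborel {x<..} (\<lambda>u. P u * f2 u)"
    and bd: "\<bar>?I (ereal x) \<infinity>\<bar> \<le> K / (x + s)" if "real m \<le> x" for x
    using P_integral_bound[of x s K f2] ms K bound c that by auto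
  have split: "?I (ereal (real m)) (ereal (real k)) + ?I (ereal (real k)) (ereal x) = ?I (ereal (real m)) (ereal x)"
    if "m \<le> k" "real k \<le> x" for k x
  proof (rule interval_integral_sum)
    show "interval_lebesgue_integrable lborel (min (ereal (real m)) (min (ereal (real k)) (ereal x)))
            (max (ereal (real m)) (max (ereal (real k)) (ereal x))) (\<lambda>u. P u * f2 u)"
      using that by (auto simp: interval_lebesgue_integrable_def min_def max_def
          intro!: set_integrable_subset[OF int[OF order.refl]])
  qed
  have fin: "?I (ereal (real m)) (ereal (real n)) =
      2 * ((\<Sum>k=m..n. f (real k)) - (f (real m) + f (real n)) / 2 - (f0 (real n) - f0 (real m)))"
    if "m \<le> n" for n
    using that
  proof (induction n rule: dec_induct)
    case (step n)
    have "?I (ereal (real m)) (ereal (real (Suc n))) =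
          ?I (ereal (real m)) (ereal (real n)) + ?I (ereal (real n)) (ereal (real (Suc n)))"
      using split[of n "real (Suc n)"] step by simp
    also have "?I (ereal (real n)) (ereal (real (Suc n))) =
         f (real n) + f (real (Suc n)) - 2 * (f0 (real (Suc n)) - f0 (real n))"
      by (rule trapezoid_unit[where ?f1.0 = f1]) (use d step in \<open>auto intro!: continuous_on_subset[OF cont]\<close>)
    finally show ?case using step by (simp add: field_simps)
  qed simp
  have "(\<lambda>n. ?I (ereal (real m)) \<infinity> - ?I (ereal (real m)) (ereal (real n))) \<longlonglongrightarrow> 0"
  proof (rule Lim_null_comparison)
    show "\<forall>\<^sub>F n in sequentially. norm (?I (ereal (real m)) \<infinity> - ?I (ereal (real m)) (ereal (real n))) \<le> K / (real n + s)"
      using eventually_ge_at_top[of m]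
    proof eventually_elim
      case (elim n)
      have "?I (ereal (real m)) (ereal (real n)) + ?I (ereal (real n)) \<infinity> = ?I (ereal (real m)) \<infinity>"
      proof (rule interval_integral_sum)
        show "interval_lebesgue_integrable lborel (min (ereal (real m)) (min (ereal (real n)) \<infinity>))
            (max (ereal (real m)) (max (ereal (real n)) \<infinity>)) (\<lambda>u. P u * f2 u)"
          using elim int[of "real m"] by (auto simp: interval_lebesgue_integrable_def min_def max_def)
      qed
      thus ?case using bd[of "real n"] elim by (simp add: algebra_simps)
    qed
    show "(\<lambda>n. K / (real n + s)) \<longlonglongrightarrow> 0"
      by (rule filterlim_compose[OF tendsto_divide_add_at_top filterlim_real_sequentially])
  qed
  hence "(\<lambda>n. ?I (ereal (real m)) \<infinity> - (?I (ereal (real m)) \<infinity> - ?I (ereal (real m)) (ereal (real n))))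
            \<longlonglongrightarrow> ?I (ereal (real m)) \<infinity> - 0"
    by (intro tendsto_intros)
  hence "(\<lambda>n. 1 / 2 * ?I (ereal (real m)) (ereal (real n))) \<longlonglongrightarrow> 1 / 2 * ?I (ereal (real m)) \<infinity>"
    by (intro tendsto_intros) simp
  moreover have "\<forall>\<^sub>F n in sequentially. 1 / 2 * ?I (ereal (real m)) (ereal (real n)) =
     (\<Sum>k=m..n. f (real k)) - (f (real m) + f (real n)) / 2 - (f0 (real n) - f0 (real m))"
    using eventually_ge_at_top[of m] by eventually_elim (simp add: fin)
  ultimately show ?thesis by (rule Lim_transform_eventually)
qed

section \<open>The Weierstrass product\<close>

text \<open>Real derivatives along horizontal lines are the real and imaginary parts of complex derivatives.\<close>

lemma Re_compose_real_line_derivative: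
  assumes "(F has_field_derivative D) (at (of_real u + z))"
  shows "((\<lambda>u. Re (F (of_real u + z))) has_real_derivative Re D) (at u)"
    and "((\<lambda>u. Im (F (of_real u + z))) has_real_derivative Im D) (at u)"
proof -
  have "((\<lambda>w. w + z) has_field_derivative 1) (at (of_real u))"
    by (auto intro!: derivative_eq_intros)
  hence "((\<lambda>w. F (w + z)) has_field_derivative D * 1) (at (of_real u))"
    by (rule DERIV_chain2[where f = F and g = "\<lambda>w. w + z", OF assms])
  hence "((\<lambda>u. F (of_real u + z)) has_vector_derivative D) (at u)"
    using has_vector_derivative_real_field[of "\<lambda>w. F (w + z)" D u] by simp
  thus "((\<lambda>u. Re (F (of_real u + z))) has_real_derivative Re D) (at u)"
    "((\<lambda>u. Im (F (of_real u + z))) has_real_derivative Im D) (at u)"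
    unfolding has_real_derivative_iff_has_vector_derivative
    by (auto intro: bounded_linear.has_vector_derivative[OF bounded_linear_Re]
        bounded_linear.has_vector_derivative[OF bounded_linear_Im])
qed

definition log_on_reals :: "(complex \<Rightarrow> complex) \<Rightarrow> real \<Rightarrow> real" where
  "log_on_reals \<phi> u = ln (on_reals \<phi> u)"

context
  fixes \<phi> assumes bern: "\<phi> \<in> bernstein_functions"
begin

lemma bernstein_log_eq_log_on_reals:
  "0 < x \<Longrightarrow> bernstein_log \<phi> (of_real x) = of_real (log_on_reals \<phi> x)"
  using bernstein_log_of_real[OF bern] by (simp add: log_on_reals_def)

lemma log_on_reals_has_derivative:
  assumes "0 < x"
  shows "(log_on_reals \<phi> has_real_derivative Re (deriv (bernstein_log \<phi>) (of_real x))) (at x)"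
proof -
  have "((\<lambda>u. Re (bernstein_log \<phi> (of_real u + 0))) has_real_derivative
           Re (deriv (bernstein_log \<phi>) (of_real x))) (at x)"
    by (rule Re_compose_real_line_derivative) (use bernstein_log_deriv(1)[OF bern] assms in simp)
  thus ?thesis
    by (rule has_field_derivative_transform_within_open[where S = "{0<..}"])
       (use assms bernstein_log_eq_log_on_reals in auto)
qed

text \<open>On the positive half-line the logarithm is real, so the imaginary part of its derivative is the derivative of zero.\<close>

lemma deriv_log_real:
  assumes "0 < x"
  shows "deriv (bernstein_log \<phi>) (of_real x) = of_real (Re (deriv (bernstein_log \<phi>) (of_real x)))"
proof -
  have "((\<lambda>u. Im (bernstein_log \<phi> (of_real u + 0))) has_real_derivative
           Im (deriv (bernstein_log \<phi>) (of_real x))) (at x)"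
    by (rule Re_compose_real_line_derivative) (use bernstein_log_deriv(1)[OF bern] assms in simp)
  moreover have "((\<lambda>u. Im (bernstein_log \<phi> (of_real u + 0))) has_real_derivative 0) (at x)"
    by (rule has_field_derivative_transform_within_open[where S = "{0<..}", OF DERIV_const[of 0]])
       (use assms bernstein_log_eq_log_on_reals in auto)
  ultimately have "Im (deriv (bernstein_log \<phi>) (of_real x)) = 0" by (rule DERIV_unique)
  thus ?thesis by (simp add: complex_eq_iff)
qed

lemma on_reals_has_derivative:
  assumes "0 < x"
  shows "(on_reals \<phi> has_real_derivative Re (deriv \<phi> (of_real x))) (at x)"
  using Re_compose_real_line_derivative(1)[of \<phi> "deriv \<phi> (of_real x)" x 0] bernstein_deriv(1)[OF bern] assms
  by (simp add: on_reals_def[abs_def])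

lemma deriv_on_reals_div:
  assumes "0 < x"
  shows "deriv (on_reals \<phi>) x / on_reals \<phi> x = Re (deriv (bernstein_log \<phi>) (of_real x))"
proof -
  have "deriv (on_reals \<phi>) x = Re (deriv \<phi> (of_real x))"
    using on_reals_has_derivative[OF assms] by (rule DERIV_imp_deriv)
  thus ?thesis
    using bernstein_log_deriv(2)[OF bern, of "of_real x"] bernstein_of_real[OF bern, of x] assms by simp
qed

text \<open>The first two Taylor estimates on the half-plane \<open>Re z \<ge> c\<close>, which is convex, with the derivative bounds
  \<open>1 / c\<close> and \<open>4 / c\<^sup>2\<close> valid there.\<close>

lemma bernstein_log_Taylor:
  assumes "0 < c" "c \<le> Re v" "c \<le> Re w"
  shows "norm (bernstein_log \<phi> w - bernstein_log \<phi> v - deriv (bernstein_log \<phi>) v * (w - v))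
            \<le> 4 / c\<^sup>2 * (norm (w - v))\<^sup>2"
    and "norm (bernstein_log \<phi> w - bernstein_log \<phi> v) \<le> norm (w - v) / c"
proof -
  define f where "f = (\<lambda>n. (deriv ^^ n) (bernstein_log \<phi>))"
  have "norm (f 0 w - (\<Sum>i\<le>1. f i v * (w - v) ^ i / fact i)) \<le> 4 / c\<^sup>2 * norm (w - v) ^ Suc 1 / fact 1"
  proof (rule complex_Taylor[where S = "{z. c \<le> Re z}"])
    show "convex {z. c \<le> Re z}" by (rule convex_halfspace_Re_ge)
    show "(f i has_field_derivative f (Suc i) x) (at x within {z. c \<le> Re z})"
      if "x \<in> {z. c \<le> Re z}" "i \<le> 1" for i x
      using that assms(1) bernstein_log_deriv(1)[OF bern, of x] bernstein_log_deriv2(1)[OF bern, of x]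
      by (cases i) (auto simp: f_def intro: has_field_derivative_at_within)
    show "norm (f (Suc 1) x) \<le> 4 / c\<^sup>2" if "x \<in> {z. c \<le> Re z}" for x
    proof -
      have "c\<^sup>2 \<le> (Re x)\<^sup>2" using that assms by (intro power_mono) auto
      hence "4 / (Re x)\<^sup>2 \<le> 4 / c\<^sup>2" using assms that by (intro divide_left_mono mult_pos_pos zero_less_power) auto
      thus ?thesis using bernstein_log_deriv2(2)[OF bern, of x] that assms(1) by (simp add: f_def)
    qed
  qed (use assms in auto)
  thus "norm (bernstein_log \<phi> w - bernstein_log \<phi> v - deriv (bernstein_log \<phi>) v * (w - v))
            \<le> 4 / c\<^sup>2 * (norm (w - v))\<^sup>2"
    by (simp add: f_def power2_eq_square algebra_simps)
  have "norm (bernstein_log \<phi> w - bernstein_log \<phi> v) \<le> (1 / c) * norm (w - v)"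
  proof (rule field_differentiable_bound[where S = "{z. c \<le> Re z}"])
    show "convex {z. c \<le> Re z}" by (rule convex_halfspace_Re_ge)
    fix x assume x: "x \<in> {z. c \<le> Re z}"
    thus "(bernstein_log \<phi> has_field_derivative deriv (bernstein_log \<phi>) x) (at x within {z. c \<le> Re z})"
      using assms(1) bernstein_log_deriv(1)[OF bern, of x] by (auto intro: has_field_derivative_at_within)
    have "1 / Re x \<le> 1 / c" using x assms by (intro divide_left_mono) auto
    thus "norm (deriv (bernstein_log \<phi>) x) \<le> 1 / c"
      using bernstein_log_deriv(3)[OF bern, of x] x assms(1) by simp
  qed (use assms in auto)
  thus "norm (bernstein_log \<phi> w - bernstein_log \<phi> v) \<le> norm (w - v) / c" by simp
qed

lemma summable_inverse_Suc_square: "summable (\<lambda>k. C / (real (Suc k))\<^sup>2)"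
proof -
  have "summable (\<lambda>k. 1 / (real (Suc k))\<^sup>2)"
    using inverse_squares_sums by (simp add: sums_iff add.commute)
  from summable_mult[OF this, of C] show ?thesis by simp
qed

text \<open>The increments of the sequence are first-order Taylor errors of the logarithm on steps of length one, hence
  summable like \<open>1 / n\<^sup>2\<close>.\<close>

lemma gamma_const_limit:
  "(\<lambda>n. (\<Sum>k=1..n. deriv (on_reals \<phi>) (real k) / on_reals \<phi> (real k)) - ln (on_reals \<phi> (real n)))
      \<longlonglongrightarrow> gamma_const \<phi>"
proof -
  let ?r = "\<lambda>k. deriv (on_reals \<phi>) (real k) / on_reals \<phi> (real k)"
  let ?s = "\<lambda>n. (\<Sum>k=1..n. ?r k) - log_on_reals \<phi> (real n)"
  \<comment> \<open>the increment between \<open>n + 1\<close> and \<open>n + 2\<close>\<close>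
  define D where "D n = ?r (Suc (Suc n)) - (log_on_reals \<phi> (real (Suc (Suc n))) - log_on_reals \<phi> (real (Suc n)))" for n
  have "norm (D n) \<le> 4 / (real (Suc n))\<^sup>2" for n
  proof -
    let ?v = "of_real (real (Suc (Suc n)))" and ?w = "of_real (real (Suc n)) :: complex"
    have r: "of_real (?r (Suc (Suc n))) = deriv (bernstein_log \<phi>) ?v"
      using deriv_on_reals_div[of "real (Suc (Suc n))"] deriv_log_real[of "real (Suc (Suc n))"] by simp
    have "complex_of_real (D n) = bernstein_log \<phi> ?w - bernstein_log \<phi> ?v - deriv (bernstein_log \<phi>) ?v * (?w - ?v)"
      unfolding r[symmetric] using bernstein_log_eq_log_on_reals[of "real (Suc (Suc n))"]
        bernstein_log_eq_log_on_reals[of "real (Suc n)"] by (simp add: D_def)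
    moreover have "norm (bernstein_log \<phi> ?w - bernstein_log \<phi> ?v - deriv (bernstein_log \<phi>) ?v * (?w - ?v))
        \<le> 4 / (real (Suc n))\<^sup>2 * (norm (?w - ?v))\<^sup>2"
      by (rule bernstein_log_Taylor) auto
    moreover have "norm (?w - ?v) = 1" by (simp add: norm_minus_commute)
    ultimately show ?thesis by (metis mult.right_neutral norm_of_real power_one real_norm_def)
  qed
  hence "summable D"
    by (intro summable_comparison_test'[OF summable_inverse_Suc_square[of 4], of 0]) auto
  moreover have s_eq: "?s (Suc n) = ?s 1 + (\<Sum>k<n. D k)" for n
    by (induction n) (auto simp: D_def)
  ultimately have "(\<lambda>n. ?s (Suc n)) \<longlonglongrightarrow> ?s 1 + suminf D"
    unfolding s_eq by (intro tendsto_intros summable_LIMSEQ)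
  hence "?s \<longlonglongrightarrow> ?s 1 + suminf D" by (subst (asm) filterlim_sequentially_Suc)
  hence "convergent ?s" by (auto simp: convergent_def)
  thus ?thesis
    unfolding gamma_const_def convergent_LIMSEQ_iff log_on_reals_def .
qed

lemma W_eq_W_right: "0 < Re z \<Longrightarrow> W \<phi> z = W_right \<phi> z"
  by (simp add: W_def Let_def Least_eq_0)

text \<open>Each factor of the Weierstrass product is \<open>exp (t k)\<close> where \<open>t k\<close> is a Taylor error of the logarithm of order \<open>1 / k\<^sup>2\<close>,
  so the product is the exponential of an absolutely convergent series and does not vanish. Combining the
  exponential factors with the limit defining \<open>gamma_const \<phi>\<close> gives a Gauss-type limit
  formula for the modulus.\<close>

lemma W_limit:
  assumes z: "0 < Re z"
  shows "W \<phi> z \<noteq> 0"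
    and "(\<lambda>n. Re z * log_on_reals \<phi> (real n) + (\<Sum>k=1..n. log_on_reals \<phi> (real k))
              - (\<Sum>k=0..n. Re (bernstein_log \<phi> (of_nat k + z))))
           \<longlonglongrightarrow> ln (norm (W \<phi> z))"
proof -
  define t where "t k = bernstein_log \<phi> (of_nat (Suc k)) - bernstein_log \<phi> (of_nat (Suc k) + z)
      + deriv (bernstein_log \<phi>) (of_nat (Suc k)) * z" for k
  have t_bound: "norm (t k) \<le> (4 * (norm z)\<^sup>2) / (real (Suc k))\<^sup>2" for k
  proof -
    have "norm (bernstein_log \<phi> (of_nat (Suc k) + z) - bernstein_log \<phi> (of_nat (Suc k))
         - deriv (bernstein_log \<phi>) (of_nat (Suc k)) * (of_nat (Suc k) + z - of_nat (Suc k)))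
        \<le> 4 / (real (Suc k))\<^sup>2 * (norm (of_nat (Suc k) + z - of_nat (Suc k)))\<^sup>2"
      by (rule bernstein_log_Taylor) (use z in auto)
    moreover have "t k = - (bernstein_log \<phi> (of_nat (Suc k) + z) - bernstein_log \<phi> (of_nat (Suc k))
         - deriv (bernstein_log \<phi>) (of_nat (Suc k)) * (of_nat (Suc k) + z - of_nat (Suc k)))"
      by (simp add: t_def)
    ultimately show ?thesis by (simp only: norm_minus_cancel) simp
  qed
  have sum_t: "summable t"
    by (rule summable_comparison_test'[OF summable_inverse_Suc_square, of 0]) (rule t_bound)
  have exp_t: "\<phi> (of_nat (Suc k)) / \<phi> (of_nat (Suc k) + z) *
      exp (deriv \<phi> (of_nat (Suc k)) / \<phi> (of_nat (Suc k)) * z) = exp (t k)" for k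
    using z exp_bernstein_log[OF bern, of "of_nat (Suc k)"] exp_bernstein_log[OF bern, of "of_nat (Suc k) + z"]
      bernstein_log_deriv(2)[OF bern, of "of_nat (Suc k)"]
    by (simp add: t_def exp_add exp_diff)
  have W: "W \<phi> z = exp (- of_real (gamma_const \<phi>) * z) / \<phi> z * exp (suminf t)"
    unfolding W_eq_W_right[OF z] W_right_def exp_t by (simp add: prodinf_exp[OF sum_t])
  thus "W \<phi> z \<noteq> 0" using bernstein_nonzero[OF bern z] by simp
  have lnW: "ln (norm (W \<phi> z)) = - gamma_const \<phi> * Re z - Re (bernstein_log \<phi> z) + Re (suminf t)"
    using bernstein_nonzero[OF bern z] Re_bernstein_log[OF bern z]
    by (simp add: W norm_mult norm_divide ln_mult ln_div)
  have lim: "(\<lambda>n. - ((\<Sum>k=1..n. deriv (on_reals \<phi>) (real k) / on_reals \<phi> (real k)) - log_on_reals \<phi> (real n)) * Re z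
          - Re (bernstein_log \<phi> z) + Re (\<Sum>k<n. t k)) \<longlonglongrightarrow> ln (norm (W \<phi> z))"
    unfolding lnW using gamma_const_limit[folded log_on_reals_def]
    by (intro tendsto_intros summable_LIMSEQ sum_t)
  have eq: "- ((\<Sum>k=1..n. deriv (on_reals \<phi>) (real k) / on_reals \<phi> (real k)) - log_on_reals \<phi> (real n)) * Re z
          - Re (bernstein_log \<phi> z) + Re (\<Sum>k<n. t k) =
        Re z * log_on_reals \<phi> (real n) + (\<Sum>k=1..n. log_on_reals \<phi> (real k))
              - (\<Sum>k=0..n. Re (bernstein_log \<phi> (of_nat k + z)))" for n
  proof -
    have Re_t: "Re (t k) = log_on_reals \<phi> (real (Suc k)) - Re (bernstein_log \<phi> (of_nat (Suc k) + z)) +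
         deriv (on_reals \<phi>) (real (Suc k)) / on_reals \<phi> (real (Suc k)) * Re z" for k
      using bernstein_log_eq_log_on_reals[of "real (Suc k)"] deriv_on_reals_div[of "real (Suc k)"]
        deriv_log_real[of "real (Suc k)"]
      by (simp add: t_def) (metis Im_complex_of_real diff_zero mult_zero_left)
    show ?thesis
      by (induction n) (simp_all add: Re_t algebra_simps)
  qed
  show "(\<lambda>n. Re z * log_on_reals \<phi> (real n) + (\<Sum>k=1..n. log_on_reals \<phi> (real k))
              - (\<Sum>k=0..n. Re (bernstein_log \<phi> (of_nat k + z))))
           \<longlonglongrightarrow> ln (norm (W \<phi> z))"
    using lim unfolding eq .
qed

end

section \<open>The Stirling-type representation\<close>

lemma Re_compose_vertical_line_derivative:
  assumes "(F has_field_derivative D) (at (Complex a u))"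
  shows "((\<lambda>u. Re (F (Complex a u))) has_real_derivative - Im D) (at u)"
proof -
  have C: "Complex a v = of_real a + \<i> * of_real v" for v by (simp add: complex_eq_iff)
  have "((\<lambda>w. of_real a + \<i> * w) has_field_derivative \<i>) (at (of_real u))"
    by (auto intro!: derivative_eq_intros)
  hence "((\<lambda>w. F (of_real a + \<i> * w)) has_field_derivative D * \<i>) (at (of_real u))"
    using assms by (intro DERIV_chain2[where f = F and g = "\<lambda>w. of_real a + \<i> * w"]) (auto simp: C)
  hence "((\<lambda>u. F (Complex a u)) has_vector_derivative D * \<i>) (at u)"
    using has_vector_derivative_real_field[of "\<lambda>w. F (of_real a + \<i> * w)" "D * \<i>" u] by (simp add: C)
  from bounded_linear.has_vector_derivative[OF bounded_linear_Re this] show ?thesis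
    by (simp add: has_real_derivative_iff_has_vector_derivative)
qed

lemma deriv_funpow_2_eq:
  fixes f g g1 :: "real \<Rightarrow> real"
  assumes "open S" "u \<in> S" "\<And>v. v \<in> S \<Longrightarrow> f v = g v"
    "\<And>v. v \<in> S \<Longrightarrow> (g has_real_derivative g1 v) (at v)" "(g1 has_real_derivative g2) (at u)"
  shows "(deriv ^^ 2) f u = g2"
proof -
  have "deriv f v = g1 v" if "v \<in> S" for v
    by (rule DERIV_imp_deriv, rule has_field_derivative_transform_within_open[OF assms(4)[OF that] assms(1) that])
       (simp add: assms(3))
  hence "(deriv f has_real_derivative g2) (at u)"
    by (intro has_field_derivative_transform_within_open[OF assms(5) assms(1,2)]) simp
  thus ?thesis by (simp add: numeral_2_eq_2 DERIV_imp_deriv)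
qed

text \<open>Both remainder terms are trapezoidal remainders of functions of this form: \<open>E\<close> with the points \<open>z\<close> and
  \<open>Re z\<close> and lower limit 0, and \<open>R\<close> with the points \<open>a\<close> and 0 and lower limit 1.\<close>

definition log_ratio :: "(complex \<Rightarrow> complex) \<Rightarrow> complex \<Rightarrow> complex \<Rightarrow> real \<Rightarrow> real" where
  "log_ratio \<phi> w z u = Re (bernstein_log \<phi> (of_real u + w)) - Re (bernstein_log \<phi> (of_real u + z))"

definition log_ratio_d2 :: "(complex \<Rightarrow> complex) \<Rightarrow> complex \<Rightarrow> complex \<Rightarrow> real \<Rightarrow> real" where
  "log_ratio_d2 \<phi> w z u = Re (deriv (deriv (bernstein_log \<phi>)) (of_real u + w))
      - Re (deriv (deriv (bernstein_log \<phi>)) (of_real u + z))"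

context
  fixes \<phi> assumes bern: "\<phi> \<in> bernstein_functions"
begin

text \<open>A primitive of the logarithm replaces contour integrals: \<open>A\<close> and \<open>G\<close> are differences of its real part along
  vertical and horizontal segments.\<close>

lemma bernstein_log_primitive:
  obtains F where "\<And>z. 0 < Re z \<Longrightarrow> (F has_field_derivative bernstein_log \<phi> z) (at z)"
proof (rule holomorphic_convex_primitive'[OF convex_right_half_plane open_right_half_plane
        bernstein_log_holomorphic[OF bern]])
  fix F
  assume F: "\<And>z. z \<in> right_half_plane \<Longrightarrow>
      (F has_field_derivative bernstein_log \<phi> z) (at z within right_half_plane)"
  show thesis
  proof (rule that)
    fix z :: complex assume "0 < Re z"
    hence z: "z \<in> right_half_plane" by simp
    show "(F has_field_derivative bernstein_log \<phi> z) (at z)"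
      using F[OF z] unfolding at_within_open[OF z open_right_half_plane] .
  qed
qed

lemma bernstein_log_continuous: "continuous_on right_half_plane (bernstein_log \<phi>)"
  by (rule holomorphic_on_imp_continuous_on[OF bernstein_log_holomorphic[OF bern]])

lemma continuous_on_vertical:
  assumes "0 < a" "continuous_on right_half_plane h"
  shows "continuous_on UNIV (\<lambda>u. h (Complex a u))"
  by (rule continuous_on_compose2[OF assms(2)])
     (use assms(1) in \<open>auto simp: Complex_eq intro!: continuous_intros\<close>)

lemma continuous_on_horizontal:
  assumes "continuous_on right_half_plane h"
  shows "continuous_on {- Re z<..} (\<lambda>u. h (of_real u + z))"
  by (rule continuous_on_compose2[OF assms])
     (auto intro!: continuous_intros)

lemma A_eq_primitive:
  assumes F: "\<And>z. 0 < Re z \<Longrightarrow> (F has_field_derivative bernstein_log \<phi> z) (at z)" and z: "0 < Re z"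
  shows "A \<phi> z = Re (F (of_real (Re z))) - Re (F z)"
proof -
  define a b where "a = Re z" and "b = Im z"
  have ab: "0 < a" "z = Complex a b" using z by (auto simp: a_def b_def)
  have "A \<phi> z = (LBINT u=ereal 0..ereal b. Im (bernstein_log \<phi> (Complex a u)))"
    using ab(1) by (simp add: A_def ab(2) zero_ereal_def Im_bernstein_log[OF bern])
  also have "\<dots> = - Re (F (Complex a b)) - (- Re (F (Complex a 0)))"
  proof (rule interval_integral_FTC_finite)
    have "continuous_on UNIV (\<lambda>u. bernstein_log \<phi> (Complex a u))"
      by (rule continuous_on_vertical[OF ab(1) bernstein_log_continuous])
    thus "continuous_on {min 0 b..max 0 b} (\<lambda>u. Im (bernstein_log \<phi> (Complex a u)))"
      by (intro continuous_intros continuous_on_subset[where t = "{min 0 b..max 0 b}"]) auto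
    fix u
    have "((\<lambda>u. - Re (F (Complex a u))) has_real_derivative - (- Im (bernstein_log \<phi> (Complex a u)))) (at u)"
      by (rule DERIV_minus, rule Re_compose_vertical_line_derivative, rule F) (use ab in simp)
    thus "((\<lambda>u. - Re (F (Complex a u))) has_vector_derivative Im (bernstein_log \<phi> (Complex a u)))
            (at u within {min 0 b..max 0 b})"
      by (auto simp: has_real_derivative_iff_has_vector_derivative intro: has_vector_derivative_at_within)
  qed
  finally show ?thesis by (simp add: ab(2) complex_of_real_def)
qed

text \<open>The argument of \<open>\<phi>(a + i u)\<close> is at most \<open>\<bar>u\<bar> / a\<close>, as the logarithm has derivative at most \<open>1 / a\<close> and
  is real at \<open>a\<close>.\<close>

lemma A_bound:
  assumes z: "0 < Re z"
  shows "\<bar>A \<phi> z\<bar> \<le> (Im z)\<^sup>2 / Re z"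
proof -
  obtain F where F: "\<And>z. 0 < Re z \<Longrightarrow> (F has_field_derivative bernstein_log \<phi> z) (at z)"
    using bernstein_log_primitive by blast
  define a b where "a = Re z" and "b = Im z"
  have ab: "0 < a" "z = Complex a b" using z by (auto simp: a_def b_def)
  have "norm (Re (F (Complex a b)) - Re (F (Complex a 0))) \<le> \<bar>b\<bar> / a * norm (b - 0)"
  proof (rule field_differentiable_bound[where S = "{- \<bar>b\<bar>..\<bar>b\<bar>}"])
    fix u assume u: "u \<in> {- \<bar>b\<bar>..\<bar>b\<bar>}"
    show "((\<lambda>u. Re (F (Complex a u))) has_real_derivative - Im (bernstein_log \<phi> (Complex a u)))
        (at u within {- \<bar>b\<bar>..\<bar>b\<bar>})"
      by (rule has_field_derivative_at_within, rule Re_compose_vertical_line_derivative, rule F)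
         (use ab in simp)
    have "\<bar>Im (bernstein_log \<phi> (Complex a u))\<bar> = \<bar>Im (bernstein_log \<phi> (Complex a u) - bernstein_log \<phi> (of_real a))\<bar>"
      using bernstein_log_eq_log_on_reals[OF bern ab(1)] by simp
    also have "\<dots> \<le> norm (bernstein_log \<phi> (Complex a u) - bernstein_log \<phi> (of_real a))"
      by (rule abs_Im_le_cmod)
    also have "\<dots> \<le> norm (Complex a u - of_real a) / a"
      by (rule bernstein_log_Taylor[OF bern]) (use ab in auto)
    also have "Complex a u - of_real a = \<i> * of_real u" by (simp add: complex_eq_iff)
    also have "norm (\<i> * of_real u) / a \<le> \<bar>b\<bar> / a"
      using u ab by (intro divide_right_mono) (auto simp: norm_mult)
    finally show "norm (- Im (bernstein_log \<phi> (Complex a u))) \<le> \<bar>b\<bar> / a" by simp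
  qed auto
  hence "\<bar>Re (F (Complex a 0)) - Re (F (Complex a b))\<bar> \<le> \<bar>b\<bar> / a * \<bar>b\<bar>"
    by (simp add: abs_minus_commute)
  moreover have "\<bar>b\<bar> / a * \<bar>b\<bar> = (Im z)\<^sup>2 / Re z"
    using ab(1) unfolding a_def b_def by (simp add: power2_eq_square flip: abs_mult)
  moreover have "A \<phi> z = Re (F (Complex a 0)) - Re (F (Complex a b))"
    using A_eq_primitive[OF F z] by (simp add: ab(2) complex_of_real_def)
  ultimately show ?thesis by (simp only:)
qed

lemma bernstein_log_line_derivs:
  assumes "0 < u + Re z"
  shows "((\<lambda>u. Re (bernstein_log \<phi> (of_real u + z))) has_real_derivative
            Re (deriv (bernstein_log \<phi>) (of_real u + z))) (at u)"
    and "((\<lambda>u. Re (deriv (bernstein_log \<phi>) (of_real u + z))) has_real_derivative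
            Re (deriv (deriv (bernstein_log \<phi>)) (of_real u + z))) (at u)"
    and "\<bar>Re (deriv (deriv (bernstein_log \<phi>)) (of_real u + z))\<bar> \<le> 4 / (u + Re z)\<^sup>2"
  using assms bernstein_log_deriv(1)[OF bern, of "of_real u + z"]
    bernstein_log_deriv2[OF bern, of "of_real u + z"]
    abs_Re_le_cmod[of "deriv (deriv (bernstein_log \<phi>)) (of_real u + z)"]
  by (auto intro!: Re_compose_real_line_derivative)

lemma continuous_on_deriv2:
  "continuous_on {- Re z<..} (\<lambda>u. Re (deriv (deriv (bernstein_log \<phi>)) (of_real u + z)))"
proof -
  have "deriv (deriv (bernstein_log \<phi>)) holomorphic_on right_half_plane"
    by (intro holomorphic_deriv bernstein_log_holomorphic[OF bern] open_right_half_plane)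
  hence "continuous_on right_half_plane (deriv (deriv (bernstein_log \<phi>)))"
    by (rule holomorphic_on_imp_continuous_on)
  from continuous_on_horizontal[OF this] show ?thesis by (rule continuous_on_Re)
qed

lemma log_ratio_trapezoid:
  assumes F: "\<And>z. 0 < Re z \<Longrightarrow> (F has_field_derivative bernstein_log \<phi> z) (at z)"
    and ms: "0 < real m + s" "s \<le> Re w" "s \<le> Re z"
  shows "(\<lambda>n. (\<Sum>k=m..n. log_ratio \<phi> w z (real k)) - (log_ratio \<phi> w z (real m) + log_ratio \<phi> w z (real n)) / 2
             - ((Re (F (of_real (real n) + w)) - Re (F (of_real (real n) + z)))
               - (Re (F (of_real (real m) + w)) - Re (F (of_real (real m) + z)))))
           \<longlonglongrightarrow> 1 / 2 * (LBINT u=ereal (real m)..\<infinity>. P u * log_ratio_d2 \<phi> w z u)" (is ?lim)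
    and "\<bar>LBINT u=ereal (real m)..\<infinity>. P u * log_ratio_d2 \<phi> w z u\<bar> \<le> 8 / (real m + s)" (is ?bound)
proof -
  have pos: "0 < u + Re w" "0 < u + Re z" "u + s \<le> u + Re w" "u + s \<le> u + Re z" "0 < u + s"
    if "real m \<le> u" for u using that ms by auto
  have bd: "\<bar>log_ratio_d2 \<phi> w z u\<bar> \<le> 8 / (u + s)\<^sup>2" if "real m \<le> u" for u
  proof -
    have "\<bar>Re (deriv (deriv (bernstein_log \<phi>)) (of_real u + x))\<bar> \<le> 4 / (u + s)\<^sup>2"
      if "s \<le> Re x" for x
    proof -
      have "(u + s)\<^sup>2 \<le> (u + Re x)\<^sup>2" using pos[OF \<open>real m \<le> u\<close>] that by (intro power_mono) auto
      hence "4 / (u + Re x)\<^sup>2 \<le> 4 / (u + s)\<^sup>2"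
        using pos[OF \<open>real m \<le> u\<close>] that by (intro divide_left_mono mult_pos_pos zero_less_power) auto
      thus ?thesis using bernstein_log_line_derivs(3)[of u x] pos[OF \<open>real m \<le> u\<close>] that by simp
    qed
    from this[of w] this[of z] show ?thesis using ms unfolding log_ratio_d2_def by simp
  qed
  have cont: "continuous_on {real m..} (log_ratio_d2 \<phi> w z)"
    unfolding log_ratio_d2_def
    by (intro continuous_on_diff continuous_on_subset[OF continuous_on_deriv2]) (use ms in auto)
  show ?bound
    by (rule P_integral_bound(2)) (use ms bd in \<open>auto intro!: continuous_on_subset[OF cont]\<close>)
  have F': "((\<lambda>u. Re (F (of_real u + x))) has_real_derivative Re (bernstein_log \<phi> (of_real u + x))) (at u)"
    if "0 < u + Re x" for u x
    by (rule Re_compose_real_line_derivative, rule F) (use that in simp)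
  show ?lim
    by (rule trapezoid_limit[where s = s and K = 8 and
          ?f1.0 = "\<lambda>u. Re (deriv (bernstein_log \<phi>) (of_real u + w)) - Re (deriv (bernstein_log \<phi>) (of_real u + z))"])
       (use ms bd cont pos in \<open>auto simp: log_ratio_def[abs_def] log_ratio_d2_def[abs_def]
          intro!: DERIV_diff F' bernstein_log_line_derivs\<close>)
qed

lemma E_eq:
  assumes "0 < Re z"
  shows "E \<phi> z = 1 / 2 * (LBINT u=ereal (real 0)..\<infinity>. P u * log_ratio_d2 \<phi> z (of_real (Re z)) u)"
proof -
  have "(deriv ^^ 2) (\<lambda>v. ln (cmod (\<phi> (of_real v + z)) / on_reals \<phi> (v + Re z))) u =
          log_ratio_d2 \<phi> z (of_real (Re z)) u" if "0 < u" for u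
  proof (rule deriv_funpow_2_eq[where S = "{0<..}"])
    show "ln (cmod (\<phi> (of_real v + z)) / on_reals \<phi> (v + Re z)) = log_ratio \<phi> z (of_real (Re z)) v"
      if "v \<in> {0<..}" for v
      using that assms bernstein_pos[OF bern, of "v + Re z"] bernstein_nonzero[OF bern, of "of_real v + z"]
        bernstein_log_eq_log_on_reals[OF bern, of "v + Re z"]
      by (simp add: log_ratio_def Re_bernstein_log[OF bern] ln_div log_on_reals_def bernstein_of_real[OF bern]
          flip: of_real_add)
    show "(log_ratio \<phi> z (of_real (Re z)) has_real_derivative
       (Re (deriv (bernstein_log \<phi>) (of_real v + z)) - Re (deriv (bernstein_log \<phi>) (of_real v + of_real (Re z))))) (at v)"
      if "v \<in> {0<..}" for v
      unfolding log_ratio_def[abs_def] by (intro DERIV_diff bernstein_log_line_derivs) (use that assms in auto)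
    show "((\<lambda>v. Re (deriv (bernstein_log \<phi>) (of_real v + z)) - Re (deriv (bernstein_log \<phi>) (of_real v + of_real (Re z))))
        has_real_derivative log_ratio_d2 \<phi> z (of_real (Re z)) u) (at u)"
      unfolding log_ratio_d2_def by (intro DERIV_diff bernstein_log_line_derivs) (use that assms in auto)
  qed (use that in auto)
  hence "(LBINT u=0..\<infinity>. P u * (deriv ^^ 2) (\<lambda>v. ln (cmod (\<phi> (of_real v + z)) / on_reals \<phi> (v + Re z))) u) =
     (LBINT u=0..\<infinity>. P u * log_ratio_d2 \<phi> z (of_real (Re z)) u)"
    by (intro interval_integral_cong) (auto simp: einterval_iff)
  thus ?thesis by (simp add: E_def zero_ereal_def)
qed

lemma R_eq:
  assumes "0 < a"
  shows "R \<phi> a = 1 / 2 * (LBINT u=ereal (real 1)..\<infinity>. P u * log_ratio_d2 \<phi> (of_real a) 0 u)"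
proof -
  have "(deriv ^^ 2) (\<lambda>v. ln (on_reals \<phi> (v + a) / on_reals \<phi> v)) u =
          log_ratio_d2 \<phi> (of_real a) 0 u" if "1 < u" for u
  proof (rule deriv_funpow_2_eq[where S = "{1<..}"])
    show "ln (on_reals \<phi> (v + a) / on_reals \<phi> v) = log_ratio \<phi> (of_real a) 0 v"
      if "v \<in> {1<..}" for v
      using that assms bernstein_pos[OF bern, of "v + a"] bernstein_pos[OF bern, of v]
        bernstein_log_eq_log_on_reals[OF bern, of "v + a"] bernstein_log_eq_log_on_reals[OF bern, of "v"]
      by (simp add: log_ratio_def ln_div log_on_reals_def flip: of_real_add)
    show "(log_ratio \<phi> (of_real a) 0 has_real_derivative
       (Re (deriv (bernstein_log \<phi>) (of_real v + of_real a)) - Re (deriv (bernstein_log \<phi>) (of_real v + 0)))) (at v)"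
      if "v \<in> {1<..}" for v
      unfolding log_ratio_def[abs_def] by (intro DERIV_diff bernstein_log_line_derivs) (use that assms in auto)
    show "((\<lambda>v. Re (deriv (bernstein_log \<phi>) (of_real v + of_real a)) - Re (deriv (bernstein_log \<phi>) (of_real v + 0)))
        has_real_derivative log_ratio_d2 \<phi> (of_real a) 0 u) (at u)"
      unfolding log_ratio_d2_def by (intro DERIV_diff bernstein_log_line_derivs) (use that assms in auto)
  qed (use that in auto)
  hence "(LBINT u=1..\<infinity>. P u * (deriv ^^ 2) (\<lambda>v. ln (on_reals \<phi> (v + a) / on_reals \<phi> v)) u) =
     (LBINT u=1..\<infinity>. P u * log_ratio_d2 \<phi> (of_real a) 0 u)"
    by (intro interval_integral_cong) (auto simp: einterval_iff one_ereal_def)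
  thus ?thesis by (simp add: R_def one_ereal_def)
qed

lemma E_bound:
  assumes "0 < Re z"
  shows "\<bar>E \<phi> z\<bar> \<le> 4 / Re z"
proof -
  obtain F where F: "\<And>z. 0 < Re z \<Longrightarrow> (F has_field_derivative bernstein_log \<phi> z) (at z)"
    using bernstein_log_primitive by blast
  have "\<bar>LBINT u=ereal (real 0)..\<infinity>. P u * log_ratio_d2 \<phi> z (of_real (Re z)) u\<bar> \<le> 8 / (real 0 + Re z)"
    by (rule log_ratio_trapezoid(2)[OF F]) (use assms in auto)
  thus ?thesis unfolding E_eq[OF assms] abs_mult by simp
qed

lemma R_bound:
  assumes "0 < a"
  shows "\<bar>R \<phi> a\<bar> \<le> 4"
proof -
  obtain F where F: "\<And>z. 0 < Re z \<Longrightarrow> (F has_field_derivative bernstein_log \<phi> z) (at z)"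
    using bernstein_log_primitive by blast
  have "\<bar>LBINT u=ereal (real 1)..\<infinity>. P u * log_ratio_d2 \<phi> (of_real a) 0 u\<bar> \<le> 8 / (real 1 + 0)"
    by (rule log_ratio_trapezoid(2)[OF F]) (use assms in auto)
  thus ?thesis unfolding R_eq[OF assms] abs_mult by simp
qed

lemma G_eq_primitive:
  assumes F: "\<And>z. 0 < Re z \<Longrightarrow> (F has_field_derivative bernstein_log \<phi> z) (at z)" and a: "0 < a"
  shows "G \<phi> a = Re (F (1 + of_real a)) - Re (F 1)"
proof -
  have "(LBINT u=ereal 1..ereal (1 + a). log_on_reals \<phi> u) = Re (F (of_real (1 + a) + 0)) - Re (F (of_real 1 + 0))"
  proof (rule interval_integral_FTC_finite)
    have d: "((\<lambda>u. Re (F (of_real u + 0))) has_real_derivative Re (bernstein_log \<phi> (of_real u + 0))) (at u)"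
      if "0 < u" for u
      by (rule Re_compose_real_line_derivative, rule F) (use that in simp)
    show "continuous_on {min 1 (1 + a)..max 1 (1 + a)} (log_on_reals \<phi>)"
      by (rule DERIV_continuous_on[OF has_field_derivative_at_within, OF log_on_reals_has_derivative[OF bern]])
         (use a in auto)
    fix u assume u: "min 1 (1 + a) \<le> u"
    hence "0 < u" using a by auto
    thus "((\<lambda>u. Re (F (of_real u + 0))) has_vector_derivative log_on_reals \<phi> u) (at u within {min 1 (1 + a)..max 1 (1 + a)})"
      using d[of u] bernstein_log_eq_log_on_reals[OF bern, of u]
      by (auto simp: has_real_derivative_iff_has_vector_derivative intro: has_vector_derivative_at_within)
  qed
  thus ?thesis by (simp add: G_def one_ereal_def log_on_reals_def)
qed

text \<open>The sum in the Gauss-type limit is split as \<open>ln \<bar>\<phi>(k + z)\<bar> = f(k) + ln \<phi>(k + a)\<close> and compared, for \<open>f\<close> and for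
  \<open>g(k) = ln \<phi>(k + a) - ln \<phi>(k)\<close>, with integrals by the trapezoidal rule. The integral of \<open>f\<close> telescopes to
  \<open>A(z) - A(z + n)\<close>, and \<open>A(z + n)\<close> vanishes in the limit; the integral of \<open>g\<close> is \<open>a ln \<phi>(n) - G(a)\<close> up to a vanishing error.\<close>

lemma ln_norm_W:
  assumes z: "0 < Re z"
  defines "a \<equiv> Re z"
  shows "ln (norm (W \<phi> z)) = (log_on_reals \<phi> 1 - log_on_reals \<phi> a - log_on_reals \<phi> (1 + a) - ln (norm (\<phi> z))) / 2
             + G \<phi> a - A \<phi> z - E \<phi> z - R \<phi> a"
proof -
  obtain F where F: "\<And>z. 0 < Re z \<Longrightarrow> (F has_field_derivative bernstein_log \<phi> z) (at z)"
    using bernstein_log_primitive by blast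
  have a: "0 < a" using z by (simp add: a_def)
  let ?f = "log_ratio \<phi> z (of_real a)" and ?g = "log_ratio \<phi> (of_real a) 0"
  let ?pf = "\<lambda>n. Re (F (of_real (real n) + z)) - Re (F (of_real (real n) + of_real a))"
  let ?pg = "\<lambda>n. Re (F (of_real (real n) + of_real a)) - Re (F (of_real (real n) + 0))"
  have lr: "Re (bernstein_log \<phi> (of_real x)) = log_on_reals \<phi> x" if "0 < x" for x
    using bernstein_log_eq_log_on_reals[OF bern that] by simp
  have lim0: "(\<lambda>n. K / real n) \<longlonglongrightarrow> 0" for K
    by (rule lim_const_over_n)

  have f_lim: "(\<lambda>n. ?f (real n)) \<longlonglongrightarrow> 0"
  proof (rule Lim_null_comparison[OF _ lim0[of "\<bar>Im z\<bar>"]])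
    show "\<forall>\<^sub>F n in sequentially. norm (?f (real n)) \<le> \<bar>Im z\<bar> / real n"
      using eventually_gt_at_top[of 0]
    proof eventually_elim
      case (elim n)
      have "\<bar>?f (real n)\<bar> \<le> norm (bernstein_log \<phi> (of_real (real n) + z) - bernstein_log \<phi> (of_real (real n) + of_real a))"
        unfolding log_ratio_def minus_complex.sel[symmetric] by (rule abs_Re_le_cmod)
      also have "\<dots> \<le> norm ((of_real (real n) + z) - (of_real (real n) + of_real a)) / real n"
        by (rule bernstein_log_Taylor[OF bern]) (use elim a in \<open>auto simp: a_def\<close>)
      also have "(of_real (real n) + z) - (of_real (real n) + of_real a) = \<i> * of_real (Im z)"
        by (simp add: complex_eq_iff a_def)
      finally show ?case by (simp add: norm_mult)
    qed
  qed
  have f0_eq: "?pf n = - A \<phi> (of_nat n + z)" for n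
    using A_eq_primitive[OF F, of "of_nat n + z"] z by (simp add: a_def)
  have f0_lim: "?pf \<longlonglongrightarrow> 0"
  proof (rule Lim_null_comparison[OF _ lim0[of "(Im z)\<^sup>2"]])
    show "\<forall>\<^sub>F n in sequentially. norm (?pf n) \<le> (Im z)\<^sup>2 / real n"
      using eventually_gt_at_top[of 0]
    proof eventually_elim
      case (elim n)
      have "norm (?pf n) \<le> (Im (of_nat n + z))\<^sup>2 / Re (of_nat n + z)"
        unfolding f0_eq using A_bound[of "of_nat n + z"] z by simp
      also have "\<dots> \<le> (Im z)\<^sup>2 / real n"
        using elim z by (auto intro!: divide_left_mono)
      finally show ?case .
    qed
  qed
  have "(\<lambda>n. (\<Sum>k=0..n. ?f (real k)) - (?f (real 0) + ?f (real n)) / 2 - (?pf n - ?pf 0)) \<longlonglongrightarrow> E \<phi> z"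
    unfolding E_eq[OF z, folded a_def] by (rule log_ratio_trapezoid(1)[OF F]) (use a in \<open>auto simp: a_def\<close>)
  hence "(\<lambda>n. ((\<Sum>k=0..n. ?f (real k)) - (?f (real 0) + ?f (real n)) / 2 - (?pf n - ?pf 0))
               + (?f (real 0) + ?f (real n)) / 2 + (?pf n - ?pf 0))
           \<longlonglongrightarrow> E \<phi> z + (?f (real 0) + 0) / 2 + (0 - ?pf 0)"
    by (intro tendsto_intros f_lim f0_lim) simp_all
  hence sum_f: "(\<lambda>n. \<Sum>k=0..n. ?f (real k)) \<longlonglongrightarrow> E \<phi> z + ?f 0 / 2 + A \<phi> z"
    using A_eq_primitive[OF F z] by (simp add: a_def)
  have g_lim: "(\<lambda>n. ?g (real n)) \<longlonglongrightarrow> 0"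
  proof (rule Lim_null_comparison[OF _ lim0[of a]])
    show "\<forall>\<^sub>F n in sequentially. norm (?g (real n)) \<le> a / real n"
      using eventually_gt_at_top[of 0]
    proof eventually_elim
      case (elim n)
      have "\<bar>?g (real n)\<bar> \<le> norm (bernstein_log \<phi> (of_real (real n) + of_real a) - bernstein_log \<phi> (of_real (real n) + 0))"
        unfolding log_ratio_def minus_complex.sel[symmetric] by (rule abs_Re_le_cmod)
      also have "\<dots> \<le> norm ((of_real (real n) + of_real a) - (of_real (real n) + 0) :: complex) / real n"
        by (rule bernstein_log_Taylor[OF bern]) (use elim a in auto)
      finally show ?case using a by simp
    qed
  qed
  \<comment> \<open>the integral of \<open>ln \<phi>\<close> over \<open>[n, n + a]\<close> against \<open>a ln \<phi>(n)\<close>\<close>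
  have g0_lim: "(\<lambda>n. ?pg n - a * log_on_reals \<phi> (real n)) \<longlonglongrightarrow> 0"
  proof (rule Lim_null_comparison[OF _ lim0[of "a\<^sup>2"]])
    show "\<forall>\<^sub>F n in sequentially. norm (?pg n - a * log_on_reals \<phi> (real n)) \<le> a\<^sup>2 / real n"
      using eventually_gt_at_top[of 0]
    proof eventually_elim
      case (elim n)
      let ?h = "\<lambda>u. Re (F (of_real u + 0)) - u * log_on_reals \<phi> (real n)"
      have "norm (?h (real n + a) - ?h (real n)) \<le> a / real n * norm (real n + a - real n)"
      proof (rule field_differentiable_bound[where S = "{real n..real n + a}"])
        fix u assume u: "u \<in> {real n..real n + a}"
        hence u0: "0 < u" using elim by simp
        have "(?h has_real_derivative Re (bernstein_log \<phi> (of_real u + 0)) - log_on_reals \<phi> (real n)) (at u)"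
        proof (rule DERIV_diff)
          show "((\<lambda>u. Re (F (of_real u + 0))) has_real_derivative Re (bernstein_log \<phi> (of_real u + 0))) (at u)"
            by (rule Re_compose_real_line_derivative(1)[OF F]) (use u0 in simp)
        qed (auto intro!: derivative_eq_intros)
        thus "(?h has_real_derivative Re (bernstein_log \<phi> (of_real u + 0)) - log_on_reals \<phi> (real n))
           (at u within {real n..real n + a})" by (rule has_field_derivative_at_within)
        have "Re (bernstein_log \<phi> (of_real u + 0)) - log_on_reals \<phi> (real n) =
             Re (bernstein_log \<phi> (of_real u) - bernstein_log \<phi> (of_real (real n)))"
          using lr[of "real n"] elim by simp
        also have "norm \<dots> \<le> norm (bernstein_log \<phi> (of_real u) - bernstein_log \<phi> (of_real (real n)))"
          unfolding real_norm_def by (rule abs_Re_le_cmod)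
        also have "\<dots> \<le> norm (of_real u - of_real (real n) :: complex) / real n"
          by (rule bernstein_log_Taylor[OF bern]) (use u elim in auto)
        also have "norm (of_real u - of_real (real n) :: complex) = u - real n"
          using u by (simp only: of_real_diff[symmetric] norm_of_real) simp
        also have "(u - real n) / real n \<le> a / real n"
          using u by (intro divide_right_mono) auto
        finally show "norm (Re (bernstein_log \<phi> (of_real u + 0)) - log_on_reals \<phi> (real n)) \<le> a / real n" .
      qed (use a in auto)
      thus ?case using a by (simp add: algebra_simps power2_eq_square)
    qed
  qed
  have "(\<lambda>n. (\<Sum>k=1..n. ?g (real k)) - (?g (real 1) + ?g (real n)) / 2 - (?pg n - ?pg 1)) \<longlonglongrightarrow> R \<phi> a"
    unfolding R_eq[OF a] by (rule log_ratio_trapezoid(1)[OF F, where s = 0]) (use a in auto)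
  hence "(\<lambda>n. ((\<Sum>k=1..n. ?g (real k)) - (?g (real 1) + ?g (real n)) / 2 - (?pg n - ?pg 1))
               + (?g (real 1) + ?g (real n)) / 2 + (?pg n - a * log_on_reals \<phi> (real n) - ?pg 1))
           \<longlonglongrightarrow> R \<phi> a + (?g (real 1) + 0) / 2 + (0 - ?pg 1)"
    by (intro tendsto_intros g_lim g0_lim) simp_all
  hence sum_g: "(\<lambda>n. (\<Sum>k=1..n. ?g (real k)) - a * log_on_reals \<phi> (real n)) \<longlonglongrightarrow> R \<phi> a + ?g 1 / 2 - G \<phi> a"
    by (simp add: G_eq_primitive[OF F a] algebra_simps)
  have "(\<lambda>n. - (\<Sum>k=0..n. ?f (real k)) - log_on_reals \<phi> a
            - ((\<Sum>k=1..n. ?g (real k)) - a * log_on_reals \<phi> (real n)))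
         \<longlonglongrightarrow> - (E \<phi> z + ?f 0 / 2 + A \<phi> z) - log_on_reals \<phi> a - (R \<phi> a + ?g 1 / 2 - G \<phi> a)"
    by (intro tendsto_intros sum_f sum_g)
  moreover have "- (\<Sum>k=0..n. ?f (real k)) - log_on_reals \<phi> a
            - ((\<Sum>k=1..n. ?g (real k)) - a * log_on_reals \<phi> (real n)) =
       a * log_on_reals \<phi> (real n) + (\<Sum>k=1..n. log_on_reals \<phi> (real k))
              - (\<Sum>k=0..n. Re (bernstein_log \<phi> (of_nat k + z)))" for n
  proof -
    have "(\<Sum>k=0..n. Re (bernstein_log \<phi> (of_real (real k) + of_real a))) =
      log_on_reals \<phi> a + (\<Sum>k=1..n. Re (bernstein_log \<phi> (of_real (real k) + of_real a)))"
      using lr[OF a] by (simp add: sum.atLeast_Suc_atMost)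
    moreover have "(\<Sum>k=1..n. Re (bernstein_log \<phi> (of_real (real k) + 0))) = (\<Sum>k=1..n. log_on_reals \<phi> (real k))"
    proof (intro sum.cong refl)
      fix k assume "k \<in> {1..n}"
      thus "Re (bernstein_log \<phi> (of_real (real k) + 0)) = log_on_reals \<phi> (real k)"
        using lr[of "real k"] by simp
    qed
    ultimately show ?thesis by (simp add: log_ratio_def sum_subtractf)
  qed
  ultimately have "ln (norm (W \<phi> z)) = - (E \<phi> z + ?f 0 / 2 + A \<phi> z) - log_on_reals \<phi> a - (R \<phi> a + ?g 1 / 2 - G \<phi> a)"
    using W_limit(2)[OF bern z, folded a_def] by (simp only: LIMSEQ_unique)
  moreover have "?f 0 = ln (norm (\<phi> z)) - log_on_reals \<phi> a"
    using Re_bernstein_log[OF bern z] lr[OF a] by (simp add: log_ratio_def)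
  moreover have "?g 1 = log_on_reals \<phi> (1 + a) - log_on_reals \<phi> 1"
    using lr[of "1 + a"] lr[of 1] a by (simp add: log_ratio_def)
  ultimately show ?thesis by (simp add: field_simps)
qed

theorem norm_W_eq:
  assumes "0 < a"
  shows "cmod (W \<phi> (Complex a b)) =
          sqrt (on_reals \<phi> 1) / sqrt (on_reals \<phi> a * on_reals \<phi> (1 + a) * cmod (\<phi> (Complex a b))) *
          exp (G \<phi> a - A \<phi> (Complex a b)) * exp (- E \<phi> (Complex a b) - R \<phi> a)"
proof -
  let ?z = "Complex a b"
  have pos: "0 < on_reals \<phi> 1" "0 < on_reals \<phi> a" "0 < on_reals \<phi> (1 + a)" "0 < cmod (\<phi> ?z)"
    using bernstein_pos[OF bern] bernstein_nonzero[OF bern, of ?z] assms by auto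
  have sq: "sqrt x = exp (ln x / 2)" if "0 < x" for x
    using that by (simp add: powr_half_sqrt[symmetric] powr_def)
  have "cmod (W \<phi> ?z) = exp (ln (norm (W \<phi> ?z)))"
    using W_limit(1)[OF bern, of ?z] assms by simp
  also have "\<dots> = exp (ln (on_reals \<phi> 1) / 2) / exp (ln (on_reals \<phi> a * on_reals \<phi> (1 + a) * cmod (\<phi> ?z)) / 2) *
      exp (G \<phi> a - A \<phi> ?z) * exp (- E \<phi> ?z - R \<phi> a)"
    unfolding exp_add[symmetric] exp_diff[symmetric]
    using ln_norm_W[of ?z] assms pos by (simp add: log_on_reals_def ln_mult field_simps)
  finally show ?thesis using pos by (simp add: sq)
qed

end

section \<open>Uniformity and asymptotics along the real axis\<close>

lemma one_in_bernstein_functions: "(\<lambda>_. 1) \<in> bernstein_functions"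
proof -
  have "levy_khintchine (\<lambda>_. 1) 1 0 (null_measure borel)"
    by (simp add: levy_khintchine_def null_measure_def[symmetric])
  moreover have "\<exists>z::complex. 0 \<le> Re z \<and> (1::complex) \<noteq> 0"
    by (intro exI[of _ 0]) simp
  ultimately show ?thesis unfolding bernstein_functions_def by blast
qed

text \<open>The bounds on \<open>E\<close> and \<open>R\<close> involve no information on \<open>\<phi>\<close>, so they hold for the supremum; the constant function
  1 serves as a witness for the lower bound.\<close>

lemma Stirling_error_bounds:
  assumes "0 < a"
  shows "\<exists>c C. 0 < c \<and>
        ereal c \<le> (SUP \<phi>\<in>bernstein_functions. SUP z\<in>{z. a < Re z}.
                     ereal \<bar>exp (- E \<phi> z - R \<phi> (Re z))\<bar>) \<and>
        (SUP \<phi>\<in>bernstein_functions. SUP z\<in>{z. a < Re z}.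
           ereal \<bar>exp (- E \<phi> z - R \<phi> (Re z))\<bar>) \<le> ereal C"
proof -
  have bd: "\<bar>- E \<phi> z - R \<phi> (Re z)\<bar> \<le> 4 / a + 4" if "\<phi> \<in> bernstein_functions" "a < Re z" for \<phi> z
  proof -
    have "4 / Re z \<le> 4 / a" using that assms by (intro divide_left_mono) auto
    thus ?thesis using E_bound[OF that(1), of z] R_bound[OF that(1), of "Re z"] that assms by simp
  qed
  show ?thesis
  proof (rule exI[of _ "exp (- (4 / a + 4))"], rule exI[of _ "exp (4 / a + 4)"], intro conjI)
    show "(SUP \<phi>\<in>bernstein_functions. SUP z\<in>{z. a < Re z}.
           ereal \<bar>exp (- E \<phi> z - R \<phi> (Re z))\<bar>) \<le> ereal (exp (4 / a + 4))"
    proof (intro SUP_least)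
      fix \<phi> z assume "\<phi> \<in> bernstein_functions" "z \<in> {z. a < Re z}"
      from bd[OF this(1)] this(2) show "ereal \<bar>exp (- E \<phi> z - R \<phi> (Re z))\<bar> \<le> ereal (exp (4 / a + 4))"
        by (auto simp: abs_le_iff)
    qed
    have "ereal (exp (- (4 / a + 4))) \<le> ereal \<bar>exp (- E (\<lambda>_. 1) (of_real (a + 1)) - R (\<lambda>_. 1) (Re (of_real (a + 1))))\<bar>"
      using bd[OF one_in_bernstein_functions, of "of_real (a + 1)"] by (simp add: abs_le_iff)
    also have "\<dots> \<le> (SUP z\<in>{z. a < Re z}. ereal \<bar>exp (- E (\<lambda>_. 1) z - R (\<lambda>_. 1) (Re z))\<bar>)"
      by (rule SUP_upper) simp
    also have "\<dots> \<le> (SUP \<phi>\<in>bernstein_functions. SUP z\<in>{z. a < Re z}. ereal \<bar>exp (- E \<phi> z - R \<phi> (Re z))\<bar>)"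
      by (rule SUP_upper[OF one_in_bernstein_functions])
    finally show "ereal (exp (- (4 / a + 4))) \<le>
       (SUP \<phi>\<in>bernstein_functions. SUP z\<in>{z. a < Re z}. ereal \<bar>exp (- E \<phi> z - R \<phi> (Re z))\<bar>)" .
  qed simp
qed

context
  fixes \<phi> assumes bern: "\<phi> \<in> bernstein_functions"
begin

lemma A_tendsto_0: "((\<lambda>a. A \<phi> (Complex a b)) \<longlongrightarrow> 0) at_top"
proof (rule Lim_null_comparison)
  show "\<forall>\<^sub>F a in at_top. norm (A \<phi> (Complex a b)) \<le> b\<^sup>2 / (a + 0)"
    using eventually_gt_at_top[of 0] by eventually_elim (use A_bound[OF bern, of "Complex _ b"] in auto)
qed (rule tendsto_divide_add_at_top)

text \<open>Integration by parts.\<close>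

lemma H_eq:
  assumes a: "0 < a"
  shows "H \<phi> a = (1 + a) * log_on_reals \<phi> (1 + a) - log_on_reals \<phi> 1 - G \<phi> a"
proof -
  obtain F where F: "\<And>z. 0 < Re z \<Longrightarrow> (F has_field_derivative bernstein_log \<phi> z) (at z)"
    using bernstein_log_primitive[OF bern] by blast
  let ?l1 = "\<lambda>u. Re (deriv (bernstein_log \<phi>) (of_real u + 0))"
  let ?K = "\<lambda>u. u * log_on_reals \<phi> u - Re (F (of_real u + 0))"
  have "H \<phi> a = (LBINT u=ereal 1..ereal (1 + a). u * ?l1 u)"
    unfolding H_def one_ereal_def[symmetric]
    by (rule interval_integral_cong)
       (use a deriv_on_reals_div[OF bern] in
         \<open>auto simp: einterval_iff one_ereal_def min_def times_divide_eq_right[symmetric]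
            simp del: times_divide_eq_right split: if_splits\<close>)
  also have "\<dots> = ?K (1 + a) - ?K 1"
  proof (rule interval_integral_FTC_finite)
    have "(\<lambda>u. ?l1 u) differentiable (at u)" if "0 < u" for u
      using bernstein_log_line_derivs(2)[OF bern, of u 0] that by (auto simp: real_differentiable_def)
    hence "isCont ?l1 u" if "0 < u" for u using that differentiable_imp_continuous_within by blast
    thus "continuous_on {min 1 (1 + a)..max 1 (1 + a)} (\<lambda>u. u * ?l1 u)"
      using a by (intro continuous_intros continuous_at_imp_continuous_on) auto
    fix u assume "min 1 (1 + a) \<le> u"
    hence u: "0 < u" using a by auto
    have "((\<lambda>u. u * log_on_reals \<phi> u) has_real_derivative log_on_reals \<phi> u + u * ?l1 u) (at u)"
      using DERIV_mult[OF DERIV_ident log_on_reals_has_derivative[OF bern u]] by (simp add: algebra_simps)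
    moreover have "((\<lambda>u. Re (F (of_real u + 0))) has_real_derivative Re (bernstein_log \<phi> (of_real u + 0))) (at u)"
      by (rule Re_compose_real_line_derivative(1)[OF F]) (use u in simp)
    ultimately have "(?K has_real_derivative log_on_reals \<phi> u + u * ?l1 u - Re (bernstein_log \<phi> (of_real u + 0))) (at u)"
      by (rule DERIV_diff)
    thus "(?K has_vector_derivative u * ?l1 u) (at u within {min 1 (1 + a)..max 1 (1 + a)})"
      using bernstein_log_eq_log_on_reals[OF bern u]
      by (auto simp: has_real_derivative_iff_has_vector_derivative intro: has_vector_derivative_at_within)
  qed
  finally show ?thesis by (simp add: G_eq_primitive[OF bern F a])
qed

text \<open>The difference is the part of \<open>R\<close> shifted by \<open>a\<close>, a remainder integral starting at \<open>1 + a\<close>.\<close>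

lemma T_minus_R_bound:
  assumes a: "0 < a"
  shows "\<bar>T \<phi> - R \<phi> a\<bar> \<le> 2 / a"
proof -
  let ?l2 = "\<lambda>x u. Re (deriv (deriv (bernstein_log \<phi>)) (of_real u + of_real x))"
  have i: "set_integrable lborel {1<..} (\<lambda>u. P u * ?l2 x u)"
    and b: "\<bar>LBINT u=ereal 1..\<infinity>. P u * ?l2 x u\<bar> \<le> 4 / (1 + x)" if "0 \<le> x" for x
  proof -
    have "continuous_on {1<..} (?l2 x)"
      by (rule continuous_on_subset[OF continuous_on_deriv2[OF bern]]) (use that in auto)
    moreover have "\<bar>?l2 x u\<bar> \<le> 4 / (u + x)\<^sup>2" if "1 < u" for u
      using bernstein_log_line_derivs(3)[OF bern, of u "of_real x"] that \<open>0 \<le> x\<close> by simp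
    ultimately show "set_integrable lborel {1<..} (\<lambda>u. P u * ?l2 x u)"
      "\<bar>LBINT u=ereal 1..\<infinity>. P u * ?l2 x u\<bar> \<le> 4 / (1 + x)"
      using P_integral_bound[of 1 x 4 "?l2 x"] that by auto
  qed
  have "R \<phi> a = 1 / 2 * (LBINT u=ereal 1..\<infinity>. P u * ?l2 a u - P u * ?l2 0 u)"
    using R_eq[OF bern a] by (simp add: log_ratio_d2_def right_diff_distrib)
  also have "(LBINT u=ereal 1..\<infinity>. P u * ?l2 a u - P u * ?l2 0 u) =
      (LBINT u=ereal 1..\<infinity>. P u * ?l2 a u) - (LBINT u=ereal 1..\<infinity>. P u * ?l2 0 u)"
    by (rule interval_lebesgue_integral_diff) (use i[of a] i[of 0] a in \<open>auto simp: interval_integrable_to_infinity_eq\<close>)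
  finally have R: "R \<phi> a = 1 / 2 * ((LBINT u=ereal 1..\<infinity>. P u * ?l2 a u) - (LBINT u=ereal 1..\<infinity>. P u * ?l2 0 u))" .
  have "(deriv ^^ 2) (\<lambda>v. ln (on_reals \<phi> v)) u = ?l2 0 u" if "1 < u" for u
  proof (rule deriv_funpow_2_eq[where S = "{1<..}"])
    show "(log_on_reals \<phi> has_real_derivative Re (deriv (bernstein_log \<phi>) (of_real v + 0))) (at v)"
      if "v \<in> {1<..}" for v
      using log_on_reals_has_derivative[OF bern, of v] that by simp
    show "((\<lambda>v. Re (deriv (bernstein_log \<phi>) (of_real v + 0))) has_real_derivative ?l2 0 u) (at u)"
      using bernstein_log_line_derivs(2)[OF bern, of u 0] that by simp
  qed (use that in \<open>auto simp: log_on_reals_def\<close>)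
  hence "(LBINT u=1..\<infinity>. P u * (deriv ^^ 2) (\<lambda>v. ln (on_reals \<phi> v)) u) = (LBINT u=1..\<infinity>. P u * ?l2 0 u)"
    by (intro interval_integral_cong) (auto simp: einterval_iff one_ereal_def)
  hence "T \<phi> = - 1 / 2 * (LBINT u=ereal 1..\<infinity>. P u * ?l2 0 u)"
    by (simp add: T_def one_ereal_def)
  hence "\<bar>T \<phi> - R \<phi> a\<bar> = \<bar>LBINT u=ereal 1..\<infinity>. P u * ?l2 a u\<bar> / 2"
    unfolding R by (simp add: algebra_simps)
  also have "\<dots> \<le> (4 / (1 + a)) / 2"
    by (rule divide_right_mono[OF b]) (use a in auto)
  also have "\<dots> \<le> 2 / a" using a by (simp add: field_simps)
  finally show ?thesis .
qed

lemma log_on_reals_increment: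
  assumes a: "0 < a"
  shows "0 \<le> log_on_reals \<phi> (1 + a) - log_on_reals \<phi> a" "log_on_reals \<phi> (1 + a) - log_on_reals \<phi> a \<le> 1 / a"
proof -
  show "0 \<le> log_on_reals \<phi> (1 + a) - log_on_reals \<phi> a"
    using bernstein_mono[OF bern, of a "1 + a"] bernstein_pos[OF bern a] a by (simp add: log_on_reals_def)
  have "norm (bernstein_log \<phi> (of_real (1 + a)) - bernstein_log \<phi> (of_real a)) \<le> norm (of_real (1 + a) - of_real a :: complex) / a"
    by (rule bernstein_log_Taylor(2)[OF bern a]) (use a in auto)
  also have "bernstein_log \<phi> (of_real (1 + a)) - bernstein_log \<phi> (of_real a) =
      of_real (log_on_reals \<phi> (1 + a) - log_on_reals \<phi> a)"
    using bernstein_log_eq_log_on_reals[OF bern, of "1 + a"] bernstein_log_eq_log_on_reals[OF bern, of a] a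
    by simp
  finally show "log_on_reals \<phi> (1 + a) - log_on_reals \<phi> a \<le> 1 / a"
    by (simp only: norm_of_real) simp
qed

text \<open>After inserting the formulas for \<open>G\<close> and \<open>H\<close> only the increment \<open>D = ln \<phi>(1 + a) - ln \<phi>(a)\<close> remains besides \<open>E\<close>
  and \<open>T - R\<close>. As \<open>0 \<le> D \<le> 1 / a\<close> and \<open>Hstar = a (exp D - 1)\<close>, replacing \<open>a D\<close> by \<open>Hstar\<close> costs
  at most \<open>a D\<^sup>2 \<le> 1 / a\<close>.\<close>

lemma ln_norm_W_error:
  assumes a: "1 \<le> a"
  shows "\<bar>ln (norm (W \<phi> (Complex a b))) - (- T \<phi> - (ln (norm (\<phi> (Complex a b))) + log_on_reals \<phi> 1) / 2
            + (a * log_on_reals \<phi> a - H \<phi> a + Hstar \<phi> a - A \<phi> (Complex a b)))\<bar> \<le> 8 / a"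
proof -
  let ?z = "Complex a b"
  define D where "D = log_on_reals \<phi> (1 + a) - log_on_reals \<phi> a"
  have a0: "0 < a" using a by simp
  have D: "0 \<le> D" "D \<le> 1 / a" "D \<le> 1"
    using log_on_reals_increment[OF a0] a order.trans[of D "1 / a" 1] by (auto simp: D_def)
  have "on_reals \<phi> (a + 1) / on_reals \<phi> a = exp D"
    using bernstein_pos[OF bern, of a] bernstein_pos[OF bern, of "1 + a"] a
    by (simp add: D_def log_on_reals_def exp_diff add.commute)
  hence Hs: "Hstar \<phi> a = a * (exp D - 1)"
    using bernstein_pos[OF bern a0] by (simp add: Hstar_def diff_divide_distrib)
  have "a * (exp D - 1 - D) \<le> a * D\<^sup>2"
    using exp_bound[of D] D a by (intro mult_left_mono) auto
  also have "\<dots> \<le> a * (1 / a)\<^sup>2" using D a by (intro mult_left_mono power_mono) auto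
  also have "\<dots> = 1 / a" using a by (simp add: power2_eq_square)
  finally have ub: "a * (exp D - 1 - D) \<le> 1 / a" .
  have "D + 1 \<le> exp D" using exp_ge_add_one_self[of D] by (simp add: add.commute)
  hence lb: "0 \<le> a * (exp D - 1 - D)" using a by (intro mult_nonneg_nonneg) auto
  have eq: "ln (norm (W \<phi> ?z)) - (- T \<phi> - (ln (norm (\<phi> ?z)) + log_on_reals \<phi> 1) / 2
            + (a * log_on_reals \<phi> a - H \<phi> a + Hstar \<phi> a - A \<phi> ?z)) =
       D / 2 - a * (exp D - 1 - D) - E \<phi> ?z + (T \<phi> - R \<phi> a)"
    using ln_norm_W[OF bern, of ?z] a0 unfolding H_eq[OF a0] Hs D_def
    by (simp add: field_simps)
  have "\<bar>D / 2 - a * (exp D - 1 - D) - E \<phi> ?z + (T \<phi> - R \<phi> a)\<bar> \<le> 1 / a + 1 / a + 4 / a + 2 / a"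
    using D(1,2) ub lb E_bound[OF bern, of ?z] T_minus_R_bound[OF a0] a0
    unfolding complex.sel abs_le_iff by linarith
  thus ?thesis unfolding eq by simp
qed

lemma norm_W_asymptotics:
  "\<exists>r. r \<in> O[at_top](\<lambda>a. 1 / a) \<and>
           (\<forall>\<^sub>F a in at_top.
              cmod (W \<phi> (Complex a b)) =
                exp (- T \<phi>) / sqrt (cmod (\<phi> (Complex a b)) * on_reals \<phi> 1) *
                exp (a * ln (on_reals \<phi> a) - H \<phi> a + Hstar \<phi> a - A \<phi> (Complex a b)) *
                (1 + r a))"
proof -
  define M where "M a = - T \<phi> - (ln (norm (\<phi> (Complex a b))) + log_on_reals \<phi> 1) / 2
            + (a * log_on_reals \<phi> a - H \<phi> a + Hstar \<phi> a - A \<phi> (Complex a b))" for a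
  define \<delta> where "\<delta> a = ln (norm (W \<phi> (Complex a b))) - M a" for a
  have \<delta>: "\<bar>\<delta> a\<bar> \<le> 8 / a" if "1 \<le> a" for a
    using ln_norm_W_error[OF that, of b] by (simp add: \<delta>_def M_def)
  have "(\<lambda>a. exp (\<delta> a) - 1) \<in> O[at_top](\<lambda>a. 1 / a)"
  proof (rule bigoI[where c = 16])
    show "\<forall>\<^sub>F a in at_top. norm (exp (\<delta> a) - 1) \<le> 16 * norm (1 / a)"
      using eventually_ge_at_top[of 16]
    proof eventually_elim
      case (elim a)
      have "8 / a \<le> 1 / 2" using elim by (simp add: field_simps)
      hence "\<delta> a \<le> 1 / 2" using \<delta>[of a] elim by linarith
      hence "exp (\<delta> a) \<le> exp (1 / 2)" by simp
      also have "exp (1 / 2 :: real) \<le> 2"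
        using exp_bound[of "1 / 2"] by (simp add: power2_eq_square)
      finally have "max 1 (exp (\<delta> a)) \<le> 2" by simp
      hence "norm (\<delta> a) * max 1 (exp (\<delta> a)) \<le> norm (\<delta> a) * 2" by (intro mult_left_mono) auto
      moreover have "norm (exp (\<delta> a) - 1) \<le> norm (\<delta> a) * max 1 (exp (\<delta> a))"
      proof -
        have "exp (of_real (\<delta> a)) - 1 = complex_of_real (exp (\<delta> a) - 1)" by (simp add: exp_of_real)
        thus ?thesis using norm_exp_diff_1_le[of "of_real (\<delta> a)"] by (simp only: norm_of_real) simp
      qed
      ultimately have "norm (exp (\<delta> a) - 1) \<le> 2 * norm (\<delta> a)" by simp
      thus ?case using \<delta>[of a] elim by simp
    qed
  qed
  moreover have "\<forall>\<^sub>F a in at_top. cmod (W \<phi> (Complex a b)) =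
                exp (- T \<phi>) / sqrt (cmod (\<phi> (Complex a b)) * on_reals \<phi> 1) *
                exp (a * ln (on_reals \<phi> a) - H \<phi> a + Hstar \<phi> a - A \<phi> (Complex a b)) *
                (1 + (exp (\<delta> a) - 1))"
    using eventually_ge_at_top[of 1]
  proof eventually_elim
    case (elim a)
    let ?z = "Complex a b"
    have pos: "0 < cmod (\<phi> ?z)" "0 < on_reals \<phi> 1"
      using bernstein_nonzero[OF bern, of ?z] bernstein_pos[OF bern, of 1] elim by auto
    have "sqrt (cmod (\<phi> ?z) * on_reals \<phi> 1) = exp (ln (cmod (\<phi> ?z) * on_reals \<phi> 1) / 2)"
      using pos by (simp add: powr_half_sqrt[symmetric] powr_def)
    also have "\<dots> = exp ((ln (cmod (\<phi> ?z)) + log_on_reals \<phi> 1) / 2)"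
      using pos by (simp add: ln_mult log_on_reals_def)
    finally have sq: "sqrt (cmod (\<phi> ?z) * on_reals \<phi> 1) = \<dots>" .
    have "cmod (W \<phi> ?z) = exp (ln (cmod (W \<phi> ?z)))"
      using W_limit(1)[OF bern, of ?z] elim by simp
    also have "\<dots> = exp (- T \<phi>) / exp ((ln (cmod (\<phi> ?z)) + log_on_reals \<phi> 1) / 2) *
         exp (a * ln (on_reals \<phi> a) - H \<phi> a + Hstar \<phi> a - A \<phi> ?z) * exp (\<delta> a)"
      unfolding exp_add[symmetric] exp_diff[symmetric] by (simp add: \<delta>_def M_def log_on_reals_def)
    finally show ?case by (simp add: sq)
  qed
  ultimately show ?thesis by (intro exI[of _ "\<lambda>a. exp (\<delta> a) - 1"] conjI)
qed

end

section \<open>The phase integral as an integral of moduli\<close>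

context
  fixes \<phi> assumes bern: "\<phi> \<in> bernstein_functions"
begin

lemma ln_modulus_ratio_nonneg:
  assumes "0 < x"
  shows "0 \<le> ln (norm (\<phi> (Complex x b)) / on_reals \<phi> x)"
  using bernstein_norm_ge[OF bern, of "Complex x b"] bernstein_pos[OF bern assms] assms by simp

text \<open>Cauchy's theorem for \<open>ln \<phi>\<close> on the half-strip to the right of the segment from \<open>a\<close> to \<open>a + i b\<close>: the phase collected on
  the segment equals the growth of the modulus between its two horizontal sides, and the far side contributes
  nothing in the limit. The new integrand is nonnegative, which turns lower bounds on \<open>A\<close> into lower bounds on
  moduli inside the half-plane, where \<open>\<phi>\<close> is easy to control.\<close>

lemma A_eq_modulus_integral:
  assumes a: "0 < a"
  shows "set_integrable lborel {a<..} (\<lambda>x. ln (norm (\<phi> (Complex x b)) / on_reals \<phi> x))"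
    and "A \<phi> (Complex a b) = (LBINT x:{a<..}. ln (norm (\<phi> (Complex x b)) / on_reals \<phi> x))"
proof -
  obtain F where F: "\<And>z. 0 < Re z \<Longrightarrow> (F has_field_derivative bernstein_log \<phi> z) (at z)"
    using bernstein_log_primitive[OF bern] by blast
  let ?g = "\<lambda>x. ln (norm (\<phi> (Complex x b)) / on_reals \<phi> x)"
  let ?h = "\<lambda>x. Re (bernstein_log \<phi> (of_real x + Complex 0 b)) - Re (bernstein_log \<phi> (of_real x + 0))"
  let ?K = "\<lambda>x. Re (F (of_real x + Complex 0 b)) - Re (F (of_real x + 0))"
  have C: "of_real x + Complex 0 b = Complex x b" for x by (simp add: complex_eq_iff)
  have g: "?g x = ?h x" if "0 < x" for x
    using that bernstein_pos[OF bern that] bernstein_nonzero[OF bern, of "Complex x b"]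
      bernstein_log_eq_log_on_reals[OF bern that] Re_bernstein_log[OF bern, of "Complex x b"]
    by (simp add: C ln_div log_on_reals_def)
  have K: "?K x = - A \<phi> (Complex x b)" if "0 < x" for x
    using A_eq_primitive[OF bern F, of "Complex x b"] that by (simp add: C)
  have dK: "(?K has_real_derivative ?h x) (at x)" if "0 < x" for x
    by (intro DERIV_diff Re_compose_real_line_derivative(1)[OF F]) (use that in auto)
  have contK: "isCont ?K x" if "0 < x" for x using DERIV_isCont[OF dK[OF that]] .
  have A: "((?K \<circ> real_of_ereal) \<longlongrightarrow> ?K a) (at_right (ereal a))"
    unfolding ereal_tendsto_simps
    by (rule tendsto_mono[OF _ contK[OF a, unfolded isCont_def]]) (simp add: at_within_le_nhds at_le)
  have B: "((?K \<circ> real_of_ereal) \<longlongrightarrow> 0) (at_left \<infinity>)"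
    unfolding ereal_tendsto_simps
  proof (rule Lim_transform_eventually)
    show "((\<lambda>x. - A \<phi> (Complex x b)) \<longlongrightarrow> 0) at_top"
      using tendsto_minus[OF A_tendsto_0[OF bern, of b]] by simp
    show "\<forall>\<^sub>F x in at_top. - A \<phi> (Complex x b) = ?K x"
      using eventually_gt_at_top[of 0] by eventually_elim (use K in simp)
  qed
  have cont: "isCont ?h x" if "0 < x" for x
    by (intro continuous_diff DERIV_isCont[OF bernstein_log_line_derivs(1)[OF bern]]) (use that in auto)
  have nn: "0 \<le> ?h x" if "0 < x" for x
    using g[OF that] ln_modulus_ratio_nonneg[OF that, of b] by (simp only:)
  have i: "set_integrable lborel (einterval (ereal a) \<infinity>) ?h"
    "(LBINT x=ereal a..\<infinity>. ?h x) = 0 - ?K a"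
  proof -
    have pos: "0 < x" if "ereal a < ereal x" for x using that a by simp
    have AE: "AE x in lborel. ereal a < ereal x \<longrightarrow> ereal x < \<infinity> \<longrightarrow> 0 \<le> ?h x"
      by (intro AE_I2 impI nn pos)
    note FTC = interval_integral_FTC_nonneg[OF _ dK[OF pos] cont[OF pos] AE A B]
    show "set_integrable lborel (einterval (ereal a) \<infinity>) ?h" by (rule FTC(1)) auto
    show "(LBINT x=ereal a..\<infinity>. ?h x) = 0 - ?K a" by (rule FTC(2)) auto
  qed
  have "set_integrable lborel {a<..} ?h" using i(1) by simp
  thus "set_integrable lborel {a<..} ?g"
    by (rule set_integrable_cong[THEN iffD1, rotated -1]) (use a g in auto)
  have "(LBINT x:{a<..}. ?g x) = (LBINT x:{a<..}. ?h x)"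
    by (rule set_lebesgue_integral_cong) (use a g in auto)
  also have "\<dots> = A \<phi> (Complex a b)"
    using i(2) K[OF a] by (simp add: interval_integral_to_infinity_eq)
  finally show "A \<phi> (Complex a b) = (LBINT x:{a<..}. ?g x)" by simp
qed

lemma A_even:
  assumes "0 < a"
  shows "A \<phi> (Complex a \<bar>b\<bar>) = A \<phi> (Complex a b)"
proof (cases "0 \<le> b")
  case False
  have "norm (\<phi> (Complex x \<bar>b\<bar>)) = norm (\<phi> (Complex x b))" if "0 < x" for x
  proof -
    have "Complex x \<bar>b\<bar> = cnj (Complex x b)" using False by (simp add: complex_eq_iff)
    thus ?thesis using bernstein_cnj[OF bern, of "Complex x b"] that by simp
  qed
  thus ?thesis unfolding A_eq_modulus_integral(2)[OF assms]
    by (intro set_lebesgue_integral_cong) (use assms in auto)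
qed simp

lemma A_nn_integral:
  assumes a: "0 < a"
  shows "(\<integral>\<^sup>+x. ennreal (indicator {a<..} x * ln (norm (\<phi> (Complex x b)) / on_reals \<phi> x)) \<partial>lborel)
           = ennreal (A \<phi> (Complex a b))"
proof -
  have "integrable lborel (\<lambda>x. indicator {a<..} x * ln (norm (\<phi> (Complex x b)) / on_reals \<phi> x))"
    using A_eq_modulus_integral(1)[OF a, of b] by (simp add: set_integrable_def)
  moreover have "0 \<le> indicator {a<..} x * ln (norm (\<phi> (Complex x b)) / on_reals \<phi> x)" for x
    using ln_modulus_ratio_nonneg[of x b] a by (simp add: indicator_def)
  ultimately show ?thesis
    unfolding A_eq_modulus_integral(2)[OF a] set_lebesgue_integral_def real_scaleR_def
    by (intro nn_integral_eq_integral) auto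
qed

lemma A_nonneg: "0 < a \<Longrightarrow> 0 \<le> A \<phi> (Complex a b)"
  unfolding A_eq_modulus_integral(2) set_lebesgue_integral_def
  by (rule integral_nonneg_AE) (use ln_modulus_ratio_nonneg[of _ b] in \<open>auto simp: indicator_def\<close>)

end

section \<open>Exponential decay\<close>

text \<open>The limiting integrand for \<open>\<phi>(z) = z\<close>, with primitive \<open>s ln (1 + 1 / s\<^sup>2) / 2 + arctan s\<close>.\<close>

lemma integral_ln_modulus:
  "set_integrable lborel {0<..} (\<lambda>s::real. ln (1 + 1 / s\<^sup>2) / 2)"
  "(LBINT s:{0<..}. ln (1 + 1 / s\<^sup>2) / 2) = pi / 2"
proof -
  let ?F = "\<lambda>s::real. s * (ln (1 + 1 / s\<^sup>2) / 2) + arctan s"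
  have A: "((?F \<circ> real_of_ereal) \<longlongrightarrow> 0) (at_right (ereal 0))"
    unfolding ereal_tendsto_simps by real_asymp
  have B: "((?F \<circ> real_of_ereal) \<longlongrightarrow> pi / 2) (at_left \<infinity>)"
    unfolding ereal_tendsto_simps by real_asymp
  have D: "(?F has_real_derivative ln (1 + 1 / s\<^sup>2) / 2) (at s)" if "0 < s" for s
  proof -
    have pos: "0 < 1 + 1 / s\<^sup>2" using that by (intro add_pos_pos) auto
    have "((\<lambda>s. 1 + 1 / s\<^sup>2) has_real_derivative - 2 / s ^ 3) (at s)"
      using that by (auto intro!: derivative_eq_intros simp: power2_eq_square power3_eq_cube field_simps)
    hence "((\<lambda>s. ln (1 + 1 / s\<^sup>2)) has_real_derivative (1 / (1 + 1 / s\<^sup>2)) * (- 2 / s ^ 3)) (at s)"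
      by (intro DERIV_chain2[where f = ln] DERIV_ln_divide pos)
    moreover have "(1 / (1 + 1 / s\<^sup>2)) * (- 2 / s ^ 3) = - 2 / (s * (1 + s\<^sup>2))"
      using that by (simp add: divide_simps power2_eq_square power3_eq_cube)
    ultimately have d: "((\<lambda>s. ln (1 + 1 / s\<^sup>2)) has_real_derivative - 2 / (s * (1 + s\<^sup>2))) (at s)" by simp
    have "(?F has_real_derivative (1 * (ln (1 + 1 / s\<^sup>2) / 2) + (- 2 / (s * (1 + s\<^sup>2)) / 2) * s) + inverse (1 + s\<^sup>2)) (at s)"
      by (intro DERIV_add DERIV_mult DERIV_ident DERIV_cdivide d DERIV_arctan)
    moreover have "(- 2 / (s * (1 + s\<^sup>2)) / 2) * s = - inverse (1 + s\<^sup>2)"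
    proof -
      have "(- 2 / (s * c) / 2) * s = - inverse c" if "0 < c" for c
        using that \<open>0 < s\<close> by (simp add: field_simps)
      thus ?thesis by (simp add: add_pos_nonneg)
    qed
    ultimately show ?thesis by simp
  qed
  have pos: "0 < 1 + 1 / s\<^sup>2" if "0 < s" for s :: real using that by (intro add_pos_pos) auto
  have i: "set_integrable lborel (einterval (ereal 0) \<infinity>) (\<lambda>s::real. ln (1 + 1 / s\<^sup>2) / 2)"
    "(LBINT s=ereal 0..\<infinity>. ln (1 + 1 / s\<^sup>2) / 2) = pi / 2 - 0"
  proof -
    have c: "isCont (\<lambda>s::real. ln (1 + 1 / s\<^sup>2) / 2) s" if "0 < s" for s
      using that pos[of s] by (intro continuous_intros) auto
    have gt: "0 < s" if "ereal 0 < ereal s" for s using that by simp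
    have AE: "AE s in lborel. ereal 0 < ereal s \<longrightarrow> ereal s < \<infinity> \<longrightarrow> 0 \<le> ln (1 + 1 / s\<^sup>2) / 2"
      by (intro AE_I2) simp
    note FTC = interval_integral_FTC_nonneg[OF _ D[OF gt] c[OF gt] AE A B]
    show "set_integrable lborel (einterval (ereal 0) \<infinity>) (\<lambda>s::real. ln (1 + 1 / s\<^sup>2) / 2)"
      by (rule FTC(1)) auto
    show "(LBINT s=ereal 0..\<infinity>. ln (1 + 1 / s\<^sup>2) / 2) = pi / 2 - 0" by (rule FTC(2)) auto
  qed
  thus "set_integrable lborel {0<..} (\<lambda>s::real. ln (1 + 1 / s\<^sup>2) / 2)"
    "(LBINT s:{0<..}. ln (1 + 1 / s\<^sup>2) / 2) = pi / 2"
    by (auto simp: interval_integral_to_infinity_eq)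
qed

text \<open>Substituting \<open>x = b s\<close> in the modulus integral gives
  \<open>A(a + i b) / b = \<integral> ln (\<bar>\<phi>(b (s + i))\<bar> / \<phi>(b s)) ds\<close> over \<open>s > a / b\<close>. By Fatou's lemma the
  lower limit is at least the integral of the limiting integrand, which is \<open>\<pi> \<alpha> / 2\<close>. Only pointwise convergence at
  interior points of the half-plane enters.\<close>

lemma A_lower_growth:
  assumes bern: "\<phi> \<in> bernstein_functions" and a: "0 < a" and \<alpha>: "0 \<le> \<alpha>" and \<epsilon>: "0 < \<epsilon>"
    and lim: "\<And>s. 0 < s \<Longrightarrow>
      ((\<lambda>t. norm (\<phi> (Complex (t * s) t)) / on_reals \<phi> (t * s)) \<longlongrightarrow> sqrt (1 + 1 / s\<^sup>2) powr \<alpha>) at_top"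
  shows "\<forall>\<^sub>F b in at_top. (pi / 2 * \<alpha> - \<epsilon>) * b \<le> A \<phi> (Complex a b)"
proof (rule ccontr)
  assume "\<not> ?thesis"
  hence "\<exists>b\<ge>real n + 1. A \<phi> (Complex a b) < (pi / 2 * \<alpha> - \<epsilon>) * b" for n
    unfolding eventually_at_top_linorder by (auto simp: not_le)
  then obtain B where B: "\<And>n. real n + 1 \<le> B n" "\<And>n. A \<phi> (Complex a (B n)) < (pi / 2 * \<alpha> - \<epsilon>) * B n"
    by metis
  have B0: "0 < B n" for n using B(1)[of n] by linarith
  have B_top: "filterlim B at_top sequentially"
    by (rule filterlim_at_top_mono[OF filterlim_real_sequentially])
       (use B(1) in \<open>auto intro!: always_eventually order.trans[OF _ B(1)]\<close>)
  let ?g = "\<lambda>x b. ln (norm (\<phi> (Complex x b)) / on_reals \<phi> x)"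
  let ?u = "\<lambda>n s. ennreal (indicator {a<..} (B n * s) * ?g (B n * s) (B n))"
  have meas: "(\<lambda>x. indicator {a<..} x * ?g x b) \<in> borel_measurable borel" for b
    using A_eq_modulus_integral(1)[OF bern a, of b] by (auto simp: set_integrable_def dest: borel_measurable_integrable)
  have int_u: "(\<integral>\<^sup>+s. ?u n s \<partial>lborel) = ennreal (A \<phi> (Complex a (B n)) / B n)" for n
  proof -
    have "ennreal (A \<phi> (Complex a (B n))) = (\<integral>\<^sup>+x. ennreal (indicator {a<..} x * ?g x (B n)) \<partial>lborel)"
      by (rule A_nn_integral[OF bern a, symmetric])
    also have "\<dots> = ennreal \<bar>B n\<bar> * (\<integral>\<^sup>+s. ?u n s \<partial>lborel)"
      using meas[of "B n"] B0[of n] by (subst nn_integral_real_affine[where c = "B n" and t = 0]) auto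
    finally have "ennreal (1 / B n) * ennreal (A \<phi> (Complex a (B n))) =
         ennreal (1 / B n) * (ennreal (B n) * (\<integral>\<^sup>+s. ?u n s \<partial>lborel))"
      using B0[of n] by simp
    also have "\<dots> = (\<integral>\<^sup>+s. ?u n s \<partial>lborel)"
      using B0[of n] by (simp add: mult.assoc[symmetric] ennreal_mult'[symmetric])
    finally show ?thesis using A_nonneg[OF bern a] B0[of n] by (simp add: ennreal_mult'[symmetric])
  qed
  have "ennreal (pi / 2 * \<alpha>) = (\<integral>\<^sup>+s. ennreal (indicator {0<..} s * (\<alpha> * (ln (1 + 1 / s\<^sup>2) / 2))) \<partial>lborel)"
  proof -
    have "integrable lborel (\<lambda>s. \<alpha> * (indicator {0<..} s * (ln (1 + 1 / s\<^sup>2) / 2)))"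
      using integral_ln_modulus(1) unfolding set_integrable_def real_scaleR_def
      by (rule integrable_mult_right)
    hence "(\<integral>\<^sup>+s. ennreal (\<alpha> * (indicator {0<..} s * (ln (1 + 1 / s\<^sup>2) / 2))) \<partial>lborel) =
        ennreal (LBINT s. \<alpha> * (indicator {0<..} s * (ln (1 + 1 / s\<^sup>2) / 2)))"
      using \<alpha> by (intro nn_integral_eq_integral) (auto intro!: AE_I2 simp: indicator_def)
    also have "(LBINT s. \<alpha> * (indicator {0<..} s * (ln (1 + 1 / s\<^sup>2) / 2))) = pi / 2 * \<alpha>"
      using integral_ln_modulus(2) by (simp add: set_lebesgue_integral_def)
    finally show ?thesis by (simp add: mult_ac)
  qed
  also have "\<dots> \<le> (\<integral>\<^sup>+s. liminf (\<lambda>n. ?u n s) \<partial>lborel)"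
  proof (rule nn_integral_mono)
    fix s :: real
    show "ennreal (indicator {0<..} s * (\<alpha> * (ln (1 + 1 / s\<^sup>2) / 2))) \<le> liminf (\<lambda>n. ?u n s)"
    proof (cases "0 < s")
      case True
      have pos: "0 < 1 + 1 / s\<^sup>2" using True by (intro add_pos_pos) auto
      have "(\<lambda>n. norm (\<phi> (Complex (B n * s) (B n))) / on_reals \<phi> (B n * s)) \<longlonglongrightarrow> sqrt (1 + 1 / s\<^sup>2) powr \<alpha>"
        by (rule filterlim_compose[OF lim[OF True] B_top])
      hence "(\<lambda>n. ?g (B n * s) (B n)) \<longlonglongrightarrow> ln (sqrt (1 + 1 / s\<^sup>2) powr \<alpha>)"
        using pos by (intro tendsto_ln) auto
      also have "ln (sqrt (1 + 1 / s\<^sup>2) powr \<alpha>) = \<alpha> * (ln (1 + 1 / s\<^sup>2) / 2)"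
        using pos by (simp add: ln_powr ln_sqrt)
      finally have l: "(\<lambda>n. ?g (B n * s) (B n)) \<longlonglongrightarrow> \<alpha> * (ln (1 + 1 / s\<^sup>2) / 2)" .
      have "\<forall>\<^sub>F n in sequentially. a / s < B n"
        using B_top by (auto simp: filterlim_at_top_dense)
      hence "\<forall>\<^sub>F n in sequentially. ?g (B n * s) (B n) = indicator {a<..} (B n * s) * ?g (B n * s) (B n)"
        by eventually_elim (use True in \<open>auto simp: field_simps\<close>)
      from tendsto_ennrealI[OF Lim_transform_eventually[OF l this]]
      have "liminf (\<lambda>n. ?u n s) = ennreal (\<alpha> * (ln (1 + 1 / s\<^sup>2) / 2))"
        by (rule lim_imp_Liminf[rotated]) simp
      thus ?thesis using True by simp
    qed simp
  qed
  also have "\<dots> \<le> liminf (\<lambda>n. \<integral>\<^sup>+s. ?u n s \<partial>lborel)"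
  proof (rule nn_integral_liminf)
    fix n
    have "(\<lambda>x. indicator {a<..} x * ?g x (B n)) \<circ> (\<lambda>s. B n * s) \<in> borel_measurable borel"
      by (rule measurable_comp[OF _ meas]) simp
    thus "?u n \<in> borel_measurable lborel" by (simp add: o_def)
  qed
  also have "\<dots> \<le> liminf (\<lambda>n. ennreal (pi / 2 * \<alpha> - \<epsilon>))"
    unfolding int_u
    by (intro Liminf_mono always_eventually allI ennreal_leI)
       (use B(2) B0 in \<open>simp add: pos_divide_le_eq less_imp_le\<close>)
  also have "\<dots> = ennreal (pi / 2 * \<alpha> - \<epsilon>)" by (simp add: Liminf_const)
  finally have le: "ennreal (pi / 2 * \<alpha>) \<le> ennreal (pi / 2 * \<alpha> - \<epsilon>)" .
  have "0 \<le> pi / 2 * \<alpha> - \<epsilon>"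
  proof -
    have "0 \<le> A \<phi> (Complex a (B 0))" by (rule A_nonneg[OF bern a])
    hence "0 < (pi / 2 * \<alpha> - \<epsilon>) * B 0" using B(2)[of 0] by linarith
    thus ?thesis using B0[of 0] by (simp add: zero_less_mult_iff)
  qed
  thus False using le \<epsilon> by (simp add: ennreal_le_iff)
qed

section \<open>Left of the imaginary axis\<close>

lemma lk_integral_holomorphic:
  assumes "exp_moment \<mu> c" "c \<le> 0"
  shows "lk_integral q d \<mu> holomorphic_on {z. c < Re z}"
proof -
  have "lk_integral q d \<mu> field_differentiable at z" if "c < Re z" for z
    unfolding field_differentiable_def
    by (rule exI, rule lk_integral_has_derivative[OF assms that])
  thus ?thesis
    by (intro holomorphic_onI) (simp add: field_differentiable_at_within)
qed

lemma holomorphic_extension_eq: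
  assumes lk: "levy_khintchine \<phi> q d \<mu>" and f: "holomorphic_extension \<phi> u f"
    and u: "u < c" "c < 0"
  shows "exp_moment \<mu> c" "\<And>z. c < Re z \<Longrightarrow> f z = lk_integral q d \<mu> z"
proof -
  have hol: "f holomorphic_on {z. u < Re z}" and eq: "\<And>z. 0 \<le> Re z \<Longrightarrow> f z = lk_integral q d \<mu> z"
    using f levy_khintchine_eq[OF lk] by (auto simp: holomorphic_extension_def)
  show mom: "exp_moment \<mu> c"
    by (rule exp_moment_extend[OF levy_khintchine_exp_moment[OF lk] u hol]) (use eq in auto)
  show "f z = lk_integral q d \<mu> z" if "c < Re z" for z
  proof (rule analytic_continuation_open[where s = right_half_plane and s' = "{z. c < Re z}"
        and f = f and g = "lk_integral q d \<mu>" and z = z])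
    show "open {z. c < Re z}" by (rule open_halfspace_Re_gt)
    show "connected {z. c < Re z}" by (intro convex_connected convex_halfspace_Re_gt)
    show "right_half_plane \<noteq> {}" by (auto intro: exI[of _ 1])
    show "f holomorphic_on {z. c < Re z}" by (rule holomorphic_on_subset[OF hol]) (use u in auto)
    show "lk_integral q d \<mu> holomorphic_on {z. c < Re z}"
      by (rule lk_integral_holomorphic[OF mom]) (use u in simp)
  qed (use that u eq open_right_half_plane in auto)
qed

text \<open>By the Landau-Pringsheim principle any holomorphic extension is the Levy-Khintchine integral itself, so
  the description in \<open>bernstein_ext\<close> denotes it.\<close>

lemma bernstein_ext_eq:
  assumes lk: "levy_khintchine \<phi> q d \<mu>" and c: "a_index \<phi> < ereal c" "c < 0"
  shows "exp_moment \<mu> c" "\<And>z. c < Re z \<Longrightarrow> bernstein_ext \<phi> z = lk_integral q d \<mu> z"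
proof -
  define S where "S = {u. u < 0 \<and> (\<exists>f. holomorphic_extension \<phi> u f)}"
  have "a_index \<phi> = (if S = {} then 0 else Inf (ereal ` S))" unfolding a_index_def Let_def S_def ..
  hence "Inf (ereal ` S) < ereal c" using c by (auto split: if_splits)
  then obtain u f where u: "u < c" "holomorphic_extension \<phi> u f"
    by (auto simp: Inf_less_iff S_def)
  show mom: "exp_moment \<mu> c" by (rule holomorphic_extension_eq(1)[OF lk u(2,1) c(2)])
  show "bernstein_ext \<phi> z = lk_integral q d \<mu> z" if z: "c < Re z" for z
  proof (cases "0 \<le> Re z")
    case True
    thus ?thesis using levy_khintchine_eq[OF lk] by (simp add: bernstein_ext_def)
  next
    case False
    have "(THE w. \<exists>u f. u < Re z \<and> holomorphic_extension \<phi> u f \<and> w = f z) = lk_integral q d \<mu> z"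
    proof (rule the_equality)
      show "\<exists>u f. u < Re z \<and> holomorphic_extension \<phi> u f \<and> lk_integral q d \<mu> z = f z"
        using u z holomorphic_extension_eq(2)[OF lk u(2,1) c(2)] by (intro exI[of _ u] exI[of _ f]) auto
      fix w assume "\<exists>u f. u < Re z \<and> holomorphic_extension \<phi> u f \<and> w = f z"
      then obtain v g where v: "v < Re z" "holomorphic_extension \<phi> v g" "w = g z" by auto
      have "g z = lk_integral q d \<mu> z"
        by (rule holomorphic_extension_eq(2)[OF lk v(2), of "(v + Re z) / 2"]) (use v False in auto)
      thus "w = lk_integral q d \<mu> z" using v by simp
    qed
    thus ?thesis using False by (simp add: bernstein_ext_def)
  qed
qed

text \<open>For \<open>a \<le> 0\<close> a nonpositive value at \<open>a\<close> would produce, by the intermediate value theorem, a zero \<open>x\<close> with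
  \<open>a \<le> x \<le> 0\<close>, and then \<open>u_index \<phi> \<ge> x \<ge> a\<close>.\<close>

lemma abar_index_continuation:
  assumes bern: "\<phi> \<in> bernstein_functions" and lk: "levy_khintchine \<phi> q d \<mu>"
    and a: "abar_index \<phi> < ereal a"
  obtains c where "c \<le> 0" "c < a" "exp_moment \<mu> c" "0 < lk_real q d \<mu> a"
    "\<And>z. a \<le> Re z \<Longrightarrow> bernstein_ext \<phi> z = lk_integral q d \<mu> z"
proof (cases "0 < a")
  case True
  show ?thesis
  proof (rule that[of 0])
    show "0 < lk_real q d \<mu> a"
      using bernstein_pos[OF bern True] levy_khintchine_on_reals[OF lk, of a] True by simp
    show "bernstein_ext \<phi> z = lk_integral q d \<mu> z" if "a \<le> Re z" for z
      using that True levy_khintchine_eq[OF lk, of z] by (simp add: bernstein_ext_def)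
  qed (use True levy_khintchine_exp_moment[OF lk] in auto)
next
  case False
  have idx: "a_index \<phi> < ereal a" "u_index \<phi> < ereal a" using a by (auto simp: abar_index_def)
  then obtain c where c: "a_index \<phi> < ereal c" "c < a"
    using ereal_dense2[of "a_index \<phi>" "ereal a"] by auto
  have c0: "c < 0" using c False by simp
  note mom = bernstein_ext_eq(1)[OF lk c(1) c0] and ext = bernstein_ext_eq(2)[OF lk c(1) c0]
  have cont: "isCont (lk_integral q d \<mu>) z" if "c < Re z" for z
    using lk_integral_has_derivative[OF mom _ that] c0 by (auto intro: DERIV_isCont)
  have tend: "((\<lambda>v. lk_integral q d \<mu> (of_real v)) \<longlongrightarrow> lk_integral q d \<mu> (of_real x)) (at x within S)"
    if "c < x" for x S
    by (rule isCont_tendsto_compose[OF cont]) (use that in \<open>auto intro!: tendsto_intros\<close>)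
  have contr: "continuous_on {a..1} (lk_real q d \<mu>)"
    unfolding continuous_on_def
  proof
    fix x assume "x \<in> {a..1}"
    hence "((\<lambda>v. Re (lk_integral q d \<mu> (of_real v))) \<longlongrightarrow> Re (lk_integral q d \<mu> (of_real x))) (at x within {a..1})"
      using c by (intro tendsto_Re tend) auto
    thus "(lk_real q d \<mu> \<longlongrightarrow> lk_real q d \<mu> x) (at x within {a..1})" by (simp add: lk_integral_of_real)
  qed
  have pos: "0 < lk_real q d \<mu> x" if "0 < x" for x
    using bernstein_pos[OF bern that] levy_khintchine_on_reals[OF lk, of x] that by simp
  have "0 < lk_real q d \<mu> a"
  proof (rule ccontr)
    assume "\<not> ?thesis"
    then obtain x where x: "a \<le> x" "x \<le> 1" "lk_real q d \<mu> x = 0"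
      using IVT'[of "lk_real q d \<mu>" a 0 1] contr pos[of 1] False by (auto simp: not_less)
    have "x \<le> 0" using pos[of x] x by force
    have "((\<lambda>v. bernstein_ext \<phi> (of_real v)) \<longlongrightarrow> 0) (at_right x)"
    proof (rule Lim_transform_eventually)
      show "((\<lambda>v. lk_integral q d \<mu> (of_real v)) \<longlongrightarrow> 0) (at_right x)"
        using tend[of x "{x<..}"] x c by (simp add: lk_integral_of_real)
      show "\<forall>\<^sub>F v in at_right x. lk_integral q d \<mu> (of_real v) = bernstein_ext \<phi> (of_real v)"
        using eventually_at_right_less[of x] by eventually_elim (use ext x c in auto)
    qed
    moreover have "a_index \<phi> \<le> ereal x"
      using idx(1) x(1) by (metis ereal_less_eq(3) less_imp_le order.trans)
    ultimately have "ereal x \<le> u_index \<phi>"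
      unfolding u_index_def using \<open>x \<le> 0\<close> by (intro Sup_upper imageI) auto
    hence "ereal x < ereal a" using idx(2) by (rule order.strict_trans1)
    thus False using x by simp
  qed
  thus ?thesis using c c0 mom ext by (intro that[of c]) auto
qed

lemma W_shift:
  assumes bern: "\<phi> \<in> bernstein_functions"
  obtains n where "0 < a + real n"
    "\<And>b. W \<phi> (Complex a b) = W \<phi> (Complex (a + real n) b) / (\<Prod>j<n. bernstein_ext \<phi> (Complex (a + real j) b))"
proof -
  define n where "n = (LEAST n::nat. 0 < a + real n)"
  have "\<exists>n::nat. 0 < a + real n"
  proof -
    obtain n :: nat where "- a < real n" using reals_Archimedean2 by blast
    hence "0 < a + real n" by linarith
    thus ?thesis ..
  qed
  hence n: "0 < a + real n" unfolding n_def by (rule LeastI_ex)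
  have C: "Complex a b + of_nat j = Complex (a + real j) b" for j b by (simp add: complex_eq_iff)
  have "W \<phi> (Complex a b) = W \<phi> (Complex (a + real n) b) / (\<Prod>j<n. bernstein_ext \<phi> (Complex (a + real j) b))" for b
    using W_eq_W_right[OF bern, of "Complex (a + real n) b"] n
    by (simp add: W_def[of \<phi> "Complex a b"] Let_def C flip: n_def)
  thus ?thesis using n that by blast
qed

lemma bernstein_ext_norm_ge:
  assumes bern: "\<phi> \<in> bernstein_functions" and a: "abar_index \<phi> < ereal a"
  obtains \<kappa> where "0 < \<kappa>" "\<And>z. a \<le> Re z \<Longrightarrow> \<kappa> \<le> norm (bernstein_ext \<phi> z)"
proof -
  obtain q d \<mu> where lk: "levy_khintchine \<phi> q d \<mu>" by (rule bernstein_lk[OF bern])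
  obtain c where c: "c \<le> 0" "c < a" "exp_moment \<mu> c" "0 < lk_real q d \<mu> a"
    "\<And>z. a \<le> Re z \<Longrightarrow> bernstein_ext \<phi> z = lk_integral q d \<mu> z"
    using abar_index_continuation[OF bern lk a] by metis
  have "lk_real q d \<mu> a \<le> norm (bernstein_ext \<phi> z)" if "a \<le> Re z" for z
  proof -
    have "lk_real q d \<mu> a \<le> lk_real q d \<mu> (Re z)"
      by (rule lk_real_mono[OF c(3,1)]) (use c that lk in \<open>auto simp: levy_khintchine_def\<close>)
    also have "\<dots> \<le> Re (lk_integral q d \<mu> z)"
      by (rule Re_lk_integral_ge[OF c(3,1)]) (use c that in auto)
    also have "\<dots> \<le> norm (lk_integral q d \<mu> z)" by (rule complex_Re_le_cmod)
    finally show ?thesis using c(5)[OF that] by simp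
  qed
  thus ?thesis using c(4) that by blast
qed

text \<open>The factors in the recurrence have modulus at least \<open>\<kappa>\<close>, uniformly in the imaginary part, so upper bounds pass
  from the right half-plane to all abscissae to the right of \<open>abar_index \<phi>\<close>.\<close>

lemma norm_W_shift_upper:
  assumes bern: "\<phi> \<in> bernstein_functions" and a: "abar_index \<phi> < ereal a"
  obtains a' K where "0 < a'" "0 < K"
    "\<And>b. norm (W \<phi> (Complex a b)) \<le> K * norm (W \<phi> (Complex a' b))"
    "\<And>b. W \<phi> (Complex a b) \<noteq> 0"
proof -
  obtain n where n: "0 < a + real n"
    "\<And>b. W \<phi> (Complex a b) = W \<phi> (Complex (a + real n) b) / (\<Prod>j<n. bernstein_ext \<phi> (Complex (a + real j) b))"
    using W_shift[OF bern, of a] by metis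
  obtain \<kappa> where \<kappa>: "0 < \<kappa>" "\<And>z. a \<le> Re z \<Longrightarrow> \<kappa> \<le> norm (bernstein_ext \<phi> z)"
    using bernstein_ext_norm_ge[OF bern a] by metis
  have prod: "\<kappa> ^ n \<le> norm (\<Prod>j<n. bernstein_ext \<phi> (Complex (a + real j) b))" for b
  proof -
    have "(\<Prod>j<n. \<kappa>) \<le> (\<Prod>j<n. norm (bernstein_ext \<phi> (Complex (a + real j) b)))"
      by (intro prod_mono) (use \<kappa> in auto)
    thus ?thesis by (simp add: prod_norm)
  qed
  have prod_pos: "0 < norm (\<Prod>j<n. bernstein_ext \<phi> (Complex (a + real j) b))" for b
    by (rule order.strict_trans2[OF zero_less_power[OF \<kappa>(1)] prod])
  show ?thesis
  proof (rule that[of "a + real n" "1 / \<kappa> ^ n"])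
    fix b
    have "norm (W \<phi> (Complex a b)) = norm (W \<phi> (Complex (a + real n) b)) / norm (\<Prod>j<n. bernstein_ext \<phi> (Complex (a + real j) b))"
      by (simp add: n(2) norm_divide)
    also have "\<dots> \<le> norm (W \<phi> (Complex (a + real n) b)) / \<kappa> ^ n"
      by (intro divide_left_mono mult_pos_pos prod prod_pos zero_less_power \<kappa>(1)) simp_all
    finally show "norm (W \<phi> (Complex a b)) \<le> 1 / \<kappa> ^ n * norm (W \<phi> (Complex (a + real n) b))" by simp
    show "W \<phi> (Complex a b) \<noteq> 0"
      using prod_pos[of b] W_limit(1)[OF bern, of "Complex (a + real n) b"] n(1) unfolding n(2)[of b] by simp
  qed (use n \<kappa> in auto)
qed

lemma norm_W_shift_lower:
  assumes bern: "\<phi> \<in> bernstein_functions" and a: "abar_index \<phi> < ereal a"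
    and K: "0 < K" "\<And>z. a \<le> Re z \<Longrightarrow> norm (bernstein_ext \<phi> z) \<le> K"
  obtains a' K' where "0 < a'" "0 < K'"
    "\<And>b. norm (W \<phi> (Complex a' b)) \<le> K' * norm (W \<phi> (Complex a b))"
proof -
  obtain n where n: "0 < a + real n"
    "\<And>b. W \<phi> (Complex a b) = W \<phi> (Complex (a + real n) b) / (\<Prod>j<n. bernstein_ext \<phi> (Complex (a + real j) b))"
    using W_shift[OF bern, of a] by metis
  have prod: "norm (\<Prod>j<n. bernstein_ext \<phi> (Complex (a + real j) b)) \<le> K ^ n" for b
  proof -
    have "(\<Prod>j<n. norm (bernstein_ext \<phi> (Complex (a + real j) b))) \<le> (\<Prod>j<n. K)"
      by (intro prod_mono) (use K in auto)
    thus ?thesis by (simp add: prod_norm)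
  qed
  obtain \<kappa> where \<kappa>: "0 < \<kappa>" "\<And>z. a \<le> Re z \<Longrightarrow> \<kappa> \<le> norm (bernstein_ext \<phi> z)"
    using bernstein_ext_norm_ge[OF bern a] by metis
  show ?thesis
  proof (rule that[of "a + real n" "K ^ n"])
    fix b
    have nz: "(\<Prod>j<n. bernstein_ext \<phi> (Complex (a + real j) b)) \<noteq> 0"
    proof -
      have "bernstein_ext \<phi> (Complex (a + real j) b) \<noteq> 0" for j
        using \<kappa>(2)[of "Complex (a + real j) b"] \<kappa>(1) by auto
      thus ?thesis by simp
    qed
    have "W \<phi> (Complex (a + real n) b) = (\<Prod>j<n. bernstein_ext \<phi> (Complex (a + real j) b)) * W \<phi> (Complex a b)"
      using nz by (simp add: n(2))
    hence "norm (W \<phi> (Complex (a + real n) b)) = norm (\<Prod>j<n. bernstein_ext \<phi> (Complex (a + real j) b)) * norm (W \<phi> (Complex a b))"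
      by (simp add: norm_mult)
    also have "\<dots> \<le> K ^ n * norm (W \<phi> (Complex a b))"
      by (intro mult_right_mono prod) auto
    finally show "norm (W \<phi> (Complex (a + real n) b)) \<le> K ^ n * norm (W \<phi> (Complex a b))" .
  qed (use n K in auto)
qed

text \<open>In the representation of \<open>ln \<bar>W\<bar>\<close> only \<open>A\<close> and \<open>ln \<bar>\<phi>\<bar>\<close> depend on \<open>b\<close> in an unbounded way, and
  \<open>\<bar>\<phi>(a + i b)\<bar> \<ge> \<phi>(a)\<close>.\<close>

lemma norm_W_upper_by_A:
  assumes bern: "\<phi> \<in> bernstein_functions" and a: "0 < a"
  obtains K where "\<And>b. ln (norm (W \<phi> (Complex a b))) \<le> K - A \<phi> (Complex a b)"
proof (rule that)
  fix b
  have "ln (on_reals \<phi> a) \<le> ln (norm (\<phi> (Complex a b)))"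
    using bernstein_norm_ge[OF bern, of "Complex a b"] bernstein_pos[OF bern a] a by (intro ln_mono) auto
  thus "ln (norm (W \<phi> (Complex a b))) \<le> ((log_on_reals \<phi> 1 - log_on_reals \<phi> a - log_on_reals \<phi> (1 + a) - ln (on_reals \<phi> a)) / 2
             + G \<phi> a + 4 / a + 4) - A \<phi> (Complex a b)"
    using ln_norm_W[OF bern, of "Complex a b"] E_bound[OF bern, of "Complex a b"] R_bound[OF bern a] a
    unfolding abs_le_iff complex.sel by argo
qed

theorem exp_class_criterion:
  assumes bern: "\<phi> \<in> bernstein_functions" and \<alpha>: "0 \<le> \<alpha>"
    and lim: "\<And>s. 0 < s \<Longrightarrow>
      ((\<lambda>t. norm (\<phi> (Complex (t * s) t)) / on_reals \<phi> (t * s)) \<longlongrightarrow> sqrt (1 + 1 / s\<^sup>2) powr \<alpha>) at_top"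
  shows "\<phi> \<in> exp_class (pi / 2 * \<alpha>)"
proof -
  have "Limsup at_infinity (\<lambda>b. ereal (ln (cmod (W \<phi> (Complex a b))) / \<bar>b\<bar>)) \<le> ereal (- (pi / 2 * \<alpha>))"
    if a: "abar_index \<phi> < ereal a" for a
  proof (rule ereal_le_epsilon2)
    fix \<epsilon> :: real assume \<epsilon>: "0 < \<epsilon>"
    obtain a' K where a': "0 < a'" "0 < K"
      "\<And>b. norm (W \<phi> (Complex a b)) \<le> K * norm (W \<phi> (Complex a' b))" "\<And>b. W \<phi> (Complex a b) \<noteq> 0"
      using norm_W_shift_upper[OF bern a] by metis
    obtain K' where K': "\<And>b. ln (norm (W \<phi> (Complex a' b))) \<le> K' - A \<phi> (Complex a' b)"
      using norm_W_upper_by_A[OF bern a'(1)] by metis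
    have "\<forall>\<^sub>F b in at_top. (pi / 2 * \<alpha> - \<epsilon> / 2) * b \<le> A \<phi> (Complex a' b) \<and> (ln K + K') / (\<epsilon> / 2) \<le> b \<and> 0 < b"
      using A_lower_growth[OF bern a'(1) \<alpha> _ lim, of "\<epsilon> / 2"] \<epsilon>
      by (intro eventually_conj eventually_ge_at_top eventually_gt_at_top) auto
    hence "\<forall>\<^sub>F b::real in at_infinity. (pi / 2 * \<alpha> - \<epsilon> / 2) * norm b \<le> A \<phi> (Complex a' (norm b)) \<and> (ln K + K') / (\<epsilon> / 2) \<le> norm b \<and> 0 < norm b"
      by (rule eventually_compose_filterlim[OF _ filterlim_norm_at_top])
    hence "\<forall>\<^sub>F b::real in at_infinity. ereal (ln (cmod (W \<phi> (Complex a b))) / \<bar>b\<bar>) \<le> ereal (- (pi / 2 * \<alpha>)) + ereal \<epsilon>"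
    proof eventually_elim
      case (elim b)
      have W': "W \<phi> (Complex a' b) \<noteq> 0" using W_limit(1)[OF bern, of "Complex a' b"] a'(1) by simp
      have "ln (cmod (W \<phi> (Complex a b))) \<le> ln (K * norm (W \<phi> (Complex a' b)))"
        using a' W' by (intro ln_mono) auto
      also have "\<dots> \<le> ln K + K' - A \<phi> (Complex a' b)"
        using K'[of b] a'(2) W' by (simp add: ln_mult)
      also have "A \<phi> (Complex a' b) = A \<phi> (Complex a' \<bar>b\<bar>)" using A_even[OF bern a'(1)] by simp
      also have "ln K + K' - \<dots> \<le> (\<epsilon> / 2) * \<bar>b\<bar> - (pi / 2 * \<alpha> - \<epsilon> / 2) * \<bar>b\<bar>"
        using elim \<epsilon> by (simp add: field_simps)
      also have "\<dots> = (- (pi / 2 * \<alpha>) + \<epsilon>) * \<bar>b\<bar>" by (simp add: algebra_simps)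
      finally show ?case using elim by (simp add: pos_divide_le_eq)
    qed
    thus "Limsup at_infinity (\<lambda>b. ereal (ln (cmod (W \<phi> (Complex a b))) / \<bar>b\<bar>)) \<le> ereal (- (pi / 2 * \<alpha>)) + ereal \<epsilon>"
      by (rule Limsup_bounded)
  qed
  thus ?thesis using bern by (simp add: exp_class_def)
qed

section \<open>Positive drift\<close>

lemma sqrt_modulus:
  assumes "0 < s"
  shows "norm (Complex s 1) / s = sqrt (1 + 1 / s\<^sup>2)"
proof -
  have "norm (Complex s 1) / s = sqrt ((s\<^sup>2 + 1) / s\<^sup>2)"
    using assms by (simp add: cmod_def real_sqrt_divide)
  also have "(s\<^sup>2 + 1) / s\<^sup>2 = 1 + 1 / s\<^sup>2" using assms by (simp add: field_simps)
  finally show ?thesis .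
qed

lemma bernstein_over_linear:
  assumes lk: "levy_khintchine \<phi> q d \<mu>" and w: "0 < Re w"
  shows "((\<lambda>t. \<phi> (of_real t * w) / of_real t) \<longlongrightarrow> of_real d * w) at_top"
proof -
  have mom: "exp_moment \<mu> 0" by (rule levy_khintchine_exp_moment[OF lk])
  note [measurable_cong] = mom[unfolded exp_moment_def, THEN conjunct1]
  have int: "integrable \<mu> (\<lambda>y. min 1 y)" and sets: "sets \<mu> = sets borel" and null: "emeasure \<mu> {..0} = 0"
    using mom by (auto simp: exp_moment_def)
  let ?s = "\<lambda>t y. (1 - exp (- (of_real t * w) * of_real y)) / of_real t"
  have "((\<lambda>t. LINT y|\<mu>. ?s t y) \<longlongrightarrow> (LINT y|\<mu>. 0)) at_top"
  proof (rule integral_dominated_convergence_at_top[where w = "\<lambda>y. (2 + norm w) * min 1 y"])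
    show "integrable \<mu> (\<lambda>y. (2 + norm w) * min 1 y)" using int by simp
    show "AE y in \<mu>. ((\<lambda>t. ?s t y) \<longlongrightarrow> 0) at_top"
      using AE_pos[OF sets null]
    proof eventually_elim
      case (elim y)
      show ?case
      proof (rule Lim_null_comparison)
        show "\<forall>\<^sub>F t in at_top. norm (?s t y) \<le> 2 / (t + 0)"
          using eventually_gt_at_top[of 0]
        proof eventually_elim
          case (elim t)
          have "norm (1 - exp (- (of_real t * w) * of_real y)) \<le> 1 + norm (exp (- (of_real t * w) * of_real y))"
            using norm_triangle_ineq4[of 1] by (metis norm_one)
          also have "norm (exp (- (of_real t * w) * of_real y)) \<le> 1"
            using elim w \<open>0 < y\<close> by simp
          finally show ?case using elim by (simp add: norm_divide divide_right_mono)
        qed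
      qed (rule tendsto_divide_add_at_top)
    qed
    show "\<forall>\<^sub>F t in at_top. AE y in \<mu>. norm (?s t y) \<le> (2 + norm w) * min 1 y"
      using eventually_ge_at_top[of 1]
    proof eventually_elim
      case (elim t)
      show ?case using AE_pos[OF sets null]
      proof eventually_elim
        case (elim y)
        have "norm (1 - exp (- (of_real t * w) * of_real y)) \<le> (2 + norm (of_real t * w)) * (min 1 y * exp (- 0 * y))"
          by (rule norm_1_minus_exp_le) (use elim \<open>1 \<le> t\<close> w in auto)
        also have "\<dots> \<le> (t * (2 + norm w)) * min 1 y"
          using elim \<open>1 \<le> t\<close> by (simp add: norm_mult algebra_simps mult_right_mono)
        finally show ?case using \<open>1 \<le> t\<close> by (simp add: norm_divide field_simps)
      qed
    qed
  qed measurable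
  hence "((\<lambda>t. of_real (q / (t + 0)) + of_real d * w + (LINT y|\<mu>. ?s t y)) \<longlongrightarrow> of_real 0 + of_real d * w + 0) at_top"
    by (intro tendsto_intros tendsto_divide_add_at_top) simp_all
  moreover have "\<forall>\<^sub>F t in at_top. of_real (q / (t + 0)) + of_real d * w + (LINT y|\<mu>. ?s t y) = \<phi> (of_real t * w) / of_real t"
    using eventually_gt_at_top[of 0]
  proof eventually_elim
    case (elim t)
    have "\<phi> (of_real t * w) = lk_integral q d \<mu> (of_real t * w)"
      by (rule levy_khintchine_eq[OF lk]) (use elim w in simp)
    thus ?case using elim by (simp add: lk_integral_def add_divide_distrib)
  qed
  ultimately show ?thesis by (simp add: Lim_transform_eventually)
qed

theorem exp_class_drift:
  assumes bern: "\<phi> \<in> bernstein_functions" and lk: "levy_khintchine \<phi> q d \<mu>" and d: "0 < d"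
  shows "\<phi> \<in> exp_class (pi / 2)"
proof -
  have "\<phi> \<in> exp_class (pi / 2 * 1)"
  proof (rule exp_class_criterion[OF bern])
    fix s :: real assume s: "0 < s"
    have "((\<lambda>t. norm (\<phi> (of_real t * Complex s 1) / of_real t) / norm (\<phi> (of_real t * of_real s) / of_real t))
        \<longlongrightarrow> norm (of_real d * Complex s 1) / norm (of_real d * of_real s :: complex)) at_top"
      using s d by (intro tendsto_intros bernstein_over_linear[OF lk]) auto
    also have "norm (of_real d * Complex s 1) / norm (of_real d * of_real s :: complex) = sqrt (1 + 1 / s\<^sup>2) powr 1"
      using s d sqrt_modulus[OF s] by (simp add: norm_mult add_pos_nonneg less_imp_le)
    finally show "((\<lambda>t. norm (\<phi> (Complex (t * s) t)) / on_reals \<phi> (t * s)) \<longlongrightarrow> sqrt (1 + 1 / s\<^sup>2) powr 1) at_top"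
    proof (rule Lim_transform_eventually)
      show "\<forall>\<^sub>F t in at_top. norm (\<phi> (of_real t * Complex s 1) / of_real t) / norm (\<phi> (of_real t * of_real s) / of_real t) =
         norm (\<phi> (Complex (t * s) t)) / on_reals \<phi> (t * s)"
        using eventually_gt_at_top[of 0]
      proof eventually_elim
        case (elim t)
        have "of_real t * Complex s 1 = Complex (t * s) t" by (simp add: complex_eq_iff)
        moreover have "norm (\<phi> (of_real t * of_real s)) = on_reals \<phi> (t * s)"
          using bernstein_of_real[OF bern, of "t * s"] bernstein_pos[OF bern, of "t * s"] elim s by simp
        ultimately show ?case using elim by (simp add: norm_divide)
      qed
    qed
  qed simp
  thus ?thesis by simp
qed

section \<open>Regularly varying tails\<close>

lemma levy_tail_finite:
  assumes "exp_moment \<mu> 0" "0 < t"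
  shows "emeasure \<mu> {t<..} < \<infinity>"
proof -
  note [measurable_cong] = assms(1)[unfolded exp_moment_def, THEN conjunct1]
  have int: "integrable \<mu> (\<lambda>y. min 1 y)" and sets: "sets \<mu> = sets borel" and null: "emeasure \<mu> {..0} = 0"
    using assms by (auto simp: exp_moment_def)
  have "integrable \<mu> (indicator {t<..} :: real \<Rightarrow> real)"
  proof (rule Bochner_Integration.integrable_bound[OF integrable_mult_right[OF int, of "1 / min 1 t"]])
    show "AE y in \<mu>. norm (indicator {t<..} y :: real) \<le> norm (1 / min 1 t * min 1 y)"
    proof (intro AE_I2)
      fix y
      show "norm (indicator {t<..} y :: real) \<le> norm (1 / min 1 t * min 1 y)"
        using assms(2) by (cases "t < y") (auto simp: min_def field_simps)
    qed
  qed measurable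
  thus ?thesis by (auto simp: integrable_indicator_iff sets_eq_imp_space_eq[OF sets])
qed

lemma levy_measure_sigma_finite:
  assumes "exp_moment \<mu> 0"
  shows "sigma_finite_measure \<mu>"
proof
  have sets: "sets \<mu> = sets borel" and null: "emeasure \<mu> {..0} = 0"
    using assms by (auto simp: exp_moment_def)
  let ?A = "insert {..0} (range (\<lambda>n. {1 / real (Suc n)<..}))"
  show "\<exists>A. countable A \<and> A \<subseteq> sets \<mu> \<and> \<Union> A = space \<mu> \<and> (\<forall>a\<in>A. emeasure \<mu> a \<noteq> \<infinity>)"
  proof (intro exI[of _ ?A] conjI ballI)
    show "?A \<subseteq> sets \<mu>" by (auto simp: sets)
    have "y \<in> \<Union> ?A" for y :: real
    proof (cases "0 < y")
      case True
      then obtain n where "1 / real (Suc n) < y" using nat_approx_posE by blast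
      thus ?thesis by auto
    qed auto
    thus "\<Union> ?A = space \<mu>" by (auto simp: sets_eq_imp_space_eq[OF sets])
    show "emeasure \<mu> a \<noteq> \<infinity>" if "a \<in> ?A" for a
      using that null levy_tail_finite[OF assms, of "1 / real (Suc _)"] by (auto simp: less_top[symmetric])
  qed simp
qed

lemma integral_exp_interval:
  assumes "0 < y"
  shows "(LBINT t. indicator {0<..<y} t *\<^sub>R (z * exp (- z * of_real t))) = 1 - exp (- z * complex_of_real y)"
    and "(LBINT t. indicator {0<..<y} t *\<^sub>R (x * exp (- x * t))) = 1 - exp (- x * (y::real))"
proof -
  have "(LBINT t=ereal 0..ereal y. z * exp (- z * of_real t)) = - exp (- z * of_real y) - (- exp (- z * of_real 0))"
  proof (rule interval_integral_FTC_finite)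
    show "continuous_on {min 0 y..max 0 y} (\<lambda>t. z * exp (- z * of_real t))" by (intro continuous_intros)
    fix t
    have "((\<lambda>w. - exp (- z * w)) has_field_derivative z * exp (- z * of_real t)) (at (of_real t))"
      by (auto intro!: derivative_eq_intros)
    from has_vector_derivative_real_field[OF this]
    show "((\<lambda>t. - exp (- z * of_real t)) has_vector_derivative z * exp (- z * of_real t)) (at t within {min 0 y..max 0 y})"
      by (rule has_vector_derivative_at_within)
  qed
  note E = this
  have e: "(LBINT t. indicator {0<..<y} t *\<^sub>R (z * exp (- z * of_real t))) = (LBINT t=ereal 0..ereal y. z * exp (- z * of_real t))"
    using assms by (subst interval_lebesgue_integral_le_eq) (auto simp only: ereal_less_eq less_imp_le set_lebesgue_integral_def einterval_eq)
  show "(LBINT t. indicator {0<..<y} t *\<^sub>R (z * exp (- z * of_real t))) = 1 - exp (- z * of_real y)"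
    unfolding e E by simp
  have "(LBINT t=ereal 0..ereal y. x * exp (- x * t)) = - exp (- x * y) - (- exp (- x * 0))"
  proof (rule interval_integral_FTC_finite)
    show "continuous_on {min 0 y..max 0 y} (\<lambda>t. x * exp (- x * t))" by (intro continuous_intros)
    fix t
    have "((\<lambda>w. - exp (- x * w)) has_field_derivative x * exp (- x * t)) (at t within {min 0 y..max 0 y})"
      by (auto intro!: derivative_eq_intros)
    thus "((\<lambda>t. - exp (- x * t)) has_vector_derivative x * exp (- x * t)) (at t within {min 0 y..max 0 y})"
      by (simp add: has_real_derivative_iff_has_vector_derivative)
  qed
  note E = this
  have e: "(LBINT t. indicator {0<..<y} t *\<^sub>R (x * exp (- x * t))) = (LBINT t=ereal 0..ereal y. x * exp (- x * t))"
    using assms by (subst interval_lebesgue_integral_le_eq) (auto simp only: ereal_less_eq less_imp_le set_lebesgue_integral_def einterval_eq)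
  show "(LBINT t. indicator {0<..<y} t *\<^sub>R (x * exp (- x * t))) = 1 - exp (- x * y)"
    unfolding e E by simp
qed

text \<open>Fubini applied to \<open>1 - exp (- z y) = \<integral> z exp (- z t) dt\<close> over \<open>0 < t < y\<close>.\<close>

lemma lk_integral_tail:
  assumes mom: "exp_moment \<mu> 0" and z: "0 < Re z"
  shows "(LINT y|\<mu>. 1 - exp (- z * of_real y)) =
           z * (LBINT t. (indicator {0<..} t * measure \<mu> {t<..}) *\<^sub>R exp (- z * of_real t))"
proof -
  note [measurable_cong] = mom[unfolded exp_moment_def, THEN conjunct1]
  have sets: "sets \<mu> = sets borel" and null: "emeasure \<mu> {..0} = 0"
    using mom by (auto simp: exp_moment_def)
  interpret M: sigma_finite_measure \<mu> by (rule levy_measure_sigma_finite[OF mom])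
  interpret PP: pair_sigma_finite \<mu> lborel ..
  let ?x = "Re z"
  let ?F = "\<lambda>y t. indicator {0<..<y} t *\<^sub>R (z * exp (- z * of_real t))"
  have F_eq: "?F y t = (if 0 < t \<and> t < y then z * exp (- z * of_real t) else 0)" for y t
    by (simp add: indicator_def)
  have meas: "(\<lambda>(y, t). ?F y t) \<in> borel_measurable (\<mu> \<Otimes>\<^sub>M lborel)"
    unfolding F_eq by measurable
  have nF: "norm (?F y t) = norm z / ?x * (indicator {0<..<y} t *\<^sub>R (?x * exp (- ?x * t)))" for y t
    using z by (simp add: indicator_def norm_mult)
  have int: "integrable (\<mu> \<Otimes>\<^sub>M lborel) (\<lambda>(y, t). ?F y t)"
  proof (rule PP.Fubini_integrable[OF meas])
    have "integrable \<mu> (\<lambda>y. norm z / ?x * (1 - exp (- ?x * y)))"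
      using exp_moment_integrable_real[OF mom, of ?x] z by simp
    thus "integrable \<mu> (\<lambda>y. LBINT t. norm (case (y, t) of (y, t) \<Rightarrow> ?F y t))"
    proof (rule Bochner_Integration.integrable_bound)
      show "(\<lambda>y. LBINT t. norm (case (y, t) of (y, t) \<Rightarrow> ?F y t)) \<in> borel_measurable \<mu>"
        using meas by measurable
      show "AE y in \<mu>. norm (LBINT t. norm (case (y, t) of (y, t) \<Rightarrow> ?F y t)) \<le> norm (norm z / ?x * (1 - exp (- ?x * y)))"
        using AE_pos[OF sets null]
      proof eventually_elim
        case (elim y)
        have "(LBINT t. norm (?F y t)) = norm z / ?x * (1 - exp (- ?x * y))"
          unfolding nF integral_mult_right_zero integral_exp_interval(2)[OF elim] ..
        thus ?case by simp
      qed
    qed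
    show "AE y in \<mu>. integrable lborel (\<lambda>t. case (y, t) of (y, t) \<Rightarrow> ?F y t)"
    proof (intro AE_I2)
      fix y
      have "continuous_on {0..y} (\<lambda>t. z * exp (- z * of_real t))" by (intro continuous_intros)
      hence "set_integrable lborel {0..y} (\<lambda>t. z * exp (- z * of_real t))" by (rule borel_integrable_atLeastAtMost')
      hence "set_integrable lborel {0<..<y} (\<lambda>t. z * exp (- z * of_real t))"
        by (rule set_integrable_subset) auto
      thus "integrable lborel (\<lambda>t. case (y, t) of (y, t) \<Rightarrow> ?F y t)" by (simp add: set_integrable_def)
    qed
  qed
  have "(LINT y|\<mu>. 1 - exp (- z * of_real y)) = (LINT y|\<mu>. (LBINT t. ?F y t))"
  proof (rule integral_cong_AE)
    show "AE y in \<mu>. 1 - exp (- z * of_real y) = (LBINT t. ?F y t)"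
      using AE_pos[OF sets null] by eventually_elim (simp only: integral_exp_interval(1))
    show "(\<lambda>y. LBINT t. ?F y t) \<in> borel_measurable \<mu>"
      using PP.integrable_fst'[OF int] by simp
  qed measurable
  also have "\<dots> = (LBINT t. (LINT y|\<mu>. ?F y t))"
    by (rule PP.Fubini_integral[OF int, symmetric])
  also have "(\<lambda>t. LINT y|\<mu>. ?F y t) = (\<lambda>t. z * ((indicator {0<..} t * measure \<mu> {t<..}) *\<^sub>R exp (- z * of_real t)))"
  proof
    fix t :: real
    show "(LINT y|\<mu>. ?F y t) = z * ((indicator {0<..} t * measure \<mu> {t<..}) *\<^sub>R exp (- z * of_real t))"
    proof (cases "0 < t")
      case True
      have "(LINT y|\<mu>. ?F y t) = (LINT y|\<mu>. indicator {t<..} y *\<^sub>R (z * exp (- z * of_real t)))"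
        using True by (intro Bochner_Integration.integral_cong) (auto simp: indicator_def)
      also have "\<dots> = (LINT y|\<mu>. indicator {t<..} y) *\<^sub>R (z * exp (- z * of_real t))"
        using levy_tail_finite[OF mom True]
        by (intro integral_scaleR_left) (auto simp: integrable_indicator_iff sets_eq_imp_space_eq[OF sets])
      finally show ?thesis using True by (simp add: sets_eq_imp_space_eq[OF sets])
    next
      case False
      thus ?thesis by simp
    qed
  qed
  finally show ?thesis by (simp only: integral_mult_right_zero)
qed

subsection \<open>The stable case\<close>

definition stable_measure :: "real \<Rightarrow> real measure" where
  "stable_measure \<alpha> = density lborel (\<lambda>y. ennreal (indicator {0<..} y * y powr (- 1 - \<alpha>)))"

lemma stable_exp_moment:
  assumes "0 < \<alpha>" "\<alpha> < 1"
  shows "exp_moment (stable_measure \<alpha>) 0"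
proof -
  have 1: "set_integrable lborel (einterval (ereal 0) (ereal 1)) (\<lambda>y. y powr (- \<alpha>))"
  proof (rule interval_integral_FTC_nonneg(1)[where F = "\<lambda>y. y powr (1 - \<alpha>) / (1 - \<alpha>)"])
    show "((\<lambda>y. y powr (1 - \<alpha>) / (1 - \<alpha>)) has_real_derivative y powr (- \<alpha>)) (at y)"
      if "ereal 0 < ereal y" for y
      using that assms by (auto intro!: derivative_eq_intros)
    show "((( \<lambda>y. y powr (1 - \<alpha>) / (1 - \<alpha>)) \<circ> real_of_ereal) \<longlongrightarrow> 0) (at_right (ereal 0))"
      unfolding ereal_tendsto_simps using assms
      by (auto intro!: tendsto_eq_intros eventually_at_right_less tendsto_neg_powr simp: eventually_at_right_field)
    show "((( \<lambda>y. y powr (1 - \<alpha>) / (1 - \<alpha>)) \<circ> real_of_ereal) \<longlongrightarrow> 1 powr (1 - \<alpha>) / (1 - \<alpha>)) (at_left (ereal 1))"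
      unfolding ereal_tendsto_simps using assms by (intro tendsto_intros) auto
  qed (auto intro!: continuous_intros)
  have 2: "set_integrable lborel (einterval (ereal 1) \<infinity>) (\<lambda>y. y powr (- 1 - \<alpha>))"
  proof (rule interval_integral_FTC_nonneg(1)[where F = "\<lambda>y. - (y powr (- \<alpha>) / \<alpha>)"])
    show "((\<lambda>y. - (y powr (- \<alpha>) / \<alpha>)) has_real_derivative y powr (- 1 - \<alpha>)) (at y)"
      if "ereal 1 < ereal y" for y
      using that assms by (auto intro!: derivative_eq_intros simp: minus_diff_commute[of \<alpha> 1])
    show "((( \<lambda>y. - (y powr (- \<alpha>) / \<alpha>)) \<circ> real_of_ereal) \<longlongrightarrow> - (1 powr (- \<alpha>) / \<alpha>)) (at_right (ereal 1))"
      unfolding ereal_tendsto_simps using assms by (intro tendsto_intros) auto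
    show "((( \<lambda>y. - (y powr (- \<alpha>) / \<alpha>)) \<circ> real_of_ereal) \<longlongrightarrow> - (0 / \<alpha>)) (at_left \<infinity>)"
      unfolding ereal_tendsto_simps using assms
      by (intro tendsto_intros tendsto_neg_powr filterlim_ident) auto
  qed (auto intro!: continuous_intros)
  have "set_integrable lborel ({0<..<1} \<union> {1<..}) (\<lambda>y. y powr (- 1 - \<alpha>) * min 1 y)"
  proof (rule set_integrable_Un)
    have "set_integrable lborel {0<..<1} (\<lambda>y. y powr (- \<alpha>))" using 1 by simp
    thus "set_integrable lborel {0<..<1} (\<lambda>y. y powr (- 1 - \<alpha>) * min 1 y)"
      by (rule set_integrable_cong[THEN iffD1, rotated -1]) (auto simp: powr_diff powr_minus field_simps)
    have "set_integrable lborel {1<..} (\<lambda>y. y powr (- 1 - \<alpha>))" using 2 by simp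
    thus "set_integrable lborel {1<..} (\<lambda>y. y powr (- 1 - \<alpha>) * min 1 y)"
      by (rule set_integrable_cong[THEN iffD1, rotated -1]) auto
  qed auto
  hence "integrable lborel (\<lambda>y. indicator ({0<..<1} \<union> {1<..}) y * (y powr (- 1 - \<alpha>) * min 1 y))"
    by (simp add: set_integrable_def)
  hence "integrable lborel (\<lambda>y. (indicator {0<..} y * y powr (- 1 - \<alpha>)) * (min 1 y * exp (- 0 * y)))"
  proof (rule integrable_cong_AE_imp)
    show "AE y in lborel. indicator ({0<..<1} \<union> {1<..}) y * (y powr (- 1 - \<alpha>) * min 1 y) =
       (indicator {0<..} y * y powr (- 1 - \<alpha>)) * (min 1 y * exp (- 0 * y))"
      using AE_lborel_singleton[of 1] by eventually_elim (auto simp: indicator_def)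
  qed measurable
  hence "integrable (stable_measure \<alpha>) (\<lambda>y. min 1 y * exp (- 0 * y))"
    unfolding stable_measure_def by (subst integrable_real_density) (auto intro!: AE_I2)
  moreover have "emeasure (stable_measure \<alpha>) {..0} = 0"
  proof -
    have "emeasure (stable_measure \<alpha>) {..0} =
        (\<integral>\<^sup>+y. ennreal (indicator {0<..} y * y powr (- 1 - \<alpha>)) * indicator {..0} y \<partial>lborel)"
      unfolding stable_measure_def by (rule emeasure_density) auto
    also have "\<dots> = (\<integral>\<^sup>+(y::real). 0 \<partial>lborel)" by (intro nn_integral_cong) (auto simp: indicator_def)
    finally show ?thesis by simp
  qed
  ultimately show ?thesis by (simp add: exp_moment_def stable_measure_def)
qed

definition power_laplace :: "real \<Rightarrow> complex \<Rightarrow> complex" where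
  "power_laplace \<alpha> z = (LBINT t. (indicator {0<..} t * t powr (- \<alpha>)) *\<^sub>R exp (- z * of_real t))"

text \<open>As \<open>t powr (- \<alpha>)\<close> is \<open>t\<close> times the density of the stable measure, holomorphy and integrability are
  instances of the facts on Levy measures.\<close>

lemma power_laplace_eq_lap:
  "lap (stable_measure \<alpha>) 1 z = power_laplace \<alpha> z"
proof -
  have "lap (stable_measure \<alpha>) 1 z =
     (LBINT y. (indicator {0<..} y * y powr (- 1 - \<alpha>)) *\<^sub>R (of_real (y ^ 1) * exp (- z * of_real y) - (if (1::nat) = 0 then 1 else 0)))"
    unfolding lap_def stable_measure_def by (rule integral_density) (auto intro!: AE_I2)
  also have "\<dots> = power_laplace \<alpha> z"
    unfolding power_laplace_def
    by (intro Bochner_Integration.integral_cong)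
       (auto simp: indicator_def scaleR_conv_of_real powr_diff powr_minus field_simps)
  finally show ?thesis .
qed

lemma power_laplace_integrable:
  assumes "0 < \<alpha>" "\<alpha> < 1" "0 < x"
  shows "integrable lborel (\<lambda>t::real. indicator {0<..} t * t powr (- \<alpha>) * exp (- x * t) :: real)"
proof -
  have "integrable (stable_measure \<alpha>) (\<lambda>y. y * exp (- x * y))"
    by (rule exp_moment_integrable_exp[OF stable_exp_moment]) (use assms in auto)
  hence "integrable lborel (\<lambda>y. (indicator {0<..} y * y powr (- 1 - \<alpha>)) * (y * exp (- x * y)))"
    unfolding stable_measure_def by (subst integrable_real_density[symmetric]) (auto intro!: AE_I2)
  thus ?thesis
    by (rule Bochner_Integration.integrable_cong[THEN iffD1, rotated -1])
       (auto simp: indicator_def powr_diff powr_minus field_simps)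
qed

lemma power_laplace_of_real:
  "power_laplace \<alpha> (of_real x) = of_real (LBINT t. indicator {0<..} t * t powr (- \<alpha>) * exp (- x * t))"
proof -
  have "power_laplace \<alpha> (of_real x) = (LBINT t. complex_of_real (indicator {0<..} t * t powr (- \<alpha>) * exp (- x * t)))"
    unfolding power_laplace_def
    by (intro Bochner_Integration.integral_cong) (simp_all add: scaleR_conv_of_real exp_of_real[symmetric])
  thus ?thesis by (simp only: integral_complex_of_real)
qed

lemma power_laplace_nonzero:
  assumes "0 < \<alpha>" "\<alpha> < 1"
  shows "power_laplace \<alpha> 1 \<noteq> 0"
proof -
  let ?f = "\<lambda>t::real. indicator {0<..} t * t powr (- \<alpha>) * exp (- 1 * t) :: real"
  have "(LBINT t. ?f t) \<noteq> 0"
  proof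
    assume "(LBINT t. ?f t) = 0"
    hence "AE t in lborel. ?f t = 0"
      using integral_nonneg_eq_0_iff_AE[OF power_laplace_integrable[OF assms, of 1]] by (auto intro!: AE_I2)
    hence "AE t in lborel. t \<notin> {0<..<1::real}"
      by eventually_elim (auto simp: indicator_def)
    hence "{0<..<1::real} \<in> null_sets lborel" by (simp add: AE_iff_null_sets)
    thus False by (auto simp: null_sets_def)
  qed
  thus ?thesis using power_laplace_of_real[of \<alpha> 1] by simp
qed

lemma power_laplace_holomorphic:
  assumes "0 < \<alpha>" "\<alpha> < 1"
  shows "power_laplace \<alpha> holomorphic_on right_half_plane"
proof (rule holomorphic_onI)
  fix z :: complex assume "z \<in> right_half_plane"
  hence "(lap (stable_measure \<alpha>) 1 has_field_derivative - lap (stable_measure \<alpha>) (Suc 1) z) (at z)"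
    by (intro lap_has_derivative[OF stable_exp_moment[OF assms]]) auto
  hence "lap (stable_measure \<alpha>) 1 field_differentiable at z"
    unfolding field_differentiable_def by (rule exI)
  moreover have "power_laplace \<alpha> = lap (stable_measure \<alpha>) 1"
    by (intro ext power_laplace_eq_lap[symmetric])
  ultimately show "power_laplace \<alpha> field_differentiable at z within right_half_plane"
    by (simp only: field_differentiable_at_within)
qed

lemma power_laplace_scaling:
  assumes x: "0 < x"
  shows "power_laplace \<alpha> (of_real x) = power_laplace \<alpha> 1 * of_real x powr of_real (\<alpha> - 1)"
proof -
  let ?f = "\<lambda>x t::real. indicator {0<..} t * t powr (- \<alpha>) * exp (- x * t) :: real"
  have "(LBINT t. ?f x t) = \<bar>1 / x\<bar> *\<^sub>R (LBINT t. ?f x (0 + 1 / x * t))"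
    by (rule lborel_integral_real_affine) (use x in simp)
  moreover have "?f x (0 + 1 / x * t) = x powr \<alpha> * ?f 1 t" for t
  proof (cases "0 < t")
    case True
    have "(1 / x * t) powr (- \<alpha>) = x powr \<alpha> * t powr (- \<alpha>)"
      using x True by (simp add: powr_divide powr_minus_divide)
    thus ?thesis using x True by simp
  next
    case False
    thus ?thesis using x by (simp add: zero_less_divide_iff)
  qed
  ultimately have "(LBINT t. ?f x t) = \<bar>1 / x\<bar> *\<^sub>R (x powr \<alpha> * (LBINT t. ?f 1 t))"
    by (simp only: integral_mult_right_zero)
  also have "\<dots> = x powr (\<alpha> - 1) * (LBINT t. ?f 1 t)"
    using x by (simp add: powr_diff)
  finally have "power_laplace \<alpha> (of_real x) = of_real (x powr (\<alpha> - 1)) * power_laplace \<alpha> (of_real 1)"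
    unfolding power_laplace_of_real by (simp only: of_real_mult)
  moreover have "complex_of_real x powr of_real (\<alpha> - 1) = of_real (x powr (\<alpha> - 1))"
    using x by (intro powr_of_real) auto
  ultimately show ?thesis by simp
qed

lemma one_islimpt_positive_reals: "(1::complex) islimpt of_real ` {0<..}"
  unfolding islimpt_approachable
proof (intro allI impI)
  fix e :: real assume "0 < e"
  moreover from this have "complex_of_real (1 + e / 2) \<in> of_real ` {0<..}"
    by (intro imageI) simp
  ultimately show "\<exists>x'\<in>of_real ` {0<..}. x' \<noteq> (1::complex) \<and> dist x' 1 < e"
    by (intro bexI[of _ "of_real (1 + e / 2)"]) (auto simp: dist_norm)
qed

text \<open>The Laplace transform of a power, up to the constant \<open>power_laplace \<alpha> 1\<close>: scaling gives it on the positive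
  half-line, and the identity theorem on the half-plane.\<close>

lemma power_laplace_eq:
  assumes \<alpha>: "0 < \<alpha>" "\<alpha> < 1" and z: "0 < Re z"
  shows "power_laplace \<alpha> z = power_laplace \<alpha> 1 * z powr (of_real (\<alpha> - 1))"
proof -
  have h1: "(\<lambda>z. z powr (of_real (\<alpha> - 1))) holomorphic_on right_half_plane"
    by (intro holomorphic_intros) (auto simp: complex_nonpos_Reals_iff)
  have "(\<lambda>z. power_laplace \<alpha> z - power_laplace \<alpha> 1 * z powr (of_real (\<alpha> - 1))) holomorphic_on right_half_plane"
    by (rule holomorphic_on_diff[OF power_laplace_holomorphic[OF \<alpha>] holomorphic_on_mult[OF holomorphic_on_const h1]])
  hence "power_laplace \<alpha> z - power_laplace \<alpha> 1 * z powr (of_real (\<alpha> - 1)) = 0"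
  proof (rule analytic_continuation[OF _ open_right_half_plane convex_connected[OF convex_right_half_plane]])
    show "of_real ` {0<..} \<subseteq> right_half_plane" by auto
    show "(1::complex) islimpt of_real ` {0<..}" by (rule one_islimpt_positive_reals)
    show "power_laplace \<alpha> w - power_laplace \<alpha> 1 * w powr (of_real (\<alpha> - 1)) = 0"
      if "w \<in> of_real ` {0<..}" for w
      using that power_laplace_scaling[of _ \<alpha>] by auto
  qed (use z in auto)
  thus ?thesis by simp
qed

subsection \<open>Convergence to the stable case\<close>

text \<open>A Potter bound for monotone functions: halving the argument repeatedly reaches the scale of \<open>\<tau>\<close>, and monotonicity
  bridges the last factor 2.\<close>

lemma doubling_imp_power_bound:
  fixes g :: "real \<Rightarrow> real"
  assumes anti: "\<And>x y. 0 < x \<Longrightarrow> x \<le> y \<Longrightarrow> g y \<le> g x" and nn: "\<And>x. 0 \<le> g x" and \<beta>: "0 < \<beta>"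
    and half: "\<And>t. 0 < t \<Longrightarrow> t \<le> t0 \<Longrightarrow> g (t / 2) \<le> 2 powr \<beta> * g t"
    and \<tau>: "0 < \<tau>" "\<tau> \<le> 1" and t: "0 < t" "t \<le> t0"
  shows "g (\<tau> * t) \<le> 2 powr \<beta> * \<tau> powr (- \<beta>) * g t"
proof -
  have large: "g (\<tau> * t) \<le> 2 powr \<beta> * \<tau> powr (- \<beta>) * g t"
    if "1 / 2 \<le> \<tau>" "\<tau> \<le> 1" "0 < t" "t \<le> t0" for \<tau> t
  proof -
    have "g (\<tau> * t) \<le> g (t / 2)" using that by (intro anti) auto
    also have "\<dots> \<le> 2 powr \<beta> * 1 * g t" using half[of t] that by simp
    also have "\<dots> \<le> 2 powr \<beta> * \<tau> powr (- \<beta>) * g t"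
    proof (intro mult_right_mono mult_left_mono nn)
      have "\<tau> powr \<beta> \<le> 1" using that \<beta> by (intro powr_le1) auto
      thus "1 \<le> \<tau> powr (- \<beta>)" using that by (simp add: powr_minus field_simps)
    qed auto
    finally show ?thesis .
  qed
  obtain n where n: "(1 / 2) ^ n < \<tau>" using real_arch_pow_inv[OF \<tau>(1), of "1 / 2"] by auto
  show ?thesis using n \<tau> t
  proof (induction n arbitrary: \<tau> t)
    case 0
    thus ?case by simp
  next
    case (Suc n)
    show ?case
    proof (cases "1 / 2 \<le> \<tau>")
      case True
      thus ?thesis using large Suc by blast
    next
      case False
      have "g (\<tau> * t) = g ((2 * \<tau>) * (t / 2))" by simp
      also have "\<dots> \<le> 2 powr \<beta> * (2 * \<tau>) powr (- \<beta>) * g (t / 2)"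
        using Suc.prems False by (intro Suc.IH) auto
      also have "\<dots> \<le> 2 powr \<beta> * (2 * \<tau>) powr (- \<beta>) * (2 powr \<beta> * g t)"
        using half[of t] Suc.prems by (intro mult_left_mono) auto
      also have "\<dots> = 2 powr \<beta> * \<tau> powr (- \<beta>) * g t"
        using Suc.prems by (simp add: powr_mult powr_minus field_simps)
      finally show ?thesis .
    qed
  qed
qed

lemma doubling_imp_unbounded:
  fixes g :: "real \<Rightarrow> real"
  assumes anti: "\<And>x y. 0 < x \<Longrightarrow> x \<le> y \<Longrightarrow> g y \<le> g x" and \<rho>: "1 < \<rho>"
    and half: "\<And>t. 0 < t \<Longrightarrow> t \<le> t1 \<Longrightarrow> \<rho> * g t \<le> g (t / 2)" and t1: "0 < t1" "0 < g t1"
  shows "filterlim g at_top (at_right 0)"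
  unfolding filterlim_at_top
proof
  fix K
  have iter: "\<rho> ^ n * g t1 \<le> g (t1 / 2 ^ n)" for n
  proof (induction n)
    case (Suc n)
    have "\<rho> ^ Suc n * g t1 \<le> \<rho> * g (t1 / 2 ^ n)" using Suc \<rho> by (simp add: mult.assoc)
    also have "\<dots> \<le> g (t1 / 2 ^ n / 2)" using t1 by (intro half) (auto simp: field_simps mult_left_le)
    finally show ?case by (simp add: field_simps)
  qed simp
  obtain n where n: "K / g t1 < \<rho> ^ n" using real_arch_pow[OF \<rho>] by blast
  have "K \<le> g (t1 / 2 ^ n)"
    using iter[of n] n t1 by (simp add: field_simps)
  hence "K \<le> g t" if "0 < t" "t < t1 / 2 ^ n" for t
    using anti[of t "t1 / 2 ^ n"] that by simp
  thus "\<forall>\<^sub>F t in at_right 0. K \<le> g t"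
    using t1 by (intro eventually_at_rightI[of 0 "t1 / 2 ^ n"]) auto
qed

lemma integral_exp_half_line:
  assumes x: "0 < (x::real)"
  shows "integrable lborel (\<lambda>t. indicator {0<..} t * exp (- x * t))"
    and "(LBINT t. indicator {0<..} t * exp (- x * t)) = 1 / x"
proof -
  let ?F = "\<lambda>t. - exp (- x * t) / x"
  have D: "(?F has_real_derivative exp (- x * t)) (at t)" for t
    using x by (auto intro!: derivative_eq_intros)
  have A: "((?F \<circ> real_of_ereal) \<longlongrightarrow> - exp (- x * 0) / x) (at_right (ereal 0))"
    unfolding ereal_tendsto_simps using x by (intro tendsto_intros) auto
  have B: "((?F \<circ> real_of_ereal) \<longlongrightarrow> 0) (at_left \<infinity>)"
    unfolding ereal_tendsto_simps using x by real_asymp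
  have c: "isCont (\<lambda>t. exp (- x * t)) t" for t by (intro continuous_intros)
  have AE: "AE t in lborel. ereal 0 < ereal t \<longrightarrow> ereal t < \<infinity> \<longrightarrow> 0 \<le> exp (- x * t)"
    by (intro AE_I2) simp
  note FTC = interval_integral_FTC_nonneg[OF _ D c AE A B]
  show "integrable lborel (\<lambda>t. indicator {0<..} t * exp (- x * t))"
    using FTC(1) by (simp add: set_integrable_def)
  have "(LBINT t=ereal 0..\<infinity>. exp (- x * t)) = 0 - (- exp (- x * 0) / x)" by (rule FTC(2)) auto
  thus "(LBINT t. indicator {0<..} t * exp (- x * t)) = 1 / x"
    by (simp add: interval_integral_to_infinity_eq set_lebesgue_integral_def)
qed

text \<open>The tail representation and the substitution \<open>t = \<tau> / r\<close> give
  \<open>\<phi>(r w) = q + w \<integral> exp (- w \<tau>) g(\<tau> / r) d\<tau>\<close>. After division by \<open>g(1 / r)\<close>, which tends to infinity, regular variation gives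
  the pointwise limit \<open>\<tau> powr (- \<alpha>)\<close>. The integrand is dominated by the Potter bound for \<open>\<tau> \<le> 1\<close> and by
  monotonicity of the tail for \<open>\<tau> > 1\<close>.\<close>

lemma regularly_varying_bernstein_limit:
  assumes bern: "\<phi> \<in> bernstein_functions" and lk: "levy_khintchine \<phi> q 0 \<mu>"
    and \<alpha>: "0 < \<alpha>" "\<alpha> < 1" and w: "0 < Re w"
  defines "g \<equiv> \<lambda>t. measure \<mu> {t<..}"
  assumes rv: "\<And>c. 0 < c \<Longrightarrow> ((\<lambda>t. g (c * t) / g t) \<longlongrightarrow> c powr (- \<alpha>)) (at_right 0)"
    and gpos: "\<forall>\<^sub>F t in at_right 0. 0 < g t"
  shows "((\<lambda>r. \<phi> (of_real r * w) / of_real (g (1 / r))) \<longlongrightarrow> w * power_laplace \<alpha> w) at_top"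
proof -
  have mom: "exp_moment \<mu> 0" by (rule levy_khintchine_exp_moment[OF lk])
  have sets: "sets \<mu> = sets borel" using mom by (simp add: exp_moment_def)
  have nn: "0 \<le> g t" for t by (simp add: g_def)
  have anti: "g y \<le> g x" if "0 < x" "x \<le> y" for x y
    unfolding g_def using levy_tail_finite[OF mom that(1)] that
    by (intro measure_mono_fmeasurable) (auto simp: fmeasurable_def sets)
  \<comment> \<open>an exponent above \<open>\<alpha>\<close>, for the Potter bound, which is still integrable at 0\<close>
  define \<beta> where "\<beta> = (1 + \<alpha>) / 2"
  have \<beta>: "0 < \<beta>" "\<beta> < 1" "\<alpha> < \<beta>" using \<alpha> by (auto simp: \<beta>_def)
  have half: "((\<lambda>t. g (1 / 2 * t) / g t) \<longlongrightarrow> 2 powr \<alpha>) (at_right 0)"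
    using rv[of "1 / 2"] by (simp add: powr_divide powr_minus field_simps)
  have "\<forall>\<^sub>F t in at_right 0. g (1 / 2 * t) / g t < 2 powr \<beta> \<and> 2 powr (\<alpha> / 2) < g (1 / 2 * t) / g t \<and> 0 < g t"
    using order_tendstoD[OF half] \<beta> \<alpha> gpos by (intro eventually_conj) auto
  then obtain t0 where t0: "0 < t0" "\<And>t. 0 < t \<Longrightarrow> t < t0 \<Longrightarrow>
      g (1 / 2 * t) / g t < 2 powr \<beta> \<and> 2 powr (\<alpha> / 2) < g (1 / 2 * t) / g t \<and> 0 < g t"
    unfolding eventually_at_right_field by auto
  define t1 where "t1 = t0 / 2"
  have t1: "0 < t1" "t1 < t0" using t0 by (auto simp: t1_def)
  have gp: "0 < g t" if "0 < t" "t \<le> t1" for t using t0(2)[of t] t1 that by simp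
  have bound: "g (\<tau> * t) \<le> 2 powr \<beta> * \<tau> powr (- \<beta>) * g t" if "0 < \<tau>" "\<tau> \<le> 1" "0 < t" "t \<le> t1" for \<tau> t
  proof (rule doubling_imp_power_bound[OF anti nn \<beta>(1) _ that])
    show "g (t / 2) \<le> 2 powr \<beta> * g t" if "0 < t" "t \<le> t1" for t
    proof -
      have "g (t / 2) / g t < 2 powr \<beta>" "0 < g t" using t0(2)[of t] t1 that by auto
      thus ?thesis by (simp add: pos_divide_less_eq)
    qed
  qed
  have g_top: "filterlim g at_top (at_right 0)"
  proof (rule doubling_imp_unbounded[OF anti, where \<rho> = "2 powr (\<alpha> / 2)" and ?t1.0 = t1])
    show "1 < 2 powr (\<alpha> / 2)" using \<alpha> by simp
    show "2 powr (\<alpha> / 2) * g t \<le> g (t / 2)" if "0 < t" "t \<le> t1" for t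
    proof -
      have "2 powr (\<alpha> / 2) < g (t / 2) / g t" "0 < g t" using t0(2)[of t] t1 that by auto
      thus ?thesis by (simp add: pos_less_divide_eq)
    qed
  qed (use t1 gp in auto)
  have inv: "filterlim (\<lambda>r::real. 1 / r) (at_right 0) at_top"
    using filterlim_inverse_at_right_top by (simp add: inverse_eq_divide)
  let ?s = "\<lambda>r \<tau>. ((indicator {0<..} (\<tau> / r) * g (\<tau> / r)) / g (1 / r)) *\<^sub>R exp (- w * of_real \<tau>)"
  have "((\<lambda>r. q / g (1 / r)) \<longlongrightarrow> 0) at_top"
    by (intro tendsto_divide_0[OF tendsto_const] filterlim_at_top_imp_at_infinity filterlim_compose[OF g_top inv])
  moreover have "((\<lambda>r. LBINT \<tau>. ?s r \<tau>)
      \<longlongrightarrow> (LBINT \<tau>. (indicator {0<..} \<tau> * \<tau> powr (- \<alpha>)) *\<^sub>R exp (- w * of_real \<tau>))) at_top"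
  proof (rule integral_dominated_convergence_at_top[where
        w = "\<lambda>\<tau>. 2 powr \<beta> * (indicator {0<..} \<tau> * \<tau> powr (- \<beta>) * exp (- Re w * \<tau>))
              + indicator {0<..} \<tau> * exp (- Re w * \<tau>)"])
    show "integrable lborel (\<lambda>\<tau>. 2 powr \<beta> * (indicator {0<..} \<tau> * \<tau> powr (- \<beta>) * exp (- Re w * \<tau>))
              + indicator {0<..} \<tau> * exp (- Re w * \<tau>))"
      by (intro Bochner_Integration.integrable_add integrable_mult_right power_laplace_integrable
          integral_exp_half_line \<beta> w)
    have "mono_on {0<..} (\<lambda>t. - g t)" using anti by (auto simp: mono_on_def)
    hence "(\<lambda>t. - g t) \<in> borel_measurable (restrict_space borel {0<..})"
      by (rule borel_measurable_mono_on_fnc)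
    hence "(\<lambda>t. indicator {0<..} t *\<^sub>R (- g t)) \<in> borel_measurable borel"
      by (subst (asm) borel_measurable_restrict_space_iff) auto
    hence [measurable]: "(\<lambda>t. indicator {0<..} t * g t) \<in> borel_measurable borel"
      by (subst (asm) borel_measurable_uminus_eq[symmetric]) simp
    show "?s r \<in> borel_measurable lborel" for r
      by measurable
    show "AE \<tau> in lborel. ((\<lambda>r. ?s r \<tau>) \<longlongrightarrow> (indicator {0<..} \<tau> * \<tau> powr (- \<alpha>)) *\<^sub>R exp (- w * of_real \<tau>)) at_top"
    proof (intro AE_I2)
      fix \<tau> :: real
      show "((\<lambda>r. ?s r \<tau>) \<longlongrightarrow> (indicator {0<..} \<tau> * \<tau> powr (- \<alpha>)) *\<^sub>R exp (- w * of_real \<tau>)) at_top"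
      proof (cases "0 < \<tau>")
        case True
        have "((\<lambda>r. g (\<tau> * (1 / r)) / g (1 / r)) \<longlongrightarrow> \<tau> powr (- \<alpha>)) at_top"
          by (rule filterlim_compose[OF rv[OF True] inv])
        hence "((\<lambda>r. (g (\<tau> * (1 / r)) / g (1 / r)) *\<^sub>R exp (- w * of_real \<tau>)) \<longlongrightarrow>
            (\<tau> powr (- \<alpha>)) *\<^sub>R exp (- w * of_real \<tau>)) at_top"
          by (intro tendsto_intros)
        hence "((\<lambda>r. ?s r \<tau>) \<longlongrightarrow> (\<tau> powr (- \<alpha>)) *\<^sub>R exp (- w * of_real \<tau>)) at_top"
          by (rule Lim_transform_eventually)
             (use True in \<open>auto intro!: eventually_mono[OF eventually_gt_at_top[of 0]]\<close>)
        thus ?thesis using True by simp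
      next
        case False
        have "((\<lambda>r. 0) \<longlongrightarrow> (0::complex)) at_top" by (rule tendsto_const)
        hence "((\<lambda>r. ?s r \<tau>) \<longlongrightarrow> 0) at_top"
          by (rule Lim_transform_eventually)
             (use False in \<open>auto simp: zero_less_divide_iff intro!: eventually_mono[OF eventually_gt_at_top[of 0]]\<close>)
        thus ?thesis using False by simp
      qed
    qed
    show "\<forall>\<^sub>F r in at_top. AE \<tau> in lborel. norm (?s r \<tau>) \<le> 2 powr \<beta> * (indicator {0<..} \<tau> * \<tau> powr (- \<beta>) * exp (- Re w * \<tau>))
              + indicator {0<..} \<tau> * exp (- Re w * \<tau>)"
      using eventually_ge_at_top[of "1 / t1"] eventually_gt_at_top[of 0]
    proof eventually_elim
      case (elim r)
      have r: "0 < 1 / r" "1 / r \<le> t1" using elim t1 by (auto simp: field_simps)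
      note g1 = gp[OF r]
      show ?case
      proof (intro AE_I2)
        fix \<tau> :: real
        show "norm (?s r \<tau>) \<le> 2 powr \<beta> * (indicator {0<..} \<tau> * \<tau> powr (- \<beta>) * exp (- Re w * \<tau>))
              + indicator {0<..} \<tau> * exp (- Re w * \<tau>)"
        proof (cases "0 < \<tau>")
          case True
          have "g (\<tau> / r) / g (1 / r) \<le> 2 powr \<beta> * \<tau> powr (- \<beta>) + 1"
          proof (cases "\<tau> \<le> 1")
            case le: True
            have "g (\<tau> / r) / g (1 / r) \<le> 2 powr \<beta> * \<tau> powr (- \<beta>)"
              using bound[OF True le r] g1 by (simp add: pos_divide_le_eq)
            thus ?thesis by simp
          next
            case False
            hence "g (\<tau> / r) \<le> g (1 / r)" using r elim by (intro anti) (auto simp: divide_right_mono)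
            hence "g (\<tau> / r) / g (1 / r) \<le> 1" using g1 by simp
            thus ?thesis by (simp add: add_increasing)
          qed
          hence "g (\<tau> / r) / g (1 / r) * exp (- Re w * \<tau>) \<le> (2 powr \<beta> * \<tau> powr (- \<beta>) + 1) * exp (- Re w * \<tau>)"
            by (intro mult_right_mono) auto
          moreover have "norm (?s r \<tau>) = g (\<tau> / r) / g (1 / r) * exp (- Re w * \<tau>)"
            using True elim g1 nn[of "\<tau> / r"] by simp
          ultimately show ?thesis using True by (simp add: algebra_simps)
        next
          case False
          thus ?thesis using elim by (simp add: zero_less_divide_iff)
        qed
      qed
    qed
  qed measurable
  ultimately have "((\<lambda>r. of_real (q / g (1 / r)) + w * (LBINT \<tau>. ?s r \<tau>)) \<longlongrightarrow> of_real 0 + w * power_laplace \<alpha> w) at_top"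
    unfolding power_laplace_def by (intro tendsto_intros)
  moreover have "\<forall>\<^sub>F r in at_top. of_real (q / g (1 / r)) + w * (LBINT \<tau>. ?s r \<tau>) = \<phi> (of_real r * w) / of_real (g (1 / r))"
    using eventually_gt_at_top[of 0] filterlim_at_top_dense[THEN iffD1, OF filterlim_compose[OF g_top inv], rule_format, of 0]
  proof eventually_elim
    case (elim r)
    let ?h = "\<lambda>t. (indicator {0<..} t * g t) *\<^sub>R exp (- (of_real r * w) * of_real t)"
    have "\<phi> (of_real r * w) = lk_integral q 0 \<mu> (of_real r * w)"
      by (rule levy_khintchine_eq[OF lk]) (use elim w in simp)
    also have "\<dots> = of_real q + (of_real r * w) * (LBINT t. ?h t)"
      unfolding lk_integral_def g_def
      by (subst lk_integral_tail[OF mom]) (use elim w in auto)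
    also have "(LBINT t. ?h t) = \<bar>1 / r\<bar> *\<^sub>R (LBINT \<tau>. ?h (0 + 1 / r * \<tau>))"
      by (rule lborel_integral_real_affine) (use elim in simp)
    also have "(LBINT \<tau>. ?h (0 + 1 / r * \<tau>)) = of_real (g (1 / r)) * (LBINT \<tau>. ?s r \<tau>)"
    proof -
      have "(\<lambda>\<tau>. ?h (0 + 1 / r * \<tau>)) = (\<lambda>\<tau>. of_real (g (1 / r)) * ?s r \<tau>)"
        using elim by (auto simp: fun_eq_iff scaleR_conv_of_real)
      thus ?thesis by (simp only: integral_mult_right_zero)
    qed
    finally show ?case using elim by (simp add: add_divide_distrib scaleR_conv_of_real)
  qed
  ultimately show ?thesis by (simp add: Lim_transform_eventually)
qed

theorem exp_class_regular:
  assumes bern: "\<phi> \<in> bernstein_functions" and \<alpha>: "0 < \<alpha>" "\<alpha> < 1" and reg: "\<phi> \<in> regular_class \<alpha>"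
  shows "\<phi> \<in> exp_class (pi / 2 * \<alpha>)"
proof -
  obtain q \<mu> l where lk: "levy_khintchine \<phi> q 0 \<mu>"
    and tail: "\<And>y. 0 < y \<Longrightarrow> measure \<mu> {y<..} = y powr (- \<alpha>) * l y" and sv: "slowly_varying_at_0 l"
    using reg by (auto simp: regular_class_def)
  define g where "g t = measure \<mu> {t<..}" for t
  have lpos: "\<forall>\<^sub>F y in at_right 0. 0 < l y" and l: "\<And>c. 0 < c \<Longrightarrow> ((\<lambda>y. l (c * y) / l y) \<longlongrightarrow> 1) (at_right 0)"
    using sv by (auto simp: slowly_varying_at_0_def)
  have gpos: "\<forall>\<^sub>F t in at_right 0. 0 < g t"
    using lpos eventually_at_right_less[of 0] by eventually_elim (simp add: g_def tail)
  have rv: "((\<lambda>t. g (c * t) / g t) \<longlongrightarrow> c powr (- \<alpha>)) (at_right 0)" if c: "0 < c" for c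
  proof -
    have "((\<lambda>t. c powr (- \<alpha>) * (l (c * t) / l t)) \<longlongrightarrow> c powr (- \<alpha>) * 1) (at_right 0)"
      by (intro tendsto_intros l c)
    moreover have "\<forall>\<^sub>F t in at_right 0. c powr (- \<alpha>) * (l (c * t) / l t) = g (c * t) / g t"
      using eventually_at_right_less[of 0] by eventually_elim (use c in \<open>simp add: g_def tail powr_mult\<close>)
    ultimately show ?thesis by (simp add: Lim_transform_eventually)
  qed
  have lim: "((\<lambda>r. \<phi> (of_real r * w) / of_real (g (1 / r))) \<longlongrightarrow> w * power_laplace \<alpha> w) at_top" if "0 < Re w" for w
    unfolding g_def
    by (rule regularly_varying_bernstein_limit[OF bern lk \<alpha> that]) (use rv gpos in \<open>auto simp: g_def\<close>)
  have inv: "filterlim (\<lambda>r::real. 1 / r) (at_right 0) at_top"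
    using filterlim_inverse_at_right_top by (simp add: inverse_eq_divide)
  have "\<forall>\<^sub>F r in at_top. 0 < g (1 / r)"
    by (rule eventually_compose_filterlim[OF gpos inv])
  note gpos' = this
  show ?thesis
  proof (rule exp_class_criterion[OF bern])
    fix s :: real assume s: "0 < s"
    have pl: "norm (w * power_laplace \<alpha> w) = norm (power_laplace \<alpha> 1) * norm w powr \<alpha>" if "0 < Re w" for w
    proof -
      have "w \<noteq> 0" using that by auto
      hence n1: "norm (w powr (of_real (\<alpha> - 1))) = norm w powr (\<alpha> - 1)"
        by (simp add: norm_powr_real_powr')
      have n2: "norm w * norm w powr (\<alpha> - 1) = norm w powr \<alpha>"
        using \<open>w \<noteq> 0\<close> by (simp add: powr_diff)
      show ?thesis
        unfolding power_laplace_eq[OF \<alpha> that] norm_mult mult.left_commute[of "norm w"] n1 n2 ..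
    qed
    have "((\<lambda>t. norm (\<phi> (of_real t * Complex s 1) / of_real (g (1 / t))) / norm (\<phi> (of_real t * of_real s) / of_real (g (1 / t))))
        \<longlongrightarrow> norm (Complex s 1 * power_laplace \<alpha> (Complex s 1)) / norm (of_real s * power_laplace \<alpha> (of_real s))) at_top"
    proof (intro tendsto_intros lim)
      show "norm (of_real s * power_laplace \<alpha> (of_real s)) \<noteq> 0"
        using pl[of "of_real s"] s power_laplace_nonzero[OF \<alpha>] by simp
    qed (use s in auto)
    also have "norm (Complex s 1 * power_laplace \<alpha> (Complex s 1)) / norm (of_real s * power_laplace \<alpha> (of_real s))
       = (norm (Complex s 1) / s) powr \<alpha>"
      using pl[of "of_real s"] pl[of "Complex s 1"] s power_laplace_nonzero[OF \<alpha>] by (simp add: powr_divide)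
    also have "\<dots> = sqrt (1 + 1 / s\<^sup>2) powr \<alpha>" by (simp only: sqrt_modulus[OF s])
    finally show "((\<lambda>t. norm (\<phi> (Complex (t * s) t)) / on_reals \<phi> (t * s)) \<longlongrightarrow> sqrt (1 + 1 / s\<^sup>2) powr \<alpha>) at_top"
    proof (rule Lim_transform_eventually)
      show "\<forall>\<^sub>F t in at_top. norm (\<phi> (of_real t * Complex s 1) / of_real (g (1 / t))) / norm (\<phi> (of_real t * of_real s) / of_real (g (1 / t))) =
         norm (\<phi> (Complex (t * s) t)) / on_reals \<phi> (t * s)"
        using eventually_gt_at_top[of 0] gpos'
      proof eventually_elim
        case (elim t)
        have "of_real t * Complex s 1 = Complex (t * s) t" by (simp add: complex_eq_iff)
        moreover have "norm (\<phi> (of_real t * of_real s)) = on_reals \<phi> (t * s)"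
          using bernstein_of_real[OF bern, of "t * s"] bernstein_pos[OF bern, of "t * s"] elim s by simp
        ultimately show ?case using elim by (simp add: norm_divide)
      qed
    qed
  qed (use \<alpha> in simp)
qed

section \<open>Logarithmic growth of the phase integral\<close>

text \<open>The function \<open>ln y - sin (b y) / (b y)\<close> is a primitive of the integrand up to \<open>sin (b y) / (b y\<^sup>2)\<close>, whose
  integral over \<open>[1 / b, \<delta>]\<close> is bounded by 1.\<close>

lemma cos_integral_bounds:
  fixes b \<delta> :: real
  assumes b: "0 < b" "1 / b \<le> \<delta>"
  defines "I \<equiv> LBINT y:{1 / b..\<delta>}. (1 - cos (b * y)) / y"
  shows "set_integrable lborel {1 / b..\<delta>} (\<lambda>y. (1 - cos (b * y)) / y)"
    and "ln (b * \<delta>) - 2 \<le> I" "I \<le> ln (b * \<delta>) + 2"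
proof -
  have b1: "0 < 1 / b" using b(1) by simp
  have pos: "0 < y" if "1 / b \<le> y" for y using that b1 by linarith
  have \<delta>: "0 < \<delta>" using pos b by blast
  have nz: "\<forall>y\<in>{1 / b..\<delta>}. y \<noteq> 0"
  proof
    fix y assume "y \<in> {1 / b..\<delta>}"
    thus "y \<noteq> 0" using pos[of y] by simp
  qed
  have c: "continuous_on {1 / b..\<delta>} (\<lambda>y. (1 - cos (b * y)) / y)"
    by (intro continuous_on_divide nz continuous_intros)
  show i: "set_integrable lborel {1 / b..\<delta>} (\<lambda>y. (1 - cos (b * y)) / y)"
    by (rule borel_integrable_atLeastAtMost'[OF c])
  have I: "I = integral {1 / b..\<delta>} (\<lambda>y. (1 - cos (b * y)) / y)"
    unfolding I_def by (rule set_borel_integral_eq_integral(2)[OF i])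
  define c0 where "c0 = (ln \<delta> - sin (b * \<delta>) / (b * \<delta>)) - (ln (1 / b) - sin 1)"
  have h0: "((\<lambda>y. 1 / y - (cos (b * y) / y - sin (b * y) / (b * y\<^sup>2))) has_integral
      ((ln \<delta> - sin (b * \<delta>) / (b * \<delta>)) - (ln (1 / b) - sin (b * (1 / b)) / (b * (1 / b))))) {1 / b..\<delta>}"
  proof (rule fundamental_theorem_of_calculus[OF b(2)])
    fix y assume "y \<in> {1 / b..\<delta>}"
    hence y: "0 < y" using pos by auto
    have num: "((\<lambda>y. sin (b * y)) has_real_derivative cos (b * y) * b) (at y)"
      and den: "((\<lambda>y. b * y) has_real_derivative b) (at y)"
      by (auto intro!: derivative_eq_intros)
    have by0: "b * y \<noteq> 0" using y b by simp
    have "((\<lambda>y. ln y - sin (b * y) / (b * y)) has_real_derivative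
        1 / y - (cos (b * y) * b * (b * y) - sin (b * y) * b) / (b * y * (b * y))) (at y)"
      by (rule DERIV_diff[OF DERIV_ln_divide[OF y] DERIV_divide[OF num den by0]])
    moreover have "(cos (b * y) * b * (b * y) - sin (b * y) * b) / (b * y * (b * y)) =
        cos (b * y) / y - sin (b * y) / (b * y\<^sup>2)"
      using y b by (simp add: diff_divide_distrib power2_eq_square)
    ultimately have "((\<lambda>y. ln y - sin (b * y) / (b * y)) has_real_derivative
        1 / y - (cos (b * y) / y - sin (b * y) / (b * y\<^sup>2))) (at y)" by simp
    thus "((\<lambda>y. ln y - sin (b * y) / (b * y)) has_vector_derivative
        1 / y - (cos (b * y) / y - sin (b * y) / (b * y\<^sup>2))) (at y within {1 / b..\<delta>})"
      by (auto simp: has_real_derivative_iff_has_vector_derivative intro: has_vector_derivative_at_within)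
  qed
  have "((\<lambda>y. (1 - cos (b * y)) / y - (1 / y - (cos (b * y) / y - sin (b * y) / (b * y\<^sup>2)))) has_integral I - c0) {1 / b..\<delta>}"
  proof (rule has_integral_diff)
    show "((\<lambda>y. (1 - cos (b * y)) / y) has_integral I) {1 / b..\<delta>}"
      unfolding I by (rule integrable_integral[OF integrable_continuous_real[OF c]])
    show "((\<lambda>y. 1 / y - (cos (b * y) / y - sin (b * y) / (b * y\<^sup>2))) has_integral c0) {1 / b..\<delta>}"
      using h0 b by (simp add: c0_def)
  qed
  hence h1: "((\<lambda>y. - (sin (b * y) / (b * y\<^sup>2))) has_integral I - c0) {1 / b..\<delta>}"
    by (rule has_integral_eq[rotated]) (auto simp: diff_divide_distrib)
  have "((\<lambda>y. 1 / (b * y\<^sup>2)) has_integral (- 1 / (b * \<delta>) - - 1 / (b * (1 / b)))) {1 / b..\<delta>}"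
  proof (rule fundamental_theorem_of_calculus[OF b(2)])
    fix y assume "y \<in> {1 / b..\<delta>}"
    hence y: "0 < y" using pos by auto
    have den: "((\<lambda>y. b * y) has_real_derivative b) (at y)"
      by (auto intro!: derivative_eq_intros)
    have by0: "b * y \<noteq> 0" using y b by simp
    have "((\<lambda>y. - 1 / (b * y)) has_real_derivative (0 * (b * y) - (- 1) * b) / (b * y * (b * y))) (at y)"
      by (rule DERIV_divide[OF DERIV_const den by0])
    moreover have "(0 * (b * y) - (- 1) * b) / (b * y * (b * y)) = 1 / (b * y\<^sup>2)"
      using y b by (simp add: power2_eq_square)
    ultimately have "((\<lambda>y. - 1 / (b * y)) has_real_derivative 1 / (b * y\<^sup>2)) (at y)" by simp
    thus "((\<lambda>y. - 1 / (b * y)) has_vector_derivative 1 / (b * y\<^sup>2)) (at y within {1 / b..\<delta>})"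
      by (auto simp: has_real_derivative_iff_has_vector_derivative intro: has_vector_derivative_at_within)
  qed
  hence h2: "((\<lambda>y. 1 / (b * y\<^sup>2)) has_integral (1 - 1 / (b * \<delta>))) {1 / b..\<delta>}"
    using b by simp
  have bd: "\<bar>- (sin (b * y) / (b * y\<^sup>2))\<bar> \<le> 1 / (b * y\<^sup>2)" for y :: real
    using b by (auto simp: abs_mult intro!: divide_right_mono)
  have "I - c0 \<le> 1 - 1 / (b * \<delta>)"
    by (rule has_integral_le[OF h1 h2]) (rule order.trans[OF abs_ge_self bd])
  moreover have "- (1 - 1 / (b * \<delta>)) \<le> I - c0"
  proof (rule has_integral_le[OF has_integral_neg[OF h2] h1])
    show "- (1 / (b * y\<^sup>2)) \<le> - (sin (b * y) / (b * y\<^sup>2))" for y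
      using bd[of y] by linarith
  qed
  moreover have "\<bar>sin (b * \<delta>) / (b * \<delta>)\<bar> \<le> 1 / (b * \<delta>)" using b \<delta> by (simp add: abs_divide divide_right_mono)
  moreover have "sin 1 \<le> (1::real)" "0 \<le> sin (1::real)" using sin_ge_zero[of 1] pi_gt3 by auto
  moreover have "0 \<le> 1 / (b * \<delta>)" "1 / (b * \<delta>) \<le> 1" using b \<delta> by (auto simp: field_simps)
  moreover have "c0 = ln (b * \<delta>) - sin (b * \<delta>) / (b * \<delta>) + sin 1"
    using b \<delta> by (simp add: c0_def ln_mult ln_div)
  ultimately show "ln (b * \<delta>) - 2 \<le> I" "I \<le> ln (b * \<delta>) + 2" unfolding abs_le_iff by linarith+
qed

lemma one_minus_cos_le: "1 - cos t \<le> \<bar>t\<bar>" for t :: real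
proof -
  have "norm (cos t - cos 0) \<le> 1 * norm (t - 0)"
    by (rule field_differentiable_bound[where S = UNIV and f' = "\<lambda>x. - sin x"])
       (auto intro!: derivative_eq_intros)
  thus ?thesis by simp
qed

lemma cos_nn_integral_lower:
  fixes g :: "real \<Rightarrow> real"
  assumes b: "0 < b" "1 / b < \<delta>" and K: "0 \<le> K" "\<And>y. 0 < y \<Longrightarrow> y < \<delta> \<Longrightarrow> K \<le> g y"
  shows "ennreal (K * (ln (b * \<delta>) - 2)) \<le> (\<integral>\<^sup>+y. ennreal (indicator {0<..} y * (g y * (1 - cos (b * y)) / y)) \<partial>lborel)"
proof -
  let ?f = "\<lambda>y. (1 - cos (b * y)) / y"
  note cb = cos_integral_bounds[OF b(1) less_imp_le[OF b(2)]]
  have b1: "0 < 1 / b" using b(1) by simp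
  have pos: "0 < y" if "1 / b \<le> y" for y using that b1 by linarith
  have "ennreal (K * (ln (b * \<delta>) - 2)) \<le> ennreal (K * (LBINT y:{1 / b..\<delta>}. ?f y))"
    using cb K by (intro ennreal_leI mult_left_mono) auto
  also have "K * (LBINT y:{1 / b..\<delta>}. ?f y) = (LBINT y. K * (indicator {1 / b..\<delta>} y *\<^sub>R ?f y))"
    unfolding set_lebesgue_integral_def by (simp only: integral_mult_right_zero)
  also have "ennreal \<dots> = (\<integral>\<^sup>+y. ennreal (K * (indicator {1 / b..\<delta>} y *\<^sub>R ?f y)) \<partial>lborel)"
  proof (rule nn_integral_eq_integral[symmetric])
    show "integrable lborel (\<lambda>y. K * (indicator {1 / b..\<delta>} y *\<^sub>R ?f y))"
      using cb(1) unfolding set_integrable_def by (rule integrable_mult_right)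
    show "AE y in lborel. 0 \<le> K * (indicator {1 / b..\<delta>} y *\<^sub>R ?f y)"
      using K pos by (intro AE_I2) (auto simp: indicator_def less_imp_le)
  qed
  also have "\<dots> \<le> (\<integral>\<^sup>+y. ennreal (indicator {0<..} y * (g y * (1 - cos (b * y)) / y)) \<partial>lborel)"
  proof (rule nn_integral_mono_AE)
    show "AE y in lborel. ennreal (K * (indicator {1 / b..\<delta>} y *\<^sub>R ?f y)) \<le>
            ennreal (indicator {0<..} y * (g y * (1 - cos (b * y)) / y))"
      using AE_lborel_singleton[of \<delta>]
    proof eventually_elim
      case (elim y)
      show ?case
      proof (cases "1 / b \<le> y \<and> y < \<delta>")
        case True
        hence "0 < y" "y < \<delta>" using pos by auto
        hence "K * ?f y \<le> g y * ?f y" using K by (intro mult_right_mono) auto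
        thus ?thesis using True \<open>0 < y\<close> by (intro ennreal_leI) auto
      next
        case False
        hence "indicator {1 / b..\<delta>} y = (0::real)" using elim by (auto simp: indicator_def)
        thus ?thesis by simp
      qed
    qed
  qed
  finally show ?thesis .
qed

text \<open>Three ranges: \<open>y < 1 / b\<close>, where \<open>(1 - cos (b y)) / y \<le> b\<close>; the logarithmic range \<open>1 / b \<le> y < \<delta>\<close>; and \<open>y \<ge> \<delta>\<close>,
  where the kernel is at most \<open>2 / \<delta>\<close>.\<close>

lemma cos_nn_integral_upper:
  fixes g :: "real \<Rightarrow> real"
  assumes b: "0 < b" "1 / b < \<delta>" and K: "0 \<le> K" "\<And>y. 0 < y \<Longrightarrow> y < \<delta> \<Longrightarrow> g y \<le> K"
    and g: "integrable lborel (\<lambda>y. indicator {0<..} y * g y)" "\<And>y. 0 < y \<Longrightarrow> 0 \<le> g y"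
  shows "(\<integral>\<^sup>+y. ennreal (indicator {0<..} y * (g y * (1 - cos (b * y)) / y)) \<partial>lborel)
          \<le> ennreal (K * (ln (b * \<delta>) + 3) + 2 / \<delta> * (LBINT y. indicator {0<..} y * g y))"
proof -
  let ?f = "\<lambda>y. (1 - cos (b * y)) / y"
  note cb = cos_integral_bounds[OF b(1) less_imp_le[OF b(2)]]
  have b1: "0 < 1 / b" using b(1) by simp
  have pos: "0 < y" if "1 / b \<le> y" for y using that b1 by linarith
  have \<delta>: "0 < \<delta>" using b b1 by linarith
  have i1: "integrable lborel (\<lambda>y. K * (b * indicator {0<..<1 / b} y))"
    by (intro integrable_mult_right integrable_real_indicator) (use b1 in auto)
  have i2: "integrable lborel (\<lambda>y. K * (indicator {1 / b..\<delta>} y *\<^sub>R ?f y))"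
    using cb(1) unfolding set_integrable_def by (rule integrable_mult_right)
  have i3: "integrable lborel (\<lambda>y. 2 / \<delta> * (indicator {0<..} y * g y))"
    by (rule integrable_mult_right[OF g(1)])
  let ?S = "\<lambda>y. K * (b * indicator {0<..<1 / b} y) + K * (indicator {1 / b..\<delta>} y *\<^sub>R ?f y)
     + 2 / \<delta> * (indicator {0<..} y * g y)"
  have parts: "0 \<le> K * (b * indicator {0<..<1 / b} y)" "0 \<le> K * (indicator {1 / b..\<delta>} y *\<^sub>R ?f y)"
    "0 \<le> 2 / \<delta> * (indicator {0<..} y * g y)" for y
    using K b pos[of y] \<delta> g(2)[of y] by (auto simp: indicator_def less_imp_le)
  have "(\<integral>\<^sup>+y. ennreal (indicator {0<..} y * (g y * (1 - cos (b * y)) / y)) \<partial>lborel) \<le> (\<integral>\<^sup>+y. ennreal (?S y) \<partial>lborel)"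
  proof (intro nn_integral_mono ennreal_leI)
    fix y :: real
    show "indicator {0<..} y * (g y * (1 - cos (b * y)) / y) \<le> ?S y"
    proof (cases "0 < y")
      case y: True
      have f: "0 \<le> ?f y" using y by simp
      have l: "indicator {0<..} y * (g y * (1 - cos (b * y)) / y) = g y * ?f y" using y by simp
      consider "y < 1 / b" | "1 / b \<le> y" "y < \<delta>" | "\<delta> \<le> y" by linarith
      thus ?thesis
      proof cases
        case 1
        have "?f y \<le> b * y / y" using one_minus_cos_le[of "b * y"] b y by (intro divide_right_mono) auto
        hence "g y * ?f y \<le> K * b" using K(2)[of y] 1 b y f K(1) by (intro mult_mono) auto
        moreover have "K * (b * indicator {0<..<1 / b} y) = K * b" using 1 y by simp
        ultimately show ?thesis using parts(2,3)[of y] unfolding l by linarith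
      next
        case 2
        hence "g y * ?f y \<le> K * ?f y" using K(2)[of y] y f by (intro mult_right_mono) auto
        moreover have "K * (indicator {1 / b..\<delta>} y *\<^sub>R ?f y) = K * ?f y" using 2 by simp
        ultimately show ?thesis using parts(1,3)[of y] unfolding l by linarith
      next
        case 3
        have "?f y \<le> 2 / \<delta>" using 3 y \<delta> cos_ge_minus_one[of "b * y"] by (intro frac_le) auto
        hence "g y * ?f y \<le> g y * (2 / \<delta>)" using g(2)[OF y] by (intro mult_left_mono) auto
        moreover have "2 / \<delta> * (indicator {0<..} y * g y) = g y * (2 / \<delta>)" using y by simp
        ultimately show ?thesis using parts(1,2)[of y] unfolding l by linarith
      qed
    next
      case False
      thus ?thesis using parts[of y] by simp
    qed
  qed
  also have "\<dots> = ennreal (LBINT y. ?S y)"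
  proof (rule nn_integral_eq_integral)
    show "integrable lborel ?S" by (rule Bochner_Integration.integrable_add[OF Bochner_Integration.integrable_add[OF i1 i2] i3])
    show "AE y in lborel. 0 \<le> ?S y" by (intro AE_I2 add_nonneg_nonneg parts)
  qed
  also have "(LBINT y. ?S y) = K * (b * (1 / b)) + K * (LBINT y:{1 / b..\<delta>}. ?f y) + 2 / \<delta> * (LBINT y. indicator {0<..} y * g y)"
  proof -
    have e1: "(LBINT y. ?S y) = (LBINT y. K * (b * indicator {0<..<1 / b} y)) + (LBINT y. K * (indicator {1 / b..\<delta>} y *\<^sub>R ?f y))
       + (LBINT y. 2 / \<delta> * (indicator {0<..} y * g y))"
      by (simp only: Bochner_Integration.integral_add[OF Bochner_Integration.integrable_add[OF i1 i2] i3]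
          Bochner_Integration.integral_add[OF i1 i2])
    have e2: "(LBINT y. indicator {0<..<1 / b} y) = 1 / b" using b1 by simp
    show ?thesis unfolding e1 set_lebesgue_integral_def integral_mult_right_zero e2 ..
  qed
  also have "ennreal \<dots> \<le> ennreal (K * (ln (b * \<delta>) + 3) + 2 / \<delta> * (LBINT y. indicator {0<..} y * g y))"
  proof (rule ennreal_leI)
    have "K * (LBINT y:{1 / b..\<delta>}. ?f y) \<le> K * (ln (b * \<delta>) + 2)" using cb K by (intro mult_left_mono) auto
    thus "K * (b * (1 / b)) + K * (LBINT y:{1 / b..\<delta>}. ?f y) + 2 / \<delta> * (LBINT y. indicator {0<..} y * g y)
        \<le> K * (ln (b * \<delta>) + 3) + 2 / \<delta> * (LBINT y. indicator {0<..} y * g y)"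
      using b by (simp add: algebra_simps)
  qed
  finally show ?thesis .
qed

text \<open>The amount by which the real part at \<open>x + i b\<close> exceeds the value at \<open>x\<close>.\<close>

definition cos_integral :: "real measure \<Rightarrow> real \<Rightarrow> real \<Rightarrow> real" where
  "cos_integral \<mu> b x = (LINT y|\<mu>. exp (- x * y) * (1 - cos (b * y)))"

text \<open>Tonelli's theorem, with \<open>\<integral> exp (- x y) dx = exp (- a y) / y\<close> over \<open>x > a\<close>.\<close>

lemma cos_integral_nn_integral:
  assumes mom: "exp_moment \<mu> 0" and a: "0 < a"
  shows "(\<integral>\<^sup>+x. ennreal (indicator {a<..} x * cos_integral \<mu> b x) \<partial>lborel) =
           (\<integral>\<^sup>+y. ennreal (exp (- a * y) * (1 - cos (b * y)) / y) \<partial>\<mu>)"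
    and "(\<lambda>x. indicator {a<..} x * cos_integral \<mu> b x) \<in> borel_measurable borel"
    and "\<And>x. 0 \<le> cos_integral \<mu> b x"
proof -
  note [measurable_cong] = mom[unfolded exp_moment_def, THEN conjunct1]
  have sets: "sets \<mu> = sets borel" and null: "emeasure \<mu> {..0} = 0"
    using mom by (auto simp: exp_moment_def)
  interpret M: sigma_finite_measure \<mu> by (rule levy_measure_sigma_finite[OF mom])
  interpret PP: pair_sigma_finite \<mu> lborel ..
  show nn: "0 \<le> cos_integral \<mu> b x" for x
    unfolding cos_integral_def by (rule integral_nonneg_AE) simp
  have [measurable]: "cos_integral \<mu> b \<in> borel_measurable lborel"
    unfolding cos_integral_def[abs_def] by measurable
  show "(\<lambda>x. indicator {a<..} x * cos_integral \<mu> b x) \<in> borel_measurable borel" by measurable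
  let ?F = "\<lambda>x y. ennreal (indicator {a<..} x * (exp (- x * y) * (1 - cos (b * y))))"
  have "(\<integral>\<^sup>+x. ennreal (indicator {a<..} x * cos_integral \<mu> b x) \<partial>lborel) = (\<integral>\<^sup>+x. (\<integral>\<^sup>+y. ?F x y \<partial>\<mu>) \<partial>lborel)"
  proof (rule nn_integral_cong)
    fix x :: real
    show "ennreal (indicator {a<..} x * cos_integral \<mu> b x) = (\<integral>\<^sup>+y. ?F x y \<partial>\<mu>)"
    proof (cases "a < x")
      case True
      have "(\<integral>\<^sup>+y. ennreal (exp (- x * y) * (1 - cos (b * y))) \<partial>\<mu>) = ennreal (cos_integral \<mu> b x)"
        unfolding cos_integral_def
        by (rule nn_integral_eq_integral[OF exp_moment_integrable_cos[OF mom]]) (use a True in auto)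
      thus ?thesis using True by simp
    qed simp
  qed
  also have "\<dots> = (\<integral>\<^sup>+y. (\<integral>\<^sup>+x. ?F x y \<partial>lborel) \<partial>\<mu>)"
    by (rule PP.Fubini') measurable
  also have "\<dots> = (\<integral>\<^sup>+y. ennreal (exp (- a * y) * (1 - cos (b * y)) / y) \<partial>\<mu>)"
  proof (rule nn_integral_cong_AE)
    show "AE y in \<mu>. (\<integral>\<^sup>+x. ?F x y \<partial>lborel) = ennreal (exp (- a * y) * (1 - cos (b * y)) / y)"
      using AE_pos[OF sets null]
    proof eventually_elim
      case (elim y)
      let ?c = "1 - cos (b * y)"
      note e = integral_exp_half_line[OF elim]
      have "(\<integral>\<^sup>+x. ?F x y \<partial>lborel) = (\<integral>\<^sup>+x. ?F (a + 1 * x) y \<partial>lborel)"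
        by (subst nn_integral_real_affine[where c = 1 and t = a]) auto
      also have "\<dots> = (\<integral>\<^sup>+x. ennreal (exp (- a * y) * ?c * (indicator {0<..} x * exp (- y * x))) \<partial>lborel)"
        by (intro nn_integral_cong arg_cong[where f = ennreal])
           (auto simp: indicator_def algebra_simps simp flip: exp_add)
      also have "\<dots> = ennreal (LBINT x. exp (- a * y) * ?c * (indicator {0<..} x * exp (- y * x)))"
        by (rule nn_integral_eq_integral[OF integrable_mult_right[OF e(1)]]) (auto intro!: AE_I2)
      also have "(LBINT x. exp (- a * y) * ?c * (indicator {0<..} x * exp (- y * x))) = exp (- a * y) * ?c / y"
        unfolding integral_mult_right_zero e(2) by simp
      finally show ?case .
    qed
  qed
  finally show "(\<integral>\<^sup>+x. ennreal (indicator {a<..} x * cos_integral \<mu> b x) \<partial>lborel) =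
           (\<integral>\<^sup>+y. ennreal (exp (- a * y) * (1 - cos (b * y)) / y) \<partial>\<mu>)" .
qed

lemma density_cos_nn_integral:
  assumes dens: "has_density \<mu> v"
  shows "(\<integral>\<^sup>+y. ennreal (exp (- a * y) * (1 - cos (b * y)) / y) \<partial>\<mu>) =
     (\<integral>\<^sup>+y. ennreal (indicator {0<..} y * ((v y * exp (- a * y)) * (1 - cos (b * y)) / y)) \<partial>lborel)"
proof -
  have [measurable]: "(\<lambda>y. indicator {0<..} y * v y) \<in> borel_measurable borel"
    using dens by (simp add: has_density_def set_borel_measurable_def)
  have v: "0 \<le> indicator {0<..} y * v y" for y using dens by (auto simp: has_density_def indicator_def)
  have "(\<integral>\<^sup>+y. ennreal (exp (- a * y) * (1 - cos (b * y)) / y) \<partial>\<mu>) =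
     (\<integral>\<^sup>+y. ennreal (indicator {0<..} y * v y) * ennreal (exp (- a * y) * (1 - cos (b * y)) / y) \<partial>lborel)"
    using dens unfolding has_density_def by (simp add: nn_integral_density)
  also have "\<dots> = (\<integral>\<^sup>+y. ennreal (indicator {0<..} y * ((v y * exp (- a * y)) * (1 - cos (b * y)) / y)) \<partial>lborel)"
  proof (rule nn_integral_cong)
    fix y
    show "ennreal (indicator {0<..} y * v y) * ennreal (exp (- a * y) * (1 - cos (b * y)) / y) =
        ennreal (indicator {0<..} y * ((v y * exp (- a * y)) * (1 - cos (b * y)) / y))"
      by (subst ennreal_mult'[OF v, symmetric]) (simp add: mult_ac)
  qed
  finally show ?thesis .
qed

section \<open>Polynomial decay\<close>

lemma levy_khintchine_no_drift_eq:
  assumes lk: "levy_khintchine \<phi> q 0 \<mu>" and fin: "integrable \<mu> (\<lambda>_. 1 :: real)" and z: "0 \<le> Re z"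
  shows "integrable \<mu> (\<lambda>y. exp (- z * of_real y))"
    and "\<phi> z = of_real (q + (LINT y|\<mu>. 1)) - (LINT y|\<mu>. exp (- z * of_real y))"
proof -
  have mom: "exp_moment \<mu> 0" by (rule levy_khintchine_exp_moment[OF lk])
  note [measurable_cong] = mom[unfolded exp_moment_def, THEN conjunct1]
  have sets: "sets \<mu> = sets borel" and null: "emeasure \<mu> {..0} = 0"
    using mom by (auto simp: exp_moment_def)
  show i: "integrable \<mu> (\<lambda>y. exp (- z * of_real y))"
  proof (rule Bochner_Integration.integrable_bound[OF fin])
    show "AE y in \<mu>. norm (exp (- z * of_real y)) \<le> norm (1::real)"
      using AE_pos[OF sets null] by eventually_elim (use z in simp)
  qed measurable
  have fin': "integrable \<mu> (\<lambda>_. 1 :: complex)" using integrable_of_real[OF fin, where 'a = complex] by simp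
  have "(LINT y|\<mu>. 1 - exp (- z * of_real y)) = (LINT y|\<mu>. 1) - (LINT y|\<mu>. exp (- z * of_real y))"
    by (rule Bochner_Integration.integral_diff[OF fin' i])
  also have "(LINT y|\<mu>. (1::complex)) = of_real (LINT y|\<mu>. 1)" by (simp add: scaleR_conv_of_real)
  finally show "\<phi> z = of_real (q + (LINT y|\<mu>. 1)) - (LINT y|\<mu>. exp (- z * of_real y))"
    using levy_khintchine_eq[OF lk z] by (simp add: lk_integral_def)
qed

lemma Re_bernstein_eq_cos_integral:
  assumes lk: "levy_khintchine \<phi> q d \<mu>" and x: "0 \<le> x"
  shows "Re (\<phi> (Complex x b)) = on_reals \<phi> x + cos_integral \<mu> b x"
  using Re_lk_integral[OF levy_khintchine_exp_moment[OF lk] order.refl x, of q d b]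
    levy_khintchine_eq[OF lk, of "Complex x b"] levy_khintchine_on_reals[OF lk x] x
  by (simp add: cos_integral_def)

text \<open>Here \<open>\<bar>\<phi>(x + i b)\<bar> \<ge> \<phi>(x) + m\<close> with \<open>m\<close> the cosine integral, and \<open>ln (1 + m / p) \<ge> m / (p + m)\<close>. For a finite
  measure the denominator is bounded by \<open>q\<close> plus three times the total mass, which gives \<open>c\<close>.\<close>

lemma A_ge_cos_integral:
  assumes bern: "\<phi> \<in> bernstein_functions" and lk: "levy_khintchine \<phi> q 0 \<mu>"
    and fin: "integrable \<mu> (\<lambda>_. 1 :: real)" and a: "0 < a"
  obtains c where "0 < c"
    "\<And>b. ennreal c * (\<integral>\<^sup>+x. ennreal (indicator {a<..} x * cos_integral \<mu> b x) \<partial>lborel) \<le> ennreal (A \<phi> (Complex a b))"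
proof -
  have mom: "exp_moment \<mu> 0" by (rule levy_khintchine_exp_moment[OF lk])
  have sets: "sets \<mu> = sets borel" and null: "emeasure \<mu> {..0} = 0"
    using mom by (auto simp: exp_moment_def)
  have q: "0 \<le> q" using lk by (simp add: levy_khintchine_def)
  define M where "M = (LINT y|\<mu>. (1::real))"
  have M: "0 \<le> M" unfolding M_def by simp
  have phi_le: "on_reals \<phi> x \<le> q + M" if "0 \<le> x" for x
  proof -
    have "(LINT y|\<mu>. 1 - exp (- x * y)) \<le> (LINT y|\<mu>. 1)"
      by (rule integral_mono[OF exp_moment_integrable_real[OF mom] fin]) (use that in auto)
    thus ?thesis using levy_khintchine_on_reals(1)[OF lk that] by (simp add: lk_real_def M_def)
  qed
  have m_le: "cos_integral \<mu> b x \<le> 2 * M" if "0 \<le> x" for b x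
  proof -
    have "cos_integral \<mu> b x \<le> (LINT y|\<mu>. 2 * 1)"
      unfolding cos_integral_def
    proof (rule integral_mono_AE)
      show "AE y in \<mu>. exp (- x * y) * (1 - cos (b * y)) \<le> 2 * 1"
        using AE_pos[OF sets null]
      proof eventually_elim
        case (elim y)
        have "exp (- x * y) * (1 - cos (b * y)) \<le> 1 * 2"
          using elim that cos_ge_minus_one[of "b * y"] by (intro mult_mono) auto
        thus ?case by simp
      qed
      show "integrable \<mu> (\<lambda>y. exp (- x * y) * (1 - cos (b * y)))"
        by (rule exp_moment_integrable_cos[OF mom order.refl that])
      show "integrable \<mu> (\<lambda>y. 2 * 1 :: real)" by (rule integrable_mult_right[OF fin])
    qed
    thus ?thesis by (simp add: M_def)
  qed
  define c where "c = 1 / (q + M + 2 * M)"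
  have "0 < on_reals \<phi> a" by (rule bernstein_pos[OF bern a])
  hence qM: "0 < q + M" using phi_le[of a] a by linarith
  hence c: "0 < c" using M by (auto simp: c_def intro!: divide_pos_pos add_pos_nonneg)
  have pw: "c * cos_integral \<mu> b x \<le> ln (norm (\<phi> (Complex x b)) / on_reals \<phi> x)" if x: "0 < x" for b x
  proof -
    let ?p = "on_reals \<phi> x" and ?m = "cos_integral \<mu> b x"
    have p: "0 < ?p" by (rule bernstein_pos[OF bern x])
    have m: "0 \<le> ?m" by (rule cos_integral_nn_integral(3)[OF mom x])
    have "c * ?m = ?m / (q + M + 2 * M)" by (simp add: c_def)
    also have "\<dots> \<le> ?m / (?p + ?m)"
      using phi_le[of x] m_le[of x b] p m x by (intro divide_left_mono mult_pos_pos) auto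
    also have "\<dots> = 1 - ?p / (?p + ?m)" using p m by (simp add: field_simps)
    also have "\<dots> \<le> - ln (?p / (?p + ?m))"
      using ln_le_minus_one[of "?p / (?p + ?m)"] p m by simp
    also have "\<dots> = ln ((?p + ?m) / ?p)" using p m by (simp add: ln_div)
    also have "\<dots> \<le> ln (norm (\<phi> (Complex x b)) / ?p)"
    proof (intro ln_mono divide_right_mono divide_pos_pos)
      show "?p + ?m \<le> norm (\<phi> (Complex x b))"
        using Re_bernstein_eq_cos_integral[OF lk, of x b] x complex_Re_le_cmod[of "\<phi> (Complex x b)"] by simp
    qed (use p m in auto)
    finally show ?thesis .
  qed
  have "ennreal c * (\<integral>\<^sup>+x. ennreal (indicator {a<..} x * cos_integral \<mu> b x) \<partial>lborel) \<le> ennreal (A \<phi> (Complex a b))" for b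
  proof -
    have "ennreal c * (\<integral>\<^sup>+x. ennreal (indicator {a<..} x * cos_integral \<mu> b x) \<partial>lborel) =
        (\<integral>\<^sup>+x. ennreal c * ennreal (indicator {a<..} x * cos_integral \<mu> b x) \<partial>lborel)"
      by (rule nn_integral_cmult[symmetric]) (use cos_integral_nn_integral(2)[OF mom a, of b] in simp)
    also have "\<dots> \<le> (\<integral>\<^sup>+x. ennreal (indicator {a<..} x * ln (norm (\<phi> (Complex x b)) / on_reals \<phi> x)) \<partial>lborel)"
    proof (rule nn_integral_mono)
      fix x :: real
      show "ennreal c * ennreal (indicator {a<..} x * cos_integral \<mu> b x) \<le>
          ennreal (indicator {a<..} x * ln (norm (\<phi> (Complex x b)) / on_reals \<phi> x))"
        using pw[of x b] a c by (cases "a < x") (auto simp: ennreal_mult'[symmetric] intro!: ennreal_leI)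
    qed
    also have "\<dots> = ennreal (A \<phi> (Complex a b))" by (rule A_nn_integral[OF bern a])
    finally show ?thesis .
  qed
  thus ?thesis using c that by blast
qed

lemma has_density_integrable:
  assumes dens: "has_density \<mu> v" and int: "integrable lborel (\<lambda>y. indicator {0<..} y * v y)"
  shows "integrable \<mu> (\<lambda>_. 1 :: real)"
proof -
  have [measurable]: "(\<lambda>y. indicator {0<..} y * v y) \<in> borel_measurable borel"
    using dens by (simp add: has_density_def set_borel_measurable_def)
  have v: "0 \<le> indicator {0<..} y * v y" for y using dens by (auto simp: has_density_def indicator_def)
  show ?thesis
    using dens int v unfolding has_density_def by (simp add: integrable_real_density)
qed

text \<open>Near 0 the density exceeds any constant \<open>K\<close>, and the range \<open>1 / b < y < \<delta>\<close> then contributes about \<open>K ln b\<close>.\<close>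

lemma A_superlogarithmic:
  assumes bern: "\<phi> \<in> bernstein_functions" and lk: "levy_khintchine \<phi> q 0 \<mu>"
    and dens: "has_density \<mu> v" and int: "integrable lborel (\<lambda>y. indicator {0<..} y * v y)"
    and top: "filterlim v at_top (at_right 0)" and a: "0 < a" and L: "0 < L"
  shows "\<forall>\<^sub>F b in at_top. L * ln b \<le> A \<phi> (Complex a b)"
proof -
  have mom: "exp_moment \<mu> 0" by (rule levy_khintchine_exp_moment[OF lk])
  obtain c where c: "0 < c"
    "\<And>b. ennreal c * (\<integral>\<^sup>+x. ennreal (indicator {a<..} x * cos_integral \<mu> b x) \<partial>lborel) \<le> ennreal (A \<phi> (Complex a b))"
    using A_ge_cos_integral[OF bern lk has_density_integrable[OF dens int] a] by metis
  \<comment> \<open>the factor 2 absorbs the constants \<open>ln \<delta> - 2\<close> for large \<open>b\<close>\<close>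
  define K where "K = 2 * L / c"
  have K: "0 < K" using c L by (simp add: K_def)
  have "((\<lambda>y. exp (- a * y)) \<longlongrightarrow> exp (- a * 0)) (at_right 0)" by (intro tendsto_intros)
  hence "filterlim (\<lambda>y. exp (- a * y) * v y) at_top (at_right 0)"
    by (rule filterlim_tendsto_pos_mult_at_top[OF _ _ top]) simp
  hence "\<forall>\<^sub>F y in at_right 0. K \<le> exp (- a * y) * v y" by (simp add: filterlim_at_top)
  then obtain \<delta> where \<delta>: "0 < \<delta>" "\<And>y. 0 < y \<Longrightarrow> y < \<delta> \<Longrightarrow> K \<le> v y * exp (- a * y)"
    unfolding eventually_at_right_field by (auto simp: mult.commute)
  show ?thesis
    using eventually_gt_at_top[of 1] eventually_gt_at_top[of "1 / \<delta>"] eventually_ge_at_top[of "exp (4 - 2 * ln \<delta>)"]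
  proof eventually_elim
    case (elim b)
    have b: "0 < b" "1 / b < \<delta>" using elim \<delta> by (auto simp: field_simps)
    have "4 - 2 * ln \<delta> \<le> ln b" using elim(3) b by (subst ln_ge_iff) auto
    hence "L * ln b \<le> L * (2 * (ln (b * \<delta>) - 2))"
      using L b \<delta> by (intro mult_left_mono) (auto simp: ln_mult)
    also have "\<dots> = c * (K * (ln (b * \<delta>) - 2))" using c by (simp add: K_def)
    finally have 1: "L * ln b \<le> c * (K * (ln (b * \<delta>) - 2))" .
    have "ennreal (L * ln b) \<le> ennreal c * ennreal (K * (ln (b * \<delta>) - 2))"
      unfolding ennreal_mult'[OF less_imp_le[OF c(1)], symmetric] by (rule ennreal_leI[OF 1])
    also have "ennreal (K * (ln (b * \<delta>) - 2)) \<le>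
        (\<integral>\<^sup>+y. ennreal (indicator {0<..} y * ((v y * exp (- a * y)) * (1 - cos (b * y)) / y)) \<partial>lborel)"
      by (rule cos_nn_integral_lower[OF b less_imp_le[OF K] \<delta>(2)])
    also have "\<dots> = (\<integral>\<^sup>+x. ennreal (indicator {a<..} x * cos_integral \<mu> b x) \<partial>lborel)"
      by (simp only: cos_integral_nn_integral(1)[OF mom a] density_cos_nn_integral[OF dens])
    also have "ennreal c * \<dots> \<le> ennreal (A \<phi> (Complex a b))" by (rule c(2))
    finally have "ennreal (L * ln b) \<le> ennreal (A \<phi> (Complex a b))" by (simp add: mult_left_mono)
    thus ?case using A_nonneg[OF bern a, of b] by (simp add: ennreal_le_iff)
  qed
qed

theorem poly_class_infinity_criterion:
  assumes bern: "\<phi> \<in> bernstein_functions"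
    and A: "\<And>a L. 0 < a \<Longrightarrow> 0 < L \<Longrightarrow> \<forall>\<^sub>F b in at_top. L * ln b \<le> A \<phi> (Complex a b)"
  shows "\<phi> \<in> poly_class_infinity"
proof -
  have "((\<lambda>b. \<bar>b\<bar> powr \<beta> * cmod (W \<phi> (Complex a b))) \<longlongrightarrow> 0) at_infinity"
    if a: "abar_index \<phi> < ereal a" and \<beta>: "0 \<le> \<beta>" for a \<beta>
  proof -
    obtain a' K where a': "0 < a'" "0 < K"
      "\<And>b. norm (W \<phi> (Complex a b)) \<le> K * norm (W \<phi> (Complex a' b))"
      using norm_W_shift_upper[OF bern a] by metis
    obtain K' where K': "\<And>b. ln (norm (W \<phi> (Complex a' b))) \<le> K' - A \<phi> (Complex a' b)"
      using norm_W_upper_by_A[OF bern a'(1)] by metis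
    show ?thesis
    proof (rule Lim_null_comparison)
      have "\<forall>\<^sub>F b in at_top. (\<beta> + 1) * ln b \<le> A \<phi> (Complex a' b) \<and> 0 < b"
        by (intro eventually_conj A a' eventually_gt_at_top) (use \<beta> in simp)
      hence "\<forall>\<^sub>F b::real in at_infinity. (\<beta> + 1) * ln (norm b) \<le> A \<phi> (Complex a' (norm b)) \<and> 0 < norm b"
        by (rule eventually_compose_filterlim[OF _ filterlim_norm_at_top])
      thus "\<forall>\<^sub>F b in at_infinity. norm (\<bar>b\<bar> powr \<beta> * cmod (W \<phi> (Complex a b))) \<le> K * exp K' * inverse \<bar>b\<bar>"
      proof eventually_elim
        case (elim b)
        have W': "W \<phi> (Complex a' b) \<noteq> 0" using W_limit(1)[OF bern, of "Complex a' b"] a'(1) by simp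
        have "ln (norm (W \<phi> (Complex a' b))) \<le> K' - (\<beta> + 1) * ln \<bar>b\<bar>"
          using K'[of b] elim A_even[OF bern a'(1), of b] by simp
        hence "norm (W \<phi> (Complex a' b)) \<le> exp (K' - (\<beta> + 1) * ln \<bar>b\<bar>)"
          using W' by (metis exp_le_cancel_iff exp_ln zero_less_norm_iff)
        also have "\<dots> = exp K' * \<bar>b\<bar> powr (- (\<beta> + 1))"
          using elim by (simp add: powr_def mult_exp_exp algebra_simps)
        finally have "\<bar>b\<bar> powr \<beta> * norm (W \<phi> (Complex a b)) \<le> \<bar>b\<bar> powr \<beta> * (K * (exp K' * \<bar>b\<bar> powr (- (\<beta> + 1))))"
          using a'(2) by (intro mult_left_mono order.trans[OF a'(3)]) auto
        also have "\<dots> = K * exp K' * (\<bar>b\<bar> powr \<beta> * \<bar>b\<bar> powr (- (\<beta> + 1)))" by simp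
        also have "\<bar>b\<bar> powr \<beta> * \<bar>b\<bar> powr (- (\<beta> + 1)) = inverse \<bar>b\<bar>"
          using elim by (simp add: powr_add[symmetric] powr_minus)
        finally show ?case by simp
      qed
      have "((\<lambda>b::real. inverse \<bar>b\<bar>) \<longlongrightarrow> 0) at_infinity"
        using tendsto_inverse_0_at_top[OF filterlim_norm_at_top[where 'a = real]] by simp
      from tendsto_mult_right_zero[OF this]
      show "((\<lambda>b. K * exp K' * inverse \<bar>b\<bar>) \<longlongrightarrow> 0) at_infinity" .
    qed
  qed
  thus ?thesis using bern by (simp add: poly_class_infinity_def)
qed

text \<open>The real part of the linear approximation of \<open>Ln (1 - w)\<close>.\<close>

lemma ln_norm_one_minus:
  assumes "norm w \<le> \<rho>" "\<rho> < 1"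
  shows "\<bar>ln (norm (1 - w)) + Re w\<bar> \<le> (norm w)\<^sup>2 / (1 - \<rho>)"
proof -
  have w: "norm (- w) < 1" using assms by simp
  have nz: "1 - w \<noteq> 0" using w by auto
  have "\<bar>ln (norm (1 - w)) + Re w\<bar> = \<bar>Re (Ln (1 + - w) - - w)\<bar>"
    using nz by (simp add: Re_Ln)
  also have "\<dots> \<le> norm (Ln (1 + - w) - - w)" by (rule abs_Re_le_cmod)
  also have "\<dots> \<le> (norm (- w))\<^sup>2 / (1 - norm (- w))" by (rule Ln_approx_linear[OF w])
  also have "\<dots> \<le> (norm w)\<^sup>2 / (1 - \<rho>)" using assms by (auto intro!: divide_left_mono mult_pos_pos)
  finally show ?thesis .
qed

text \<open>Write \<open>\<phi> = \<Phi> (1 - w)\<close> with \<open>\<Phi> = \<phi>(\<infinity>)\<close>. For a density bounded by \<open>S\<close> one has \<open>\<bar>w(x + i b)\<bar> \<le> S / (\<Phi> x)\<close>, so the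
  quadratic errors in \<open>ln \<bar>1 - w\<bar> = - Re w + O(\<bar>w\<bar>\<^sup>2)\<close> are integrable over \<open>x > a\<close>, uniformly in \<open>b\<close>. The
  linear part of the modulus integral is the cosine integral \<open>J(b) / \<Phi>\<close>, and \<open>J(b) / ln b\<close> tends to the limit of the density at 0.\<close>

lemma A_logarithmic:
  assumes bern: "\<phi> \<in> bernstein_functions" and lk: "levy_khintchine \<phi> q 0 \<mu>"
    and dens: "has_density \<mu> v" and int: "integrable lborel (\<lambda>y. indicator {0<..} y * v y)"
    and S: "\<And>y. 0 < y \<Longrightarrow> v y \<le> S" and v0: "(v \<longlongrightarrow> v0) (at_right 0)" and a: "0 < a"
  defines "\<Phi> \<equiv> q + (LINT y|\<mu>. 1)"
  shows "((\<lambda>b. A \<phi> (Complex a b) / ln b) \<longlongrightarrow> v0 / \<Phi>) at_top"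
proof -
  have mom: "exp_moment \<mu> 0" by (rule levy_khintchine_exp_moment[OF lk])
  have sets: "sets \<mu> = sets borel" and null: "emeasure \<mu> {..0} = 0"
    using mom by (auto simp: exp_moment_def)
  have fin: "integrable \<mu> (\<lambda>_. 1 :: real)" by (rule has_density_integrable[OF dens int])
  have vmeas: "(\<lambda>y. indicator {0<..} y * v y) \<in> borel_measurable borel"
    using dens by (simp add: has_density_def set_borel_measurable_def)
  have vnn: "0 \<le> v y" if "0 < y" for y using dens that by (simp add: has_density_def)
  have S0: "0 \<le> S" using S[of 1] vnn[of 1] by simp
  note phi = levy_khintchine_no_drift_eq[OF lk fin, folded \<Phi>_def]
  define h where "h z = (LINT y|\<mu>. exp (- z * complex_of_real y))" for z
  define hr where "hr x = (LINT y|\<mu>. exp (- x * y))" for x :: real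
  have int_hr: "integrable \<mu> (\<lambda>y. exp (- x * y))" if "0 \<le> x" for x :: real
  proof -
    have "(\<lambda>y. exp (- of_real x * of_real y)) = (\<lambda>y. complex_of_real (exp (- x * y)))"
      by (simp flip: exp_of_real)
    thus ?thesis using phi(1)[of "of_real x"] that by (simp only: complex_of_real_integrable_eq Re_complex_of_real)
  qed
  have h_norm: "norm (h (Complex x b)) \<le> hr x" if "0 \<le> x" for x b
    unfolding h_def hr_def
    by (rule integral_norm_bound_AE[OF phi(1) int_hr]) (use that in \<open>auto intro!: AE_I2\<close>)
  have phi_hr: "on_reals \<phi> x = \<Phi> - hr x" if "0 \<le> x" for x
  proof -
    have "\<phi> (of_real x) = of_real \<Phi> - h (of_real x)" using phi(2)[of "of_real x"] that by (simp add: h_def)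
    moreover have "h (of_real x) = of_real (hr x)"
    proof -
      have "(\<lambda>y. exp (- of_real x * of_real y)) = (\<lambda>y. complex_of_real (exp (- x * y)))"
        by (simp flip: exp_of_real)
      thus ?thesis unfolding h_def hr_def by (simp only: integral_complex_of_real)
    qed
    ultimately show ?thesis by (simp add: on_reals_def)
  qed
  have hr_nn: "0 \<le> hr x" for x unfolding hr_def by (rule integral_nonneg_AE) simp
  have hr_le: "hr x \<le> S / x" if x: "0 < x" for x
  proof -
    have v': "\<And>y. 0 \<le> indicator {0<..} y * v y" using vnn by (auto simp: indicator_def)
    have "hr x = (LBINT y. (indicator {0<..} y * v y) * exp (- x * y))"
      unfolding hr_def using dens vmeas v' by (simp add: has_density_def integral_real_density)
    also have "\<dots> \<le> (LBINT y. S * (indicator {0<..} y * exp (- x * y)))"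
    proof (rule integral_mono_AE)
      have "integrable \<mu> (\<lambda>y. exp (- x * y))" using int_hr x by simp
      thus "integrable lborel (\<lambda>y. (indicator {0<..} y * v y) * exp (- x * y))"
        using dens vmeas v' by (simp add: has_density_def integrable_real_density)
      show "integrable lborel (\<lambda>y. S * (indicator {0<..} y * exp (- x * y)))"
        by (rule integrable_mult_right[OF integral_exp_half_line(1)[OF x]])
      show "AE y in lborel. (indicator {0<..} y * v y) * exp (- x * y) \<le> S * (indicator {0<..} y * exp (- x * y))"
        using S by (intro AE_I2) (auto simp: indicator_def)
    qed
    also have "\<dots> = S / x" unfolding integral_mult_right_zero integral_exp_half_line(2)[OF x] by simp
    finally show ?thesis .
  qed
  have hr_anti: "hr x \<le> hr a" if "a \<le> x" for x
    using bernstein_mono[OF bern, of a x] phi_hr a that by simp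
  have pa: "0 < on_reals \<phi> a" by (rule bernstein_pos[OF bern a])
  have \<Phi>: "0 < \<Phi>" using pa phi_hr[of a] a hr_nn[of a] by simp
  define \<rho> where "\<rho> = hr a / \<Phi>"
  have \<rho>: "\<rho> < 1" using pa phi_hr[of a] a \<Phi> by (simp add: \<rho>_def)
  \<comment> \<open>one quadratic error from \<open>x + i b\<close> and one from \<open>x\<close>\<close>
  define C where "C = 2 * (S / \<Phi>)\<^sup>2 / (1 - \<rho>)"
  have C0: "0 \<le> C" using \<rho> by (simp add: C_def)
  let ?l = "\<lambda>b x. ln (norm (\<phi> (Complex x b)) / on_reals \<phi> x)"
  let ?m = "\<lambda>b x. cos_integral \<mu> b x"
  have close: "\<bar>?l b x - ?m b x / \<Phi>\<bar> \<le> C / x\<^sup>2" if x: "a < x" for b x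
  proof -
    have x0: "0 < x" using x a by simp
    define w where "w = h (Complex x b) / of_real \<Phi>"
    define u where "u = complex_of_real (hr x / \<Phi>)"
    have hx: "hr x / \<Phi> \<le> \<rho>" "hr x / \<Phi> \<le> (S / \<Phi>) / x"
      using hr_anti[of x] hr_le[OF x0] x \<Phi> by (auto simp: \<rho>_def field_simps)
    have nu: "norm u = hr x / \<Phi>" unfolding u_def norm_of_real using hr_nn[of x] \<Phi> by simp
    have nw: "norm w \<le> hr x / \<Phi>"
      using h_norm[of x b] x0 \<Phi> by (simp add: w_def norm_divide divide_right_mono)
    have phw: "\<phi> (Complex x b) = of_real \<Phi> * (1 - w)"
    proof -
      have "\<phi> (Complex x b) = of_real \<Phi> - h (Complex x b)"
        unfolding h_def by (rule phi(2)) (use x0 in simp)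
      also have "h (Complex x b) = of_real \<Phi> * w" using \<Phi> by (simp add: w_def)
      finally show ?thesis by (simp add: right_diff_distrib)
    qed
    have phu: "on_reals \<phi> x = \<Phi> * norm (1 - u)"
    proof -
      have "1 - u = complex_of_real (1 - hr x / \<Phi>)" by (simp add: u_def)
      hence "norm (1 - u) = 1 - hr x / \<Phi>" using hx(1) \<rho> by (simp only: norm_of_real)
      thus ?thesis using phi_hr[of x] x0 \<Phi> by (simp add: field_simps)
    qed
    have nz: "0 < norm (1 - w)" "0 < norm (1 - u)"
      using nw nu hx \<rho> by (auto simp: norm_eq_zero)
    have l: "?l b x = ln (norm (1 - w)) - ln (norm (1 - u))"
      using nz \<Phi> by (simp add: phw phu norm_mult ln_div)
    have m: "?m b x / \<Phi> = Re u - Re w"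
    proof -
      have "?m b x = Re (\<phi> (Complex x b)) - on_reals \<phi> x"
        using Re_bernstein_eq_cos_integral[OF lk, of x b] x0 by simp
      also have "\<dots> = \<Phi> * (Re u - Re w)"
        using phi_hr[of x] x0 \<Phi> by (simp add: phw u_def algebra_simps)
      finally show ?thesis using \<Phi> by simp
    qed
    have sq: "(norm w)\<^sup>2 \<le> ((S / \<Phi>) / x)\<^sup>2" "(norm u)\<^sup>2 \<le> ((S / \<Phi>) / x)\<^sup>2"
      using nw nu hx hr_nn[of x] \<Phi> by (auto intro!: power_mono)
    have "\<bar>ln (norm (1 - w)) + Re w\<bar> \<le> ((S / \<Phi>) / x)\<^sup>2 / (1 - \<rho>)"
      using ln_norm_one_minus[of w \<rho>] nw hx \<rho> sq(1) divide_right_mono[OF sq(1), of "1 - \<rho>"] by simp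
    moreover have "\<bar>ln (norm (1 - u)) + Re u\<bar> \<le> ((S / \<Phi>) / x)\<^sup>2 / (1 - \<rho>)"
      using ln_norm_one_minus[of u \<rho>] nu hx \<rho> sq(2) divide_right_mono[OF sq(2), of "1 - \<rho>"] by simp
    ultimately have "\<bar>?l b x - ?m b x / \<Phi>\<bar> \<le> 2 * (((S / \<Phi>) / x)\<^sup>2 / (1 - \<rho>))"
      unfolding l m by linarith
    also have "\<dots> = C / x\<^sup>2" by (simp add: C_def power_divide power_mult_distrib)
    finally show ?thesis .
  qed
  define J where "J b = (LBINT x. indicator {a<..} x * ?m b x)" for b
  have int_l: "integrable lborel (\<lambda>x. indicator {a<..} x * ?l b x)" for b
    using A_eq_modulus_integral(1)[OF bern a, of b] by (simp add: set_integrable_def)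
  have A_l: "A \<phi> (Complex a b) = (LBINT x. indicator {a<..} x * ?l b x)" for b
    using A_eq_modulus_integral(2)[OF bern a, of b] by (simp add: set_lebesgue_integral_def)
  have int_C: "integrable lborel (\<lambda>x. indicator {a<..} x * (C / x\<^sup>2))" and I_C: "(LBINT x. indicator {a<..} x * (C / x\<^sup>2)) = C / a"
    using integrable_inverse_square[of a 0 C] a by (auto simp: set_integrable_def set_lebesgue_integral_def)
  have int_m: "integrable lborel (\<lambda>x. indicator {a<..} x * ?m b x)" for b
  proof (rule Bochner_Integration.integrable_bound)
    show "integrable lborel (\<lambda>x. \<Phi> * (indicator {a<..} x * ?l b x + indicator {a<..} x * (C / x\<^sup>2)))"
      by (intro integrable_mult_right Bochner_Integration.integrable_add int_l int_C)
    show "AE x in lborel. norm (indicator {a<..} x * ?m b x) \<le> norm (\<Phi> * (indicator {a<..} x * ?l b x + indicator {a<..} x * (C / x\<^sup>2)))"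
    proof (intro AE_I2)
      fix x :: real
      show "norm (indicator {a<..} x * ?m b x) \<le> norm (\<Phi> * (indicator {a<..} x * ?l b x + indicator {a<..} x * (C / x\<^sup>2)))"
      proof (cases "a < x")
        case True
        have "?m b x / \<Phi> \<le> ?l b x + C / x\<^sup>2" using close[OF True, of b] by linarith
        hence "?m b x \<le> \<Phi> * (?l b x + C / x\<^sup>2)" using \<Phi> by (simp add: pos_divide_le_eq mult.commute)
        thus ?thesis using True cos_integral_nn_integral(3)[OF mom a, of b x] by simp
      qed simp
    qed
  qed (use cos_integral_nn_integral(2)[OF mom a, of b] in simp)
  have AJ: "\<bar>A \<phi> (Complex a b) - J b / \<Phi>\<bar> \<le> C / a" for b
  proof -
    have "A \<phi> (Complex a b) - J b / \<Phi> = (LBINT x. indicator {a<..} x * ?l b x - (indicator {a<..} x * ?m b x) / \<Phi>)"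
      unfolding A_l J_def
      by (subst Bochner_Integration.integral_diff[OF int_l integrable_divide[OF int_m]]) simp
    also have "norm \<dots> \<le> (LBINT x. indicator {a<..} x * (C / x\<^sup>2))"
    proof (rule integral_norm_bound_AE[OF Bochner_Integration.integrable_diff[OF int_l integrable_divide[OF int_m]] int_C])
      show "AE x in lborel. norm (indicator {a<..} x * ?l b x - (indicator {a<..} x * ?m b x) / \<Phi>) \<le> indicator {a<..} x * (C / x\<^sup>2)"
        using close by (intro AE_I2) (auto simp: indicator_def)
    qed
    finally show ?thesis unfolding I_C by simp
  qed
  define g where "g y = v y * exp (- a * y)" for y
  have J_nn: "ennreal (J b) = (\<integral>\<^sup>+y. ennreal (indicator {0<..} y * (g y * (1 - cos (b * y)) / y)) \<partial>lborel)" for b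
  proof -
    have "ennreal (J b) = (\<integral>\<^sup>+x. ennreal (indicator {a<..} x * ?m b x) \<partial>lborel)"
      unfolding J_def
      by (rule nn_integral_eq_integral[OF int_m, symmetric]) (use cos_integral_nn_integral(3)[OF mom a] in simp)
    thus ?thesis by (simp only: cos_integral_nn_integral(1)[OF mom a] density_cos_nn_integral[OF dens] g_def)
  qed
  have J0: "0 \<le> J b" for b
    unfolding J_def by (rule integral_nonneg_AE) (use cos_integral_nn_integral(3)[OF mom a] in simp)
  have g_nn: "0 \<le> g y" if "0 < y" for y using vnn[OF that] by (simp add: g_def)
  have g_int: "integrable lborel (\<lambda>y. indicator {0<..} y * g y)"
  proof (rule Bochner_Integration.integrable_bound[OF int])
    have "(\<lambda>y. (indicator {0<..} y * v y) * exp (- a * y)) \<in> borel_measurable lborel" using vmeas by measurable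
    thus "(\<lambda>y. indicator {0<..} y * g y) \<in> borel_measurable lborel" by (simp add: g_def mult.assoc)
    show "AE y in lborel. norm (indicator {0<..} y * g y) \<le> norm (indicator {0<..} y * v y)"
      using a vnn by (intro AE_I2) (auto simp: g_def indicator_def abs_mult mult_left_le)
  qed
  have g_lim: "(g \<longlongrightarrow> v0) (at_right 0)"
  proof -
    have "((\<lambda>y. v y * exp (- a * y)) \<longlongrightarrow> v0 * exp (- a * 0)) (at_right 0)" by (intro tendsto_intros v0)
    thus ?thesis by (simp add: g_def[abs_def])
  qed
  have v0_nn: "0 \<le> v0"
    by (rule tendsto_lowerbound[OF g_lim])
       (auto intro!: eventually_mono[OF eventually_at_right_less[of 0]] g_nn)
  define Mg where "Mg = (LBINT y. indicator {0<..} y * g y)"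
  have "((\<lambda>b. J b / ln b) \<longlongrightarrow> v0) at_top"
  proof (rule order_tendstoI)
    fix l assume l: "l < v0"
    \<comment> \<open>the lower bound on the cosine integral needs a nonnegative constant\<close>
    define K where "K = max 0 ((l + v0) / 2)"
    have K: "0 \<le> K" "l < K" using l by (auto simp: K_def less_max_iff_disj)
    show "\<forall>\<^sub>F b in at_top. l < J b / ln b"
    proof (cases "l < 0")
      case True
      show ?thesis using eventually_gt_at_top[of 1]
        by eventually_elim (use J0 True in \<open>auto intro: less_le_trans[of l 0]\<close>)
    next
      case False
      hence "K < v0" using l by (simp add: K_def)
      from order_tendstoD(1)[OF g_lim this] obtain \<delta> where \<delta>: "0 < \<delta>" "\<And>y. 0 < y \<Longrightarrow> y < \<delta> \<Longrightarrow> K < g y"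
        unfolding eventually_at_right_field by auto
      have "((\<lambda>b. K * (ln (b * \<delta>) - 2) / ln b) \<longlongrightarrow> K) at_top" using \<delta>(1) by real_asymp
      hence "\<forall>\<^sub>F b in at_top. l < K * (ln (b * \<delta>) - 2) / ln b" by (rule order_tendstoD(1)) (rule K)
      thus ?thesis using eventually_gt_at_top[of 1] eventually_gt_at_top[of "1 / \<delta>"]
      proof eventually_elim
        case (elim b)
        have b: "0 < b" "1 / b < \<delta>" using elim \<delta> by (auto simp: field_simps)
        have "ennreal (K * (ln (b * \<delta>) - 2)) \<le> ennreal (J b)"
          unfolding J_nn by (rule cos_nn_integral_lower[OF b K(1)]) (use \<delta>(2) less_imp_le in blast)
        hence "K * (ln (b * \<delta>) - 2) \<le> J b" using J0 by (simp add: ennreal_le_iff)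
        hence "K * (ln (b * \<delta>) - 2) / ln b \<le> J b / ln b" using elim by (intro divide_right_mono) auto
        thus ?case using elim by linarith
      qed
    qed
  next
    fix l assume l: "v0 < l"
    define K where "K = (l + v0) / 2"
    have K: "0 \<le> K" "K < l" "v0 < K" using l v0_nn by (auto simp: K_def)
    from order_tendstoD(2)[OF g_lim K(3)] obtain \<delta> where \<delta>: "0 < \<delta>" "\<And>y. 0 < y \<Longrightarrow> y < \<delta> \<Longrightarrow> g y < K"
      unfolding eventually_at_right_field by auto
    have "((\<lambda>b. (K * (ln (b * \<delta>) + 3) + 2 / \<delta> * Mg) / ln b) \<longlongrightarrow> K) at_top" using \<delta>(1) by real_asymp
    hence "\<forall>\<^sub>F b in at_top. (K * (ln (b * \<delta>) + 3) + 2 / \<delta> * Mg) / ln b < l" by (rule order_tendstoD(2)) (rule K)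
    thus "\<forall>\<^sub>F b in at_top. J b / ln b < l" using eventually_gt_at_top[of 1] eventually_gt_at_top[of "1 / \<delta>"]
    proof eventually_elim
      case (elim b)
      have b: "0 < b" "1 / b < \<delta>" using elim \<delta> by (auto simp: field_simps)
      have bd: "1 \<le> b * \<delta>" using b by (simp add: field_simps)
      have "ennreal (J b) \<le> ennreal (K * (ln (b * \<delta>) + 3) + 2 / \<delta> * Mg)"
        unfolding J_nn Mg_def
        by (rule cos_nn_integral_upper[OF b K(1) _ g_int g_nn]) (use \<delta>(2) less_imp_le in blast)
      moreover have "0 \<le> Mg" unfolding Mg_def by (rule integral_nonneg_AE) (use g_nn in \<open>auto simp: indicator_def\<close>)
      hence "0 \<le> K * (ln (b * \<delta>) + 3) + 2 / \<delta> * Mg"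
        using K \<delta> bd by (intro add_nonneg_nonneg mult_nonneg_nonneg) auto
      ultimately have "J b \<le> K * (ln (b * \<delta>) + 3) + 2 / \<delta> * Mg" by (simp add: ennreal_le_iff)
      hence "J b / ln b \<le> (K * (ln (b * \<delta>) + 3) + 2 / \<delta> * Mg) / ln b" using elim by (intro divide_right_mono) auto
      thus ?case using elim by linarith
    qed
  qed
  hence "((\<lambda>b. J b / ln b / \<Phi>) \<longlongrightarrow> v0 / \<Phi>) at_top" using \<Phi> by (intro tendsto_intros) auto
  moreover have "((\<lambda>b. (A \<phi> (Complex a b) - J b / \<Phi>) / ln b) \<longlongrightarrow> 0) at_top"
  proof (rule Lim_null_comparison)
    show "((\<lambda>b::real. (C / a) / ln b) \<longlongrightarrow> 0) at_top"
      by (intro tendsto_divide_0[OF tendsto_const] filterlim_at_top_imp_at_infinity ln_at_top)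
    show "\<forall>\<^sub>F b in at_top. norm ((A \<phi> (Complex a b) - J b / \<Phi>) / ln b) \<le> (C / a) / ln b"
      using eventually_gt_at_top[of 1]
    proof eventually_elim
      case (elim b)
      have "norm ((A \<phi> (Complex a b) - J b / \<Phi>) / ln b) = \<bar>A \<phi> (Complex a b) - J b / \<Phi>\<bar> / ln b"
        using elim by simp
      also have "\<dots> \<le> (C / a) / ln b" using elim by (intro divide_right_mono AJ) simp
      finally show ?case .
    qed
  qed
  ultimately have "((\<lambda>b. J b / ln b / \<Phi> + (A \<phi> (Complex a b) - J b / \<Phi>) / ln b) \<longlongrightarrow> v0 / \<Phi> + 0) at_top"
    by (rule tendsto_add)
  thus ?thesis by (simp add: diff_divide_distrib mult.commute)
qed

lemma bernstein_limit_eq: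
  assumes lk: "levy_khintchine \<phi> q 0 \<mu>" and fin: "integrable \<mu> (\<lambda>_. 1 :: real)"
  shows "bernstein_limit \<phi> = ereal (q + (LINT y|\<mu>. 1))"
proof -
  have mom: "exp_moment \<mu> 0" by (rule levy_khintchine_exp_moment[OF lk])
  note [measurable_cong] = mom[unfolded exp_moment_def, THEN conjunct1]
  have sets: "sets \<mu> = sets borel" and null: "emeasure \<mu> {..0} = 0"
    using mom by (auto simp: exp_moment_def)
  have "((\<lambda>u. LINT y|\<mu>. 1 - exp (- u * y)) \<longlongrightarrow> (LINT y|\<mu>. 1)) at_top"
  proof (rule integral_dominated_convergence_at_top[where w = "\<lambda>_. 1"])
    show "AE y in \<mu>. ((\<lambda>u. 1 - exp (- u * y)) \<longlongrightarrow> 1) at_top"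
      using AE_pos[OF sets null]
    proof eventually_elim
      case (elim y)
      thus ?case by real_asymp
    qed
    show "\<forall>\<^sub>F u in at_top. AE y in \<mu>. norm (1 - exp (- u * y)) \<le> 1"
      using eventually_ge_at_top[of 0]
    proof eventually_elim
      case (elim u)
      show ?case using AE_pos[OF sets null] by eventually_elim (use elim in auto)
    qed
  qed (use fin in measurable)
  hence "((\<lambda>u. q + (LINT y|\<mu>. 1 - exp (- u * y))) \<longlongrightarrow> q + (LINT y|\<mu>. 1)) at_top"
    by (intro tendsto_intros)
  moreover have "\<forall>\<^sub>F u in at_top. q + (LINT y|\<mu>. 1 - exp (- u * y)) = on_reals \<phi> u"
    using eventually_ge_at_top[of 0]
    by eventually_elim (simp add: levy_khintchine_on_reals(1)[OF lk] lk_real_def)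
  ultimately have "(on_reals \<phi> \<longlongrightarrow> q + (LINT y|\<mu>. 1)) at_top" by (rule Lim_transform_eventually)
  hence "((\<lambda>u. ereal (on_reals \<phi> u)) \<longlongrightarrow> ereal (q + (LINT y|\<mu>. 1))) at_top" by simp
  thus ?thesis unfolding bernstein_limit_def by (intro tendsto_Lim) auto
qed

lemma norm_W_lower_by_A:
  assumes bern: "\<phi> \<in> bernstein_functions" and a: "0 < a" and B: "\<And>b. norm (\<phi> (Complex a b)) \<le> B"
  obtains K where "\<And>b. K - A \<phi> (Complex a b) \<le> ln (norm (W \<phi> (Complex a b)))"
proof (rule that)
  fix b
  have "ln (norm (\<phi> (Complex a b))) \<le> ln B"
    using bernstein_nonzero[OF bern, of "Complex a b"] B[of b] a by (intro ln_mono) auto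
  thus "((log_on_reals \<phi> 1 - log_on_reals \<phi> a - log_on_reals \<phi> (1 + a) - ln B) / 2
             + G \<phi> a - 4 / a - 4) - A \<phi> (Complex a b) \<le> ln (norm (W \<phi> (Complex a b)))"
    using ln_norm_W[OF bern, of "Complex a b"] E_bound[OF bern, of "Complex a b"] R_bound[OF bern a] a
    unfolding abs_le_iff complex.sel by argo
qed

text \<open>A finite measure with an exponential moment integrates \<open>exp (- a y)\<close>, so the continuation is bounded on the half-plane
  \<open>Re z \<ge> a\<close>.\<close>

lemma bernstein_ext_norm_le:
  assumes bern: "\<phi> \<in> bernstein_functions" and lk: "levy_khintchine \<phi> q 0 \<mu>"
    and fin: "integrable \<mu> (\<lambda>_. 1 :: real)" and a: "abar_index \<phi> < ereal a"
  obtains B where "0 < B" "\<And>z. a \<le> Re z \<Longrightarrow> norm (bernstein_ext \<phi> z) \<le> B"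
proof -
  have q: "0 \<le> q" using lk by (simp add: levy_khintchine_def)
  obtain c where c: "c \<le> 0" "c < a" "exp_moment \<mu> c"
    "\<And>z. a \<le> Re z \<Longrightarrow> bernstein_ext \<phi> z = lk_integral q 0 \<mu> z"
    using abar_index_continuation[OF bern lk a] by metis
  have sets: "sets \<mu> = sets borel" and null: "emeasure \<mu> {..0} = 0"
    and int: "integrable \<mu> (\<lambda>y. min 1 y * exp (- c * y))"
    using c(3) by (auto simp: exp_moment_def)
  let ?d = "\<lambda>y. (1 + exp (- c)) * 1 + min 1 y * exp (- c * y)"
  have d: "integrable \<mu> ?d" by (intro Bochner_Integration.integrable_add integrable_mult_right fin int)
  have "norm (bernstein_ext \<phi> z) \<le> q + 1 + (LINT y|\<mu>. ?d y)" if z: "a \<le> Re z" for z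
  proof -
    have "norm (LINT y|\<mu>. 1 - exp (- z * of_real y)) \<le> (LINT y|\<mu>. ?d y)"
    proof (rule integral_norm_bound_AE[OF exp_moment_integrable[OF c(3,1)] d])
      show "AE y in \<mu>. norm (1 - exp (- z * of_real y)) \<le> ?d y"
        using AE_pos[OF sets null]
      proof eventually_elim
        case (elim y)
        have "norm (1 - exp (- z * of_real y)) \<le> 1 + exp (- Re z * y)"
          by (rule order.trans[OF norm_triangle_ineq4]) simp
        also have "exp (- Re z * y) \<le> exp (- c * y)"
          using elim z c(2) by (auto intro: mult_right_mono)
        also have "exp (- c * y) \<le> exp (- c) + min 1 y * exp (- c * y)"
        proof (cases "y \<le> 1")
          case True
          have "- c * y \<le> - c * 1" using True c(1) by (intro mult_left_mono) auto
          hence "exp (- c * y) \<le> exp (- c)" by simp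
          thus ?thesis using elim by (simp add: add_increasing2)
        qed simp
        finally show ?case by simp
      qed
    qed (use c z in auto)
    moreover have "norm (lk_integral q 0 \<mu> z) \<le> q + norm (LINT y|\<mu>. 1 - exp (- z * of_real y))"
      unfolding lk_integral_def using q
      by (simp add: order.trans[OF norm_triangle_ineq])
    ultimately show ?thesis using c(4)[OF z] by simp
  qed
  moreover have "0 \<le> (LINT y|\<mu>. ?d y)"
    by (rule integral_nonneg_AE) (use AE_pos[OF sets null] in \<open>auto elim!: eventually_mono\<close>)
  hence "0 < q + 1 + (LINT y|\<mu>. ?d y)" using q by simp
  ultimately show ?thesis using that by blast
qed

text \<open>For a finite measure \<open>\<phi>\<close> is bounded above and below on vertical lines, so \<open>\<bar>W(a + i b)\<bar>\<close> is comparable to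
  \<open>exp (- A(a + i b))\<close>, and the shift lemmas transfer this comparison to all admissible abscissae.\<close>

theorem poly_class_criterion:
  assumes bern: "\<phi> \<in> bernstein_functions" and lk: "levy_khintchine \<phi> q 0 \<mu>"
    and fin: "integrable \<mu> (\<lambda>_. 1 :: real)"
    and A: "\<And>a. 0 < a \<Longrightarrow> ((\<lambda>b. A \<phi> (Complex a b) / ln b) \<longlongrightarrow> \<beta>) at_top"
  shows "\<phi> \<in> poly_class \<beta>"
proof -
  have bounds: "\<forall>\<^sub>F b::real in at_infinity. (\<beta> - \<epsilon>) * ln \<bar>b\<bar> \<le> A \<phi> (Complex a b) \<and>
      A \<phi> (Complex a b) \<le> (\<beta> + \<epsilon>) * ln \<bar>b\<bar> \<and> 0 < \<bar>b\<bar>" if "0 < \<epsilon>" "0 < a" for a \<epsilon>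
  proof -
    have "\<forall>\<^sub>F b in at_top. (\<beta> - \<epsilon>) * ln b \<le> A \<phi> (Complex a b) \<and> A \<phi> (Complex a b) \<le> (\<beta> + \<epsilon>) * ln b \<and> 0 < b"
    proof -
      have "\<forall>\<^sub>F b in at_top. \<beta> - \<epsilon> < A \<phi> (Complex a b) / ln b"
        "\<forall>\<^sub>F b in at_top. A \<phi> (Complex a b) / ln b < \<beta> + \<epsilon>"
        using order_tendstoD[OF A[OF that(2)]] that(1) by auto
      thus ?thesis using eventually_gt_at_top[of 1]
      proof eventually_elim
        case (elim b)
        have "0 < ln b" using elim by simp
        hence "(\<beta> - \<epsilon>) * ln b < A \<phi> (Complex a b)" "A \<phi> (Complex a b) < (\<beta> + \<epsilon>) * ln b"
          using elim(1,2) by (simp_all only: pos_less_divide_eq pos_divide_less_eq)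
        thus ?case using elim by simp
      qed
    qed
    hence "\<forall>\<^sub>F b::real in at_infinity. (\<beta> - \<epsilon>) * ln (norm b) \<le> A \<phi> (Complex a (norm b)) \<and>
        A \<phi> (Complex a (norm b)) \<le> (\<beta> + \<epsilon>) * ln (norm b) \<and> 0 < norm b"
      by (rule eventually_compose_filterlim[OF _ filterlim_norm_at_top])
    thus ?thesis using A_even[OF bern that(2)] by simp
  qed
  have lim0: "((\<lambda>b::real. K * \<bar>b\<bar> powr (- \<epsilon>)) \<longlongrightarrow> 0) at_infinity" if "0 < \<epsilon>" for \<epsilon> K
  proof -
    have "((\<lambda>b::real. norm b powr (- \<epsilon>)) \<longlongrightarrow> 0) at_infinity"
      by (rule tendsto_neg_powr[OF _ filterlim_norm_at_top]) (use that in simp)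
    from tendsto_mult_right_zero[OF this, of K] show ?thesis by simp
  qed
  have "((\<lambda>b. cmod (W \<phi> (Complex a b)) / \<bar>b\<bar> powr (- \<beta> + \<epsilon>)) \<longlongrightarrow> 0) at_infinity \<and>
        ((\<lambda>b. \<bar>b\<bar> powr (- \<beta> - \<epsilon>) / cmod (W \<phi> (Complex a b))) \<longlongrightarrow> 0) at_infinity"
    if a: "abar_index \<phi> < ereal a" and \<epsilon>: "0 < \<epsilon>" for a \<epsilon>
  proof
    obtain a' K where a': "0 < a'" "0 < K"
      "\<And>b. norm (W \<phi> (Complex a b)) \<le> K * norm (W \<phi> (Complex a' b))" "\<And>b. W \<phi> (Complex a b) \<noteq> 0"
      using norm_W_shift_upper[OF bern a] by metis
    obtain K' where K': "\<And>b. ln (norm (W \<phi> (Complex a' b))) \<le> K' - A \<phi> (Complex a' b)"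
      using norm_W_upper_by_A[OF bern a'(1)] by metis
    show "((\<lambda>b. cmod (W \<phi> (Complex a b)) / \<bar>b\<bar> powr (- \<beta> + \<epsilon>)) \<longlongrightarrow> 0) at_infinity"
    proof (rule Lim_null_comparison[OF _ lim0])
      show "\<forall>\<^sub>F b in at_infinity. norm (cmod (W \<phi> (Complex a b)) / \<bar>b\<bar> powr (- \<beta> + \<epsilon>)) \<le> (K * exp K') * \<bar>b\<bar> powr (- (\<epsilon> / 2))"
      proof (rule eventually_mono[OF bounds[OF half_gt_zero[OF \<epsilon>] a'(1)]])
        fix b assume *: "(\<beta> - \<epsilon> / 2) * ln \<bar>b\<bar> \<le> A \<phi> (Complex a' b) \<and>
            A \<phi> (Complex a' b) \<le> (\<beta> + \<epsilon> / 2) * ln \<bar>b\<bar> \<and> 0 < \<bar>b\<bar>"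
        have W': "W \<phi> (Complex a' b) \<noteq> 0" using W_limit(1)[OF bern, of "Complex a' b"] a'(1) by simp
        have "ln (norm (W \<phi> (Complex a' b))) \<le> K' - (\<beta> - \<epsilon> / 2) * ln \<bar>b\<bar>" using K'[of b] * by linarith
        hence "norm (W \<phi> (Complex a' b)) \<le> exp (K' - (\<beta> - \<epsilon> / 2) * ln \<bar>b\<bar>)"
          using W' by (metis exp_le_cancel_iff exp_ln zero_less_norm_iff)
        also have "\<dots> = exp K' * \<bar>b\<bar> powr (- (\<beta> - \<epsilon> / 2))"
          using * by (simp add: powr_def mult_exp_exp algebra_simps)
        finally have "norm (W \<phi> (Complex a b)) \<le> K * (exp K' * \<bar>b\<bar> powr (- (\<beta> - \<epsilon> / 2)))"
          using a'(2) by (intro order.trans[OF a'(3)] mult_left_mono) auto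
        hence "norm (W \<phi> (Complex a b)) / \<bar>b\<bar> powr (- \<beta> + \<epsilon>) \<le>
            K * (exp K' * \<bar>b\<bar> powr (- (\<beta> - \<epsilon> / 2))) / \<bar>b\<bar> powr (- \<beta> + \<epsilon>)"
          by (intro divide_right_mono) auto
        also have "\<dots> = K * exp K' * (\<bar>b\<bar> powr (- (\<beta> - \<epsilon> / 2)) / \<bar>b\<bar> powr (- \<beta> + \<epsilon>))" by simp
        also have "\<bar>b\<bar> powr (- (\<beta> - \<epsilon> / 2)) / \<bar>b\<bar> powr (- \<beta> + \<epsilon>) = \<bar>b\<bar> powr (- (\<epsilon> / 2))"
          by (simp add: powr_diff[symmetric])
        finally show "norm (cmod (W \<phi> (Complex a b)) / \<bar>b\<bar> powr (- \<beta> + \<epsilon>)) \<le> (K * exp K') * \<bar>b\<bar> powr (- (\<epsilon> / 2))"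
          by simp
      qed
    qed (use \<epsilon> in simp)
  next
    obtain B where B: "0 < B" "\<And>z. a \<le> Re z \<Longrightarrow> norm (bernstein_ext \<phi> z) \<le> B"
      using bernstein_ext_norm_le[OF bern lk fin a] by metis
    obtain a' K where a': "0 < a'" "0 < K"
      "\<And>b. norm (W \<phi> (Complex a' b)) \<le> K * norm (W \<phi> (Complex a b))"
      using norm_W_shift_lower[OF bern a B] by metis
    have Wnz: "W \<phi> (Complex a b) \<noteq> 0" for b using norm_W_shift_upper[OF bern a] by metis
    have "abar_index \<phi> < ereal a'"
    proof -
      have "u_index \<phi> \<le> 0" unfolding u_index_def by (intro Sup_least) auto
      moreover have "a_index \<phi> \<le> 0"
      proof -
        define U where "U = {u. u < 0 \<and> (\<exists>f. holomorphic_extension \<phi> u f)}"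
        have "Inf (ereal ` U) \<le> 0" if ne: "U \<noteq> {}"
        proof -
          obtain u where u: "u \<in> U" using ne by blast
          hence "Inf (ereal ` U) \<le> ereal u" by (intro Inf_lower imageI)
          also have "\<dots> \<le> 0" using u by (simp add: U_def)
          finally show ?thesis .
        qed
        thus ?thesis unfolding a_index_def Let_def U_def[symmetric] by simp
      qed
      ultimately have "abar_index \<phi> \<le> 0" by (simp add: abar_index_def)
      thus ?thesis using a'(1) by (simp add: order.strict_trans1)
    qed
    then obtain B' where B': "\<And>z. a' \<le> Re z \<Longrightarrow> norm (bernstein_ext \<phi> z) \<le> B'"
      using bernstein_ext_norm_le[OF bern lk fin] by metis
    have "norm (\<phi> (Complex a' b)) \<le> B'" for b
      using B'[of "Complex a' b"] a'(1) by (simp add: bernstein_ext_def)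
    then obtain K' where K': "\<And>b. K' - A \<phi> (Complex a' b) \<le> ln (norm (W \<phi> (Complex a' b)))"
      using norm_W_lower_by_A[OF bern a'(1)] by metis
    show "((\<lambda>b. \<bar>b\<bar> powr (- \<beta> - \<epsilon>) / cmod (W \<phi> (Complex a b))) \<longlongrightarrow> 0) at_infinity"
    proof (rule Lim_null_comparison[OF _ lim0])
      show "\<forall>\<^sub>F b in at_infinity. norm (\<bar>b\<bar> powr (- \<beta> - \<epsilon>) / cmod (W \<phi> (Complex a b))) \<le> (K * exp (- K')) * \<bar>b\<bar> powr (- (\<epsilon> / 2))"
      proof (rule eventually_mono[OF bounds[OF half_gt_zero[OF \<epsilon>] a'(1)]])
        fix b assume *: "(\<beta> - \<epsilon> / 2) * ln \<bar>b\<bar> \<le> A \<phi> (Complex a' b) \<and>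
            A \<phi> (Complex a' b) \<le> (\<beta> + \<epsilon> / 2) * ln \<bar>b\<bar> \<and> 0 < \<bar>b\<bar>"
        have W': "W \<phi> (Complex a' b) \<noteq> 0" using W_limit(1)[OF bern, of "Complex a' b"] a'(1) by simp
        have "K' - (\<beta> + \<epsilon> / 2) * ln \<bar>b\<bar> \<le> ln (norm (W \<phi> (Complex a' b)))" using K'[of b] * by linarith
        hence "exp (K' - (\<beta> + \<epsilon> / 2) * ln \<bar>b\<bar>) \<le> norm (W \<phi> (Complex a' b))"
          using W' by (metis exp_le_cancel_iff exp_ln zero_less_norm_iff)
        also have "\<dots> \<le> K * norm (W \<phi> (Complex a b))" by (rule a'(3))
        finally have le: "exp (K' - (\<beta> + \<epsilon> / 2) * ln \<bar>b\<bar>) \<le> K * norm (W \<phi> (Complex a b))" .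
        have "\<bar>b\<bar> powr (- \<beta> - \<epsilon>) / norm (W \<phi> (Complex a b)) = K * \<bar>b\<bar> powr (- \<beta> - \<epsilon>) / (K * norm (W \<phi> (Complex a b)))"
          using a'(2) by simp
        also have "\<dots> \<le> K * \<bar>b\<bar> powr (- \<beta> - \<epsilon>) / exp (K' - (\<beta> + \<epsilon> / 2) * ln \<bar>b\<bar>)"
          using a'(2) Wnz[of b] by (intro divide_left_mono le mult_pos_pos mult_nonneg_nonneg) auto
        also have "\<dots> = K * (\<bar>b\<bar> powr (- \<beta> - \<epsilon>) / exp (K' - (\<beta> + \<epsilon> / 2) * ln \<bar>b\<bar>))" by simp
        also have "\<bar>b\<bar> powr (- \<beta> - \<epsilon>) / exp (K' - (\<beta> + \<epsilon> / 2) * ln \<bar>b\<bar>) = exp (- K') * \<bar>b\<bar> powr (- (\<epsilon> / 2))"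
        proof -
          have p: "\<bar>b\<bar> powr x = exp (x * ln \<bar>b\<bar>)" for x using * by (simp add: powr_def)
          show ?thesis unfolding p exp_diff[symmetric] mult_exp_exp by (simp add: algebra_simps)
        qed
        finally show "norm (\<bar>b\<bar> powr (- \<beta> - \<epsilon>) / cmod (W \<phi> (Complex a b))) \<le> (K * exp (- K')) * \<bar>b\<bar> powr (- (\<epsilon> / 2))"
          by simp
      qed
    qed (use \<epsilon> in simp)
  qed
  thus ?thesis using bern by (simp add: poly_class_def)
qed

lemma poly_class_bounded_density:
  assumes bern: "\<phi> \<in> bernstein_functions" and lk: "levy_khintchine \<phi> q 0 \<mu>" and dens: "has_density \<mu> v"
    and v0: "(v \<longlongrightarrow> v0) (at_right 0)" and bdd: "bdd_above (v ` {0<..})"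
  shows "\<phi> \<in> poly_class (real_of_ereal (ereal v0 / bernstein_limit \<phi>))"
proof -
  have mom: "exp_moment \<mu> 0" by (rule levy_khintchine_exp_moment[OF lk])
  obtain S where S: "\<And>y. 0 < y \<Longrightarrow> v y \<le> S" using bdd by (auto simp: bdd_above_def)
  have [measurable]: "(\<lambda>y. indicator {0<..} y * v y) \<in> borel_measurable borel"
    using dens by (simp add: has_density_def set_borel_measurable_def)
  have v': "0 \<le> indicator {0<..} y * v y" for y using dens by (auto simp: has_density_def indicator_def)
  have S0: "0 \<le> S" using S[of 1] v'[of 1] by simp
  have "integrable \<mu> (\<lambda>y. min 1 y)" using mom by (simp add: exp_moment_def)
  hence "integrable lborel (\<lambda>y. (indicator {0<..} y * v y) * min 1 y)"
    using dens v' unfolding has_density_def by (simp add: integrable_real_density)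
  moreover have "integrable lborel (\<lambda>y::real. S * indicator {0<..<1} y :: real)"
    by (intro integrable_mult_right integrable_real_indicator) auto
  ultimately have "integrable lborel (\<lambda>y. (indicator {0<..} y * v y) * min 1 y + S * indicator {0<..<1} y)"
    by (rule Bochner_Integration.integrable_add)
  hence int: "integrable lborel (\<lambda>y. indicator {0<..} y * v y)"
  proof (rule Bochner_Integration.integrable_bound)
    show "AE y in lborel. norm (indicator {0<..} y * v y) \<le> norm ((indicator {0<..} y * v y) * min 1 y + S * indicator {0<..<1} y)"
    proof (intro AE_I2)
      fix y :: real
      have "indicator {0<..} y * v y \<le> (indicator {0<..} y * v y) * min 1 y + S * indicator {0<..<1} y"
        using S[of y] v'[of y] S0 by (cases "0 < y"; cases "y < 1") (auto simp: add_increasing)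
      thus "norm (indicator {0<..} y * v y) \<le> norm ((indicator {0<..} y * v y) * min 1 y + S * indicator {0<..<1} y)"
        using v'[of y] by simp
    qed
  qed measurable
  have fin: "integrable \<mu> (\<lambda>_. 1 :: real)" by (rule has_density_integrable[OF dens int])
  have pos: "0 < q + (LINT y|\<mu>. 1)"
  proof -
    have "(LINT y|\<mu>. 1 - exp (- 1 * y)) \<le> (LINT y|\<mu>. 1)"
      by (rule integral_mono[OF exp_moment_integrable_real[OF mom] fin]) auto
    thus ?thesis
      using bernstein_pos[OF bern, of 1] levy_khintchine_on_reals(1)[OF lk, of 1] by (simp add: lk_real_def)
  qed
  have "\<phi> \<in> poly_class (v0 / (q + (LINT y|\<mu>. 1)))"
    by (rule poly_class_criterion[OF bern lk fin A_logarithmic[OF bern lk dens int S v0]])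
  moreover have "real_of_ereal (ereal v0 / bernstein_limit \<phi>) = v0 / (q + (LINT y|\<mu>. 1))"
    unfolding bernstein_limit_eq[OF lk fin] using pos by simp
  ultimately show ?thesis by (simp only:)
qed

lemma poly_class_unbounded_density:
  assumes bern: "\<phi> \<in> bernstein_functions" and lk: "levy_khintchine \<phi> q 0 \<mu>" and dens: "has_density \<mu> v"
    and top: "filterlim v at_top (at_right 0)" and int: "set_integrable lborel {0<..} v"
  shows "\<phi> \<in> poly_class_infinity"
proof (rule poly_class_infinity_criterion[OF bern])
  have "integrable lborel (\<lambda>y. indicator {0<..} y * v y)" using int by (simp add: set_integrable_def)
  thus "\<forall>\<^sub>F b in at_top. L * ln b \<le> A \<phi> (Complex a b)" if "0 < a" "0 < L" for a L
    using A_superlogarithmic[OF bern lk dens _ top that] by blast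
qed

theorem theorem4p2:
  shows
    "((\<forall>\<phi>\<in>bernstein_functions. \<forall>a>0. \<forall>b.
        cmod (W \<phi> (Complex a b)) =
          sqrt (on_reals \<phi> 1) /
            sqrt (on_reals \<phi> a * on_reals \<phi> (1 + a) * cmod (\<phi> (Complex a b))) *
          exp (G \<phi> a - A \<phi> (Complex a b)) * exp (- E \<phi> (Complex a b) - R \<phi> a)) \<and>
     (\<forall>a>0. \<exists>c C. 0 < c \<and>
        ereal c \<le> (SUP \<phi>\<in>bernstein_functions. SUP z\<in>{z. a < Re z}.
                     ereal \<bar>exp (- E \<phi> z - R \<phi> (Re z))\<bar>) \<and>
        (SUP \<phi>\<in>bernstein_functions. SUP z\<in>{z. a < Re z}.
           ereal \<bar>exp (- E \<phi> z - R \<phi> (Re z))\<bar>) \<le> ereal C)) \<and>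
     (\<forall>\<phi>\<in>bernstein_functions. \<forall>b.
        (\<exists>r. r \<in> O[at_top](\<lambda>a. 1 / a) \<and>
           (\<forall>\<^sub>F a in at_top.
              cmod (W \<phi> (Complex a b)) =
                exp (- T \<phi>) / sqrt (cmod (\<phi> (Complex a b)) * on_reals \<phi> 1) *
                exp (a * ln (on_reals \<phi> a) - H \<phi> a + Hstar \<phi> a - A \<phi> (Complex a b)) *
                (1 + r a))) \<and>
        ((\<lambda>a. A \<phi> (Complex a b)) \<longlongrightarrow> 0) at_top) \<and>
     (\<forall>\<phi>\<in>bernstein_functions. \<forall>q d \<mu>.
        levy_khintchine \<phi> q d \<mu> \<and> 0 < d \<longrightarrow> \<phi> \<in> exp_class (pi / 2)) \<and>
     (\<forall>\<phi>\<in>bernstein_functions. \<forall>\<alpha>. 0 < \<alpha> \<and> \<alpha> < 1 \<and> \<phi> \<in> regular_class \<alpha> \<longrightarrow>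
        \<phi> \<in> exp_class (pi / 2 * \<alpha>)) \<and>
     (\<forall>\<phi>\<in>bernstein_functions. \<forall>q \<mu> v.
        levy_khintchine \<phi> q 0 \<mu> \<and> has_density \<mu> v \<longrightarrow>
          (\<forall>v0. (v \<longlongrightarrow> v0) (at_right 0) \<and> bdd_above (v ` {0<..}) \<longrightarrow>
             \<phi> \<in> poly_class (real_of_ereal (ereal v0 / bernstein_limit \<phi>))) \<and>
          (\<forall>v1 v2 C.
             filterlim v at_top (at_right 0) \<and> (\<forall>y>0. v y = v1 y + v2 y) \<and>
             set_integrable lborel {0<..} v1 \<and> set_integrable lborel {0<..} v2 \<and>
             (\<forall>y>0. 0 \<le> v1 y) \<and> antimono_on {0<..} v1 \<and>
             0 \<le> (LBINT y:{0<..}. v2 y) \<and> 0 < C \<and>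
             (\<forall>y>0. \<bar>v2 y\<bar> \<le> max (LBINT r:{y<..}. v1 r) C) \<longrightarrow>
             \<phi> \<in> poly_class_infinity))"
proof (intro conjI ballI allI impI)
  fix \<phi> :: "complex \<Rightarrow> complex" and a b :: real
  assume "\<phi> \<in> bernstein_functions" "0 < a"
  thus "cmod (W \<phi> (Complex a b)) =
          sqrt (on_reals \<phi> 1) /
            sqrt (on_reals \<phi> a * on_reals \<phi> (1 + a) * cmod (\<phi> (Complex a b))) *
          exp (G \<phi> a - A \<phi> (Complex a b)) * exp (- E \<phi> (Complex a b) - R \<phi> a)"
    by (rule norm_W_eq)
next
  fix a :: real assume "0 < a"
  thus "\<exists>c C. 0 < c \<and>
        ereal c \<le> (SUP \<phi>\<in>bernstein_functions. SUP z\<in>{z. a < Re z}.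
                     ereal \<bar>exp (- E \<phi> z - R \<phi> (Re z))\<bar>) \<and>
        (SUP \<phi>\<in>bernstein_functions. SUP z\<in>{z. a < Re z}.
           ereal \<bar>exp (- E \<phi> z - R \<phi> (Re z))\<bar>) \<le> ereal C"
    by (rule Stirling_error_bounds)
next
  fix \<phi> :: "complex \<Rightarrow> complex" and b :: real
  assume bern: "\<phi> \<in> bernstein_functions"
  show "\<exists>r. r \<in> O[at_top](\<lambda>a. 1 / a) \<and>
           (\<forall>\<^sub>F a in at_top.
              cmod (W \<phi> (Complex a b)) =
                exp (- T \<phi>) / sqrt (cmod (\<phi> (Complex a b)) * on_reals \<phi> 1) *
                exp (a * ln (on_reals \<phi> a) - H \<phi> a + Hstar \<phi> a - A \<phi> (Complex a b)) *
                (1 + r a))"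
    by (rule norm_W_asymptotics[OF bern])
  show "((\<lambda>a. A \<phi> (Complex a b)) \<longlongrightarrow> 0) at_top" by (rule A_tendsto_0[OF bern])
next
  fix \<phi> q d \<mu> assume "\<phi> \<in> bernstein_functions" "levy_khintchine \<phi> q d \<mu> \<and> 0 < d"
  thus "\<phi> \<in> exp_class (pi / 2)" using exp_class_drift by blast
next
  fix \<phi> \<alpha> assume "\<phi> \<in> bernstein_functions" "0 < \<alpha> \<and> \<alpha> < 1 \<and> \<phi> \<in> regular_class \<alpha>"
  thus "\<phi> \<in> exp_class (pi / 2 * \<alpha>)" using exp_class_regular by blast
next
  fix \<phi> q \<mu> v v0
  assume "\<phi> \<in> bernstein_functions" "levy_khintchine \<phi> q 0 \<mu> \<and> has_density \<mu> v"
    "(v \<longlongrightarrow> v0) (at_right 0) \<and> bdd_above (v ` {0<..})"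
  thus "\<phi> \<in> poly_class (real_of_ereal (ereal v0 / bernstein_limit \<phi>))"
    using poly_class_bounded_density by blast
next
  fix \<phi> q \<mu> v v1 v2 and C :: real
  assume bern: "\<phi> \<in> bernstein_functions" and lk: "levy_khintchine \<phi> q 0 \<mu> \<and> has_density \<mu> v"
    and v: "filterlim v at_top (at_right 0) \<and> (\<forall>y>0. v y = v1 y + v2 y) \<and>
             set_integrable lborel {0<..} v1 \<and> set_integrable lborel {0<..} v2 \<and>
             (\<forall>y>0. 0 \<le> v1 y) \<and> antimono_on {0<..} v1 \<and>
             0 \<le> (LBINT y:{0<..}. v2 y) \<and> 0 < C \<and>
             (\<forall>y>0. \<bar>v2 y\<bar> \<le> max (LBINT r:{y<..}. v1 r) C)"
  have "set_integrable lborel {0<..} (\<lambda>y. v1 y + v2 y)" using v by (intro set_integral_add(1)) auto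
  hence "set_integrable lborel {0<..} v"
    by (rule set_integrable_cong[THEN iffD1, rotated -1]) (use v in auto)
  thus "\<phi> \<in> poly_class_infinity"
    using poly_class_unbounded_density[OF bern] lk v by blast
qed

end
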